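(* Consider DLAG with $\kappa=\kappa_F/\zeta(U)$ and parameters $$\gamma=\frac{\alpha\beta\mu_{\min}^2}{288D\|\sqrt U\|^4}e^{-\frac{2D}{\sqrt\kappa}},\qquad c=\frac{\alpha\beta\mu_{\min}^2}{1200D\|\sqrt U\|^4}e^{-\frac{2(D+1)}{\sqrt\kappa}}<1,\qquad \eta=\frac{2}{15}\frac1\beta,\qquad s=10,$$ where at each iteration every worker applies Katyusha, warm started at its previous approximate dual gradient, with $\mathcal O(m+\sqrt{m\kappa_{\max}})$ stochastic gradient evaluations. Then there are positive constants $c_d$ ($1\le d\le D$) and $\tilde c_d$ ($d\ge1$), independent of $k$, such that the Lyapunov function $$L^k=2\eta s\kappa\big(G(\lambda^k)-G(\xi^\star)\big)+\|v^k-\xi^\star\|^2+\sum_{d=1}^{D}c_d\|\xi^{k+1-d}-\xi^{k-d}\|^2+\sum_{d=1}^{k}\tilde c_d\|\xi^{k+1-d}-\xi^{k-d}\|^2$$ satisfies $\mathbb E[L^{k+1}]\le\big(1-\frac1{\sqrt{10\kappa}}\big)\mathbb E[L^k]$ for every $k\ge0$. To obtain an $\varepsilon$-suboptimal solution of the dual problem $\min_{\xi\in\mathbb R^{d\times n}}G(\xi)$, DLAG needs an iteration complexity of $$\mathcal I_{\mathrm{DLAG}}(\varepsilon)=\mathcal O\big(\sqrt\kappa\log(1/\varepsilon)\big)$$ and a stochastic gradient complexity of $$\mathcal G_{\mathrm{DLAG}}(\varepsilon)=\mathcal O\big(n(m+\sqrt{m\kappa_{\max}})\sqrt\kappa\l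og(1/\varepsilon)\big).$$
   Context: Problem. There are $n$ workers. Worker $i$ has $f_i=\frac1m\sum_{j=1}^m f_{i,j}$ with $f_{i,j}:\mathbb R^d\to\mathbb R$ differentiable, $L_i$-smooth ($f_{i,j}(y)\le f_{i,j}(x)+\langle\nabla f_{i,j}(x),y-x\rangle+\frac{L_i}2\|y-x\|^2$) and $\mu_i$-strongly convex, $\mu_i>0$. Put $\kappa_i=L_i/\mu_i$, $\mu_{\min}=\min_i\mu_i$, $L_{\max}=\max_iL_i$, $\kappa_{\max}=\max_i\kappa_i$, $\kappa_F=L_{\max}/\mu_{\min}$. For $\Theta=(\theta_1,\dots,\theta_n)\in\mathbb R^{d\times n}$ let $F(\Theta)=\sum_if_i(\theta_i)$. A star denotes the convex conjugate, $\varphi^*(y)=\sup_x\{\langle y,x\rangle-\varphi(x)\}$; thus $F^*(x)=\sum_if_i^*(x_i)$. $\|\cdot\|$ is the Euclidean norm of vectors and the Frobenius norm of matrices. Network. $\mathcal G=(\{1,\dots,n\},\mathcal E)$ is an undirected graph, $\mathcal N(i)=\{j:(i,j)\in\mathcal E\}\cup\{i\}$. $W\in\mathbb R^{n\times n}$ is symmetric, $W_{ij}\ne0$ iff $(i,j)\in\mathcal E$, $U=I-W$ is positive semidefinite and $\mathrm{null}(U)=\mathrm{span}\{\mathbf 1\}$. Let $\sigma_1(U)\ge\dots\ge\sigma_{n-1}(U)>\sigma_n(U)=0$ be its eigenvalues, $\zeta(U)=\sigma_{n-1}(U)/\sigma_1(U)$, and $\sqrt U$ the positive semidefinite square root. Dual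 objective: $G(\xi)=F^*(\xi\sqrt U)$. Set $\beta=\sigma_1(U)/\mu_{\min}$, $\alpha=\sigma_{n-1}(U)/L_{\max}$, $\kappa=\beta/\alpha=\kappa_F/\zeta(U)$. DLAG. Parameters: step size $\eta>0$, $s\ge1$, $c\in(0,1)$, $\gamma>0$, maximal delay $D\ge1$ (integer). Initialization: $x^0=y^0=0\in\mathbb R^{d\times n}$, $\hat\theta_i^0=\theta_i^0=\nabla f_i^*(0)$, $d_i^0=0$. At iteration $k\ge1$ each worker $i$ computes $\theta_i^k\approx\arg\min_\theta\frac1m\sum_{j=1}^m(f_{i,j}(\theta)-\langle\theta,x_i^k\rangle)$ (exact minimizer $\nabla f_i^*(x_i^k)$) by Katyusha started at $\theta_i^{k-1}$, with fresh independent random samples. The lazy condition of worker $i$ at iteration $k$ is $$\|\hat\theta_i^{k-1}-\theta_i^k\|^2\le\frac3{\mu_{\min}^2}\Big[\sum_{j=0}^{k-D-1}c^{k-D-j}\delta_i^j+\sum_{j=0}^{k-1}c^{k-j}\delta_i^j+\sum_{j=k-D}^{k-1}c\,\delta_i^j+\sum_{j=k-D}^{k-1}\gamma\,\delta_i^j\Big],\quad\delta_i^j=\|x_i^j-x_i^{j+1}\|^2,$$ where empty sums and terms with negative $j$ are $0$. If it fails or $d_i^{k-1}=D$, worker $i$ sends $\theta_i^k-\hat\theta_i^{k-1}$ to all its neighbors and sets $\hat\theta_i^k=\theta_i^k$, $d_i^k=0$; otherwise it sends nothing and sets $\hat\theta_i^k=\hat\theta_i^{k-1}$, $d_i^k=d_i^{k-1}+1$.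 With $\hat\Theta^k=(\hat\theta_1^k,\dots,\hat\theta_n^k)$, for $k\ge0$: $$y^{k+1}=x^k-\eta\hat\Theta^kU,\qquad x^{k+1}=y^{k+1}+\tfrac{\sqrt{s\kappa}-1}{\sqrt{s\kappa}+1}(y^{k+1}-y^k).$$ Auxiliary sequences: $\xi^0=\lambda^0=0$, $\lambda^{k+1}=\xi^k-\eta\hat\Theta^k\sqrt U$, $\xi^{k+1}=\lambda^{k+1}+\frac{\sqrt{s\kappa}-1}{\sqrt{s\kappa}+1}(\lambda^{k+1}-\lambda^k)$, so $x^k=\xi^k\sqrt U$, $y^k=\lambda^k\sqrt U$; $\xi^j=\xi^0$ for $j<0$. $\xi^\star$ is the minimizer of $G$ in $\{\xi:\xi\mathbf 1=0\}$ (also a global minimizer), and $v^k=(1+\sqrt{s\kappa})\xi^k-\sqrt{s\kappa}\lambda^k$. Katyusha (Allen-Zhu). For $\min_\theta\frac1m\sum_jh_j(\theta)+\psi(\theta)$ with $h_j$ convex $L$-smooth, $\psi$ $\mu$-strongly convex, started at $\theta^{0}$: set $\tau_2=\frac12$, $\tau_1=\min\{\sqrt{2m\mu/(3L)},\frac12\}$, $a=\frac1{3\tau_1L}$, $p_0=z_0=\tilde u^0=\theta^0$. In epoch $e=0,1,\dots$ compute $g=\frac1m\sum_j\nabla h_j(\tilde u^e)$; for $l=0,\dots,2m-1$, with $t=2me+l$: $u_{t+1}=\tau_1z_t+\tau_2\tilde u^e+(1-\tau_1-\tau_2)p_t$; draw $j$ uniformly; $\tilde g=g+\nabla h_j(u_{t+1})-\nabla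 h_j(\tilde u^e)$; $z_{t+1}=\arg\min_z\{\frac1{2a}\|z-z_t\|^2+\langle\tilde g,z\rangle+\psi(z)\}$; $p_{t+1}=\arg\min_p\{\frac{3L}2\|p-u_{t+1}\|^2+\langle\tilde g,p\rangle+\psi(p)\}$. Then $\tilde u^{e+1}$ is the weighted average of $p_{2me+1},\dots,p_{2me+2m}$ with weights proportional to $(1+a\mu)^{l}$, $l=0,\dots,2m-1$. The output is the last $\tilde u^{e}$. Here $h_j=f_{i,j}-\frac{\mu_i}2\|\cdot\|^2$, $\psi(\theta)=\frac{\mu_i}2\|\theta\|^2-\langle\theta,x_i^k\rangle$, $L=L_i$, $\mu=\mu_i$. Each epoch costs $O(m)$ stochastic gradient evaluations. Complexity conventions. "Katyusha with $\mathcal O(m+\sqrt{m\kappa_{\max}})$ evaluations" means: at most a sufficiently large universal constant times $(m+\sqrt{m\kappa_{\max}})\log(2\kappa_{\max}/c)$ evaluations per worker per iteration (i.e. $\lceil C_0(1+\sqrt{\kappa_{\max}/m})\log(2\kappa_{\max}/c)\rceil$ epochs for a suitable universal $C_0$), the factor $\log(2\kappa_{\max}/c)$ being suppressed in $\mathcal O$. $\varepsilon$-suboptimality means $\mathbb E[G(\lambda^k)]-\min G\le\varepsilon$ (equivalently $\mathbb E[F^*(y^k)]-\min_{x\mathbf 1=0}F^*(x)\le\varepsilon$). The iteration complexity is the number of iterations to reach it; the stochastic gradient complexity is the total number of stochastic gradients used by all workers. In the complexity bounds the initial gap $L^0/(2\eta s\kappa)$ is treated as a constant. *)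

theory Defs
  imports "HOL-Probability.Probability"
begin

definition grad :: "('v::real_inner \<Rightarrow> real) \<Rightarrow> 'v \<Rightarrow> 'v" where
  "grad f x = (THE g. GDERIV f x :> g)"

definition smooth_with :: "real \<Rightarrow> ('v::real_inner \<Rightarrow> real) \<Rightarrow> bool" where
  "smooth_with L f \<longleftrightarrow>
     (\<forall>x y. f y \<le> f x + grad f x \<bullet> (y - x) + L / 2 * (norm (y - x))\<^sup>2)"

definition strongly_convex_with :: "real \<Rightarrow> ('v::real_inner \<Rightarrow> real) \<Rightarrow> bool" where
  "strongly_convex_with \<mu> f \<longleftrightarrow> convex_on UNIV (\<lambda>x. f x - \<mu> / 2 * (norm x)\<^sup>2)"

text \<open>The supremum is taken in the reals; it is finite for the strongly convex functions to which
  the conjugate is applied.\<close>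

definition conjugate :: "('v::real_inner \<Rightarrow> real) \<Rightarrow> 'v \<Rightarrow> real" where
  "conjugate \<phi> y = (SUP x. y \<bullet> x - \<phi> x)"

definition average :: "nat \<Rightarrow> (nat \<Rightarrow> 'v \<Rightarrow> real) \<Rightarrow> 'v \<Rightarrow> real" where
  "average m h \<theta> = (\<Sum>j<m. h j \<theta>) / real m"


text \<open>A real matrix with one column per worker has type \<^typ>\<open>'a^'n\<close>, where \<open>'a\<close> is the column
  space and \<open>X $ i\<close> is the column of worker \<open>i\<close>. Its norm is the Frobenius norm, and so is that of
  \<^typ>\<open>real^'n^'n\<close>.\<close>

definition rmult :: "'a::real_vector^'n \<Rightarrow> real^'n^'n \<Rightarrow> 'a^'n" where
  "rmult X A = (\<chi> i. \<Sum>j\<in>UNIV. (A $ j $ i) *\<^sub>R (X $ j))"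

definition primal :: "nat \<Rightarrow> ('n::finite \<Rightarrow> nat \<Rightarrow> 'a \<Rightarrow> real) \<Rightarrow> 'a^'n \<Rightarrow> real" where
  "primal m f \<Theta> = (\<Sum>i\<in>UNIV. average m (f i) (\<Theta> $ i))"

definition dual :: "nat \<Rightarrow> ('n::finite \<Rightarrow> nat \<Rightarrow> 'a::real_inner \<Rightarrow> real) \<Rightarrow> real^'n^'n \<Rightarrow> 'a^'n \<Rightarrow> real" where
  "dual m f sqrtU \<xi> = conjugate (primal m f) (rmult \<xi> sqrtU)"

definition pos_semidef :: "real^'n^'n \<Rightarrow> bool" where
  "pos_semidef A \<longleftrightarrow> transpose A = A \<and> (\<forall>v. 0 \<le> v \<bullet> (A *v v))"

text \<open>\<open>\<sigma> 1 \<ge> \<dots> \<ge> \<sigma> n\<close> are the eigenvalues of \<open>A\<close> with multiplicity, i.e. the roots of the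
  characteristic polynomial.\<close>

definition eigenvalues_desc :: "real^'n^'n \<Rightarrow> (nat \<Rightarrow> real) \<Rightarrow> bool" where
  "eigenvalues_desc A \<sigma> \<longleftrightarrow>
     (\<forall>t. det (mat t - A) = (\<Prod>r = 1..CARD('n). t - \<sigma> r)) \<and>
     (\<forall>r s. 1 \<le> r \<longrightarrow> r \<le> s \<longrightarrow> s \<le> CARD('n) \<longrightarrow> \<sigma> s \<le> \<sigma> r)"


text \<open>Katyusha. The samples \<open>js e l\<close> (epoch \<open>e\<close>, inner step \<open>l\<close>) are an argument, so that a run is
  a function of the sample path.\<close>

definition kat_tau :: "nat \<Rightarrow> real \<Rightarrow> real \<Rightarrow> real" where
  "kat_tau m L \<mu> = min (sqrt (2 * real m * \<mu> / (3 * L))) (1 / 2)"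

definition kat_step_size :: "nat \<Rightarrow> real \<Rightarrow> real \<Rightarrow> real" where
  "kat_step_size m L \<mu> = 1 / (3 * kat_tau m L \<mu> * L)"

text \<open>The pair \<open>(p, z)\<close> after the given number of inner steps of an epoch with snapshot \<open>w\<close>,
  entered with the pair \<open>pz\<close>.\<close>

primrec kat_inner ::
  "nat \<Rightarrow> (nat \<Rightarrow> 'v::real_inner \<Rightarrow> real) \<Rightarrow> ('v \<Rightarrow> real) \<Rightarrow> real \<Rightarrow> real \<Rightarrow> (nat \<Rightarrow> nat) \<Rightarrow> 'v \<Rightarrow> 'v \<times> 'v
     \<Rightarrow> nat \<Rightarrow> 'v \<times> 'v" where
  "kat_inner m h \<psi> L \<mu> js w pz 0 = pz"
| "kat_inner m h \<psi> L \<mu> js w pz (Suc l) =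
     (let (p, z) = kat_inner m h \<psi> L \<mu> js w pz l;
          \<tau>1 = kat_tau m L \<mu>;
          \<tau>2 = 1 / 2;
          a = kat_step_size m L \<mu>;
          u = \<tau>1 *\<^sub>R z + \<tau>2 *\<^sub>R w + (1 - \<tau>1 - \<tau>2) *\<^sub>R p;
          g = (1 / real m) *\<^sub>R (\<Sum>j<m. grad (h j) w);
          g' = g + grad (h (js l)) u - grad (h (js l)) w
      in (ARG_MIN (\<lambda>q. 3 * L / 2 * (norm (q - u))\<^sup>2 + g' \<bullet> q + \<psi> q) q. True,
          ARG_MIN (\<lambda>q. 1 / (2 * a) * (norm (q - z))\<^sup>2 + g' \<bullet> q + \<psi> q) q. True))"

text \<open>The snapshot and the pair \<open>(p, z)\<close> after the given number of epochs.\<close>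

primrec kat_epochs ::
  "nat \<Rightarrow> (nat \<Rightarrow> 'v::real_inner \<Rightarrow> real) \<Rightarrow> ('v \<Rightarrow> real) \<Rightarrow> real \<Rightarrow> real \<Rightarrow> (nat \<Rightarrow> nat \<Rightarrow> nat) \<Rightarrow> 'v
     \<Rightarrow> nat \<Rightarrow> 'v \<times> ('v \<times> 'v)" where
  "kat_epochs m h \<psi> L \<mu> js \<theta>0 0 = (\<theta>0, (\<theta>0, \<theta>0))"
| "kat_epochs m h \<psi> L \<mu> js \<theta>0 (Suc e) =
     (let (w, pz) = kat_epochs m h \<psi> L \<mu> js \<theta>0 e;
          run = kat_inner m h \<psi> L \<mu> (js e) w pz;
          wt = (\<lambda>l. (1 + kat_step_size m L \<mu> * \<mu>) ^ l)
      in ((1 / (\<Sum>l<2 * m. wt l)) *\<^sub>R (\<Sum>l<2 * m. wt l *\<^sub>R fst (run (Suc l))), run (2 * m)))"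

definition katyusha ::
  "nat \<Rightarrow> (nat \<Rightarrow> 'v::real_inner \<Rightarrow> real) \<Rightarrow> ('v \<Rightarrow> real) \<Rightarrow> real \<Rightarrow> real \<Rightarrow> nat \<Rightarrow> (nat \<Rightarrow> nat \<Rightarrow> nat) \<Rightarrow> 'v \<Rightarrow> 'v" where
  "katyusha m h \<psi> L \<mu> E js \<theta>0 = fst (kat_epochs m h \<psi> L \<mu> js \<theta>0 E)"

text \<open>Per epoch: \<open>m\<close> component gradients for the snapshot, and two in each of the \<open>2 m\<close> inner
  steps.\<close>

definition katyusha_evals :: "nat \<Rightarrow> nat \<Rightarrow> nat" where
  "katyusha_evals m E = E * (m + 2 * (2 * m))"

definition worker_katyusha ::
  "nat \<Rightarrow> (nat \<Rightarrow> 'v::real_inner \<Rightarrow> real) \<Rightarrow> real \<Rightarrow> real \<Rightarrow> nat \<Rightarrow> (nat \<Rightarrow> nat \<Rightarrow> nat) \<Rightarrow> 'v \<Rightarrow> 'v \<Rightarrow> 'v" where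
  "worker_katyusha m fi L \<mu> E js x \<theta>0 =
     katyusha m (\<lambda>j \<theta>. fi j \<theta> - \<mu> / 2 * (norm \<theta>)\<^sup>2) (\<lambda>\<theta>. \<mu> / 2 * (norm \<theta>)\<^sup>2 - \<theta> \<bullet> x) L \<mu> E js \<theta>0"


text \<open>Truncated subtraction on \<^typ>\<open>nat\<close> implements the convention that empty sums and terms with
  negative index vanish.\<close>

definition lazy_threshold ::
  "nat \<Rightarrow> real \<Rightarrow> real \<Rightarrow> real \<Rightarrow> (nat \<Rightarrow> 'a::real_normed_vector^'n) \<Rightarrow> nat \<Rightarrow> 'n \<Rightarrow> real" where
  "lazy_threshold D c \<gamma> \<mu>min x k i =
     (let \<delta> = (\<lambda>j. (norm (x j $ i - x (Suc j) $ i))\<^sup>2)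
      in 3 / \<mu>min\<^sup>2 *
         ((\<Sum>j<k - D. c ^ (k - D - j) * \<delta> j) + (\<Sum>j<k. c ^ (k - j) * \<delta> j)
          + (\<Sum>j\<in>{k - D..<k}. c * \<delta> j) + (\<Sum>j\<in>{k - D..<k}. \<gamma> * \<delta> j)))"

definition dlag_run ::
  "nat \<Rightarrow> ('n::finite \<Rightarrow> nat \<Rightarrow> 'a::real_inner \<Rightarrow> real) \<Rightarrow> ('n \<Rightarrow> real) \<Rightarrow> ('n \<Rightarrow> real) \<Rightarrow> real^'n^'n
     \<Rightarrow> real \<Rightarrow> real \<Rightarrow> real \<Rightarrow> real \<Rightarrow> real \<Rightarrow> nat \<Rightarrow> nat \<Rightarrow> (nat \<Rightarrow> 'n \<Rightarrow> nat \<Rightarrow> nat \<Rightarrow> nat)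
     \<Rightarrow> (nat \<Rightarrow> 'a^'n) \<Rightarrow> (nat \<Rightarrow> 'a^'n) \<Rightarrow> (nat \<Rightarrow> 'a^'n) \<Rightarrow> (nat \<Rightarrow> 'a^'n) \<Rightarrow> (nat \<Rightarrow> 'n \<Rightarrow> nat) \<Rightarrow> bool" where
  "dlag_run m f L \<mu> U \<eta> s \<kappa> c \<gamma> D E js x y \<theta> \<theta>hat delay \<longleftrightarrow>
     x 0 = 0 \<and> y 0 = 0 \<and>
     (\<forall>i. \<theta> 0 $ i = grad (conjugate (average m (f i))) 0 \<and> \<theta>hat 0 $ i = \<theta> 0 $ i \<and> delay 0 i = 0) \<and>
     (\<forall>k\<ge>1. \<forall>i.
        \<theta> k $ i = worker_katyusha m (f i) (L i) (\<mu> i) E (js k i) (x k $ i) (\<theta> (k - 1) $ i) \<and>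
        (if \<not> (norm (\<theta>hat (k - 1) $ i - \<theta> k $ i))\<^sup>2 \<le> lazy_threshold D c \<gamma> (Min (range \<mu>)) x k i
            \<or> delay (k - 1) i = D
         then \<theta>hat k $ i = \<theta> k $ i \<and> delay k i = 0
         else \<theta>hat k $ i = \<theta>hat (k - 1) $ i \<and> delay k i = delay (k - 1) i + 1)) \<and>
     (\<forall>k. y (Suc k) = x k - \<eta> *\<^sub>R rmult (\<theta>hat k) U \<and>
          x (Suc k) = y (Suc k)
            + ((sqrt (s * \<kappa>) - 1) / (sqrt (s * \<kappa>) + 1)) *\<^sub>R (y (Suc k) - y k))"

definition dlag_aux ::
  "real^'n^'n \<Rightarrow> real \<Rightarrow> real \<Rightarrow> real \<Rightarrow> (nat \<Rightarrow> 'a::real_vector^'n) \<Rightarrow> (nat \<Rightarrow> 'a^'n) \<Rightarrow> (nat \<Rightarrow> 'a^'n) \<Rightarrow> bool" where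
  "dlag_aux sqrtU \<eta> s \<kappa> \<theta>hat \<xi> lam \<longleftrightarrow>
     \<xi> 0 = 0 \<and> lam 0 = 0 \<and>
     (\<forall>k. lam (Suc k) = \<xi> k - \<eta> *\<^sub>R rmult (\<theta>hat k) sqrtU \<and>
          \<xi> (Suc k) = lam (Suc k)
            + ((sqrt (s * \<kappa>) - 1) / (sqrt (s * \<kappa>) + 1)) *\<^sub>R (lam (Suc k) - lam k))"

text \<open>Truncated subtraction also implements the convention that \<open>\<xi>\<close> at a negative index is
  \<open>\<xi> 0\<close>.\<close>

definition lyapunov ::
  "('v::real_normed_vector \<Rightarrow> real) \<Rightarrow> real \<Rightarrow> real \<Rightarrow> real \<Rightarrow> nat \<Rightarrow> (nat \<Rightarrow> real) \<Rightarrow> (nat \<Rightarrow> real) \<Rightarrow> 'v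
     \<Rightarrow> (nat \<Rightarrow> 'v) \<Rightarrow> (nat \<Rightarrow> 'v) \<Rightarrow> nat \<Rightarrow> real" where
  "lyapunov G \<eta> s \<kappa> D cd ctd \<xi>opt \<xi> lam k =
     (let v = (1 + sqrt (s * \<kappa>)) *\<^sub>R \<xi> k - sqrt (s * \<kappa>) *\<^sub>R lam k
      in 2 * \<eta> * s * \<kappa> * (G (lam k) - G \<xi>opt) + (norm (v - \<xi>opt))\<^sup>2
         + (\<Sum>d = 1..D. cd d * (norm (\<xi> (k + 1 - d) - \<xi> (k - d)))\<^sup>2)
         + (\<Sum>d = 1..k. ctd d * (norm (\<xi> (k + 1 - d) - \<xi> (k - d)))\<^sup>2))"

end

theory Submission
  imports Defs
begin

text \<open>
  The smoothness and strong convexity constants of \<open>G\<close> on \<open>{\<xi>. \<xi> 1 = 0}\<close> are \<open>\<beta>\<close> and \<open>\<alpha>\<close>: by duality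
  \<open>F\<^sup>*\<close> lies between quadratics with curvatures \<open>1 / L\<^sub>m\<^sub>a\<^sub>x\<close> and \<open>1 / \<mu>\<^sub>m\<^sub>i\<^sub>n\<close>, and the Rayleigh quotient of
  \<open>U\<close> lies between \<open>\<sigma>\<^sub>n\<^sub>-\<^sub>1\<close> and \<open>\<sigma>\<^sub>1\<close>, because its extrema over the sphere are attained at eigenvectors.
  One accelerated step with gradient error \<open>e\<close> contracts
  \<open>2\<eta>s\<kappa>(G(\<lambda>) - G(\<xi>\<^sup>*)) + \<parallel>v - \<xi>\<^sup>*\<parallel>\<^sup>2\<close> by \<open>1 - 1/q\<close>, where \<open>q = \<surd>(s\<kappa>)\<close>, gains \<open>- q/5 \<parallel>\<xi>\<^sup>k\<^sup>+\<^sup>1 - \<xi>\<^sup>k\<parallel>\<^sup>2\<close>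
  and loses \<open>6 q\<^sup>3 \<eta>\<^sup>2 \<parallel>e\<parallel>\<^sup>2\<close>. A warm-started run of Katyusha contracts the expected squared distance
  to the minimizer by \<open>c / 2\<close>, so that, together with the lazy condition, \<open>\<parallel>e\<parallel>\<^sup>2\<close> is in expectation a
  sum of earlier displacements \<open>\<parallel>\<xi>\<^sup>j\<^sup>+\<^sup>1 - \<xi>\<^sup>j\<parallel>\<^sup>2\<close> whose coefficients decay in the lag. Weights that
  decay like \<open>exp (- 2 d / \<surd>\<kappa>)\<close> in the lag \<open>d\<close> let the gain pay for these losses.

  All random variables of a run are functions of finitely many samples, so that integrability is
  automatic and averaging over the current sample replaces conditional expectations.
\<close>

subsection \<open>Quadratic bounds and conjugates\<close>

text \<open>\<open>qbounds\<close> carries all regularity: strong convexity, smoothness and the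
  gradient in one pair of inequalities, stable under averaging, tilting and conjugation;
  \<open>\<mu> = 0\<close> is plain convexity. The difficulty is the size of the loss: the
  accelerated step multiplies the squared gradient error by \<open>q ^ 3\<close>, so after
  normalizing by \<eta>\<beta> = 2/15 a displacement returns with a factor of order q \<kappa>,
  against a gain of q/5 only. Hence \<kappa> c and \<kappa> \<gamma> must be of order 1/D. The
  prefactor of c and \<gamma> delivers this: \<beta> times \<open>\<mu>min\<close> is the largest
  eigenvalue of \<open>U\<close>, at most the squared Frobenius norm of \<open>sqrtU\<close>, so
  \<alpha>\<beta> \<open>\<mu>min\<^sup>2\<close> over the fourth power of that norm is at most
  1/\<kappa>. The exponentials leave room for weights to decay over D lags. The values \<eta> =
  2/(15\<beta>) and s = 10 make the square terms of the accelerated step balance. Strong convexity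
  of \<open>G\<close> fails in the direction of constant columns, where \<open>sqrtU\<close>
  vanishes, so the iterates and the minimizer are kept at column sum zero.\<close>

definition qbounds :: "real \<Rightarrow> real \<Rightarrow> ('v::real_inner \<Rightarrow> real) \<Rightarrow> ('v \<Rightarrow> 'v) \<Rightarrow> bool" where
  "qbounds \<mu> L f g \<longleftrightarrow>
     (\<forall>x y. f x + g x \<bullet> (y - x) + \<mu> / 2 * (norm (y - x))\<^sup>2 \<le> f y \<and>
            f y \<le> f x + g x \<bullet> (y - x) + L / 2 * (norm (y - x))\<^sup>2)"

lemma
  fixes f :: "'v::real_inner \<Rightarrow> real"
  shows qbounds_lower:
  "qbounds \<mu> L f g \<Longrightarrow> f x + g x \<bullet> (y - x) + \<mu> / 2 * (norm (y - x))\<^sup>2 \<le> f y"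
  and qbounds_upper:
  "qbounds \<mu> L f g \<Longrightarrow> f y \<le> f x + g x \<bullet> (y - x) + L / 2 * (norm (y - x))\<^sup>2"
  unfolding qbounds_def by blast+

lemma qbounds_mono:
  fixes f :: "'v::real_inner \<Rightarrow> real"
  assumes "qbounds \<mu> L f g" "\<mu>' \<le> \<mu>" "L \<le> L'"
  shows "qbounds \<mu>' L' f g"
  unfolding qbounds_def
proof (intro allI conjI)
  fix x y :: 'v
  have "\<mu>' / 2 * (norm (y - x))\<^sup>2 \<le> \<mu> / 2 * (norm (y - x))\<^sup>2"
    "L / 2 * (norm (y - x))\<^sup>2 \<le> L' / 2 * (norm (y - x))\<^sup>2"
    using assms by (auto intro!: mult_right_mono)
  then show "f x + g x \<bullet> (y - x) + \<mu>' / 2 * (norm (y - x))\<^sup>2 \<le> f y"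
    and "f y \<le> f x + g x \<bullet> (y - x) + L' / 2 * (norm (y - x))\<^sup>2"
    using qbounds_lower[OF assms(1), of x y] qbounds_upper[OF assms(1), of y x] by linarith+
qed

text \<open>Used with \<open>b = - \<mu>\<close> to make Katyusha's components convex, with
  \<open>b = 0\<close> to tilt a worker's objective by the dual point, and on the zero function to
  obtain the regularizer \<psi>.\<close>

lemma qbounds_add_quadratic:
  fixes f :: "'v::real_inner \<Rightarrow> real"
  assumes "qbounds \<mu> L f g"
  shows "qbounds (\<mu> + b) (L + b) (\<lambda>x. f x + b / 2 * (norm x)\<^sup>2 - x \<bullet> w) (\<lambda>x. g x + b *\<^sub>R x - w)"
  unfolding qbounds_def
proof (intro allI conjI)
  fix x y :: 'v
  define N where "N = (norm (y - x))\<^sup>2"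
  have sq: "(norm y)\<^sup>2 = (norm x)\<^sup>2 + 2 * (x \<bullet> (y - x)) + N"
    unfolding N_def power2_norm_eq_inner by (simp add: inner_diff inner_commute)
  have "b / 2 * (norm y)\<^sup>2 - y \<bullet> w
      = b / 2 * (norm x)\<^sup>2 - x \<bullet> w + (b * (x \<bullet> (y - x)) - w \<bullet> (y - x)) + b / 2 * N"
    unfolding sq by (simp add: inner_diff_right inner_commute algebra_simps)
  moreover have "(g x + b *\<^sub>R x - w) \<bullet> (y - x)
      = g x \<bullet> (y - x) + (b * (x \<bullet> (y - x)) - w \<bullet> (y - x))"
    by (simp add: inner_add_left inner_diff_left)
  moreover have "(\<mu> + b) / 2 * N = \<mu> / 2 * N + b / 2 * N" "(L + b) / 2 * N = L / 2 * N + b / 2 * N"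
    by (simp_all add: add_divide_distrib distrib_right)
  ultimately show "f x + b / 2 * (norm x)\<^sup>2 - x \<bullet> w + (g x + b *\<^sub>R x - w) \<bullet> (y - x)
        + (\<mu> + b) / 2 * (norm (y - x))\<^sup>2 \<le> f y + b / 2 * (norm y)\<^sup>2 - y \<bullet> w"
    and "f y + b / 2 * (norm y)\<^sup>2 - y \<bullet> w \<le> f x + b / 2 * (norm x)\<^sup>2 - x \<bullet> w
        + (g x + b *\<^sub>R x - w) \<bullet> (y - x) + (L + b) / 2 * (norm (y - x))\<^sup>2"
    using qbounds_lower[OF assms, of x y] qbounds_upper[OF assms, of y x] unfolding N_def by linarith+
qed

lemma qbounds_average:
  assumes "0 < m" "\<And>j. j < m \<Longrightarrow> qbounds \<mu> L (f j) (g j)"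
  shows "qbounds \<mu> L (average m f) (\<lambda>x. (1 / real m) *\<^sub>R (\<Sum>j<m. g j x))"
  unfolding qbounds_def
proof (intro allI conjI)
  fix x y
  have avg: "(\<Sum>j<m. f j x + g j x \<bullet> (y - x) + b / 2 * (norm (y - x))\<^sup>2) / real m
      = average m f x + ((1 / real m) *\<^sub>R (\<Sum>j<m. g j x)) \<bullet> (y - x) + b / 2 * (norm (y - x))\<^sup>2" for b
    using assms(1) by (simp add: average_def sum.distrib inner_sum_left add_divide_distrib)
  have "(\<Sum>j<m. f j x + g j x \<bullet> (y - x) + \<mu> / 2 * (norm (y - x))\<^sup>2) \<le> (\<Sum>j<m. f j y)"
    by (intro sum_mono) (use qbounds_lower assms(2) in fastforce)
  then show "average m f x + ((1 / real m) *\<^sub>R (\<Sum>j<m. g j x)) \<bullet> (y - x) + \<mu> / 2 * (norm (y - x))\<^sup>2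
      \<le> average m f y"
    unfolding avg[symmetric] by (simp add: average_def divide_right_mono)
  have "(\<Sum>j<m. f j y) \<le> (\<Sum>j<m. f j x + g j x \<bullet> (y - x) + L / 2 * (norm (y - x))\<^sup>2)"
    by (intro sum_mono) (use qbounds_upper assms(2) in fastforce)
  then show "average m f y
      \<le> average m f x + ((1 / real m) *\<^sub>R (\<Sum>j<m. g j x)) \<bullet> (y - x) + L / 2 * (norm (y - x))\<^sup>2"
    unfolding avg[symmetric] by (simp add: average_def divide_right_mono)
qed

lemma grad_eqI:
  assumes "GDERIV f x :> g"
  shows "grad f x = g"
  unfolding grad_def
proof (rule the_equality)
  show "GDERIV f x :> g" by (rule assms)
  fix g' assume "GDERIV f x :> g'"
  then have "(\<lambda>h. h \<bullet> g') = (\<lambda>h. h \<bullet> g)"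
    using assms unfolding gderiv_def by (rule has_derivative_unique)
  then have "(g' - g) \<bullet> (g' - g) = 0"
    by (metis inner_diff_right right_minus_eq)
  then show "g' = g" by simp
qed

text \<open>Riesz representation, written out in an orthonormal basis.\<close>

lemma gderiv_grad:
  fixes f :: "'a::euclidean_space \<Rightarrow> real"
  assumes "f differentiable (at x)"
  shows "GDERIV f x :> grad f x"
proof -
  obtain f' where f': "(f has_derivative f') (at x)"
    using assms unfolding differentiable_def by blast
  define g where "g = (\<Sum>b\<in>Basis. f' b *\<^sub>R b)"
  have "h \<bullet> g = f' h" for h
  proof -
    have "f' h = f' (\<Sum>b\<in>Basis. (h \<bullet> b) *\<^sub>R b)"
      by (simp add: euclidean_representation)
    also have "\<dots> = (\<Sum>b\<in>Basis. (h \<bullet> b) * f' b)"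
      using has_derivative_linear[OF f'] by (simp add: linear_sum linear_scale)
    finally show ?thesis by (simp add: g_def inner_sum_right mult.commute)
  qed
  then have "GDERIV f x :> g"
    using f' unfolding gderiv_def by presburger
  then show ?thesis using grad_eqI by metis
qed

text \<open>Squeezed between two parabolas, the first-order remainder is quadratic in the distance.
  So \<open>g\<close> is forced to be the gradient that the algorithm evaluates through
  \<open>grad\<close>.\<close>

lemma qbounds_gderiv:
  assumes "qbounds \<mu> L f g"
  shows "GDERIV f x :> g x"
  unfolding gderiv_def
proof (rule has_derivativeI_sandwich[where e=1])
  show "bounded_linear (\<lambda>h. h \<bullet> g x)" by (rule bounded_linear_inner_left)
  define C where "C = \<bar>\<mu>\<bar> + \<bar>L\<bar>"
  show "norm ((f y - f x) - (y - x) \<bullet> g x) / norm (y - x) \<le> C * norm (y - x)"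
    if "y \<noteq> x" "dist y x < 1" for y
  proof -
    have "\<bar>\<mu> / 2 * (norm (y - x))\<^sup>2\<bar> \<le> C * (norm (y - x))\<^sup>2" "\<bar>L / 2 * (norm (y - x))\<^sup>2\<bar> \<le> C * (norm (y - x))\<^sup>2"
      by (auto simp: C_def abs_mult algebra_simps)
    then have "\<bar>(f y - f x) - (y - x) \<bullet> g x\<bar> \<le> C * (norm (y - x))\<^sup>2"
      using qbounds_lower[OF assms, of x y] qbounds_upper[OF assms, of y x]
      by (simp add: inner_commute)
    then show ?thesis using that(1) by (simp add: power2_eq_square divide_simps mult.assoc)
  qed
  have "((\<lambda>y. C * norm (y - x)) \<longlongrightarrow> C * norm (x - x)) (at x)"
    by (intro tendsto_intros)
  then show "((\<lambda>y. C * norm (y - x)) \<longlongrightarrow> 0) (at x)" by simp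
qed auto

lemma qbounds_grad: "qbounds \<mu> L f g \<Longrightarrow> grad f x = g x"
  by (rule grad_eqI[OF qbounds_gderiv])

text \<open>The upper half is the smoothness hypothesis. For the lower half, remove the quadratic
  and restrict to the line from \<open>x\<close> to \<open>y\<close>: the one-variable convex
  function \<open>p\<close> lies above its tangent at 0.\<close>

lemma qbounds_of_smooth_strongly_convex:
  fixes f :: "'a::euclidean_space \<Rightarrow> real"
  assumes diff: "\<And>z. f differentiable (at z)" and "smooth_with L f" and cvx: "strongly_convex_with \<mu> f"
  shows "qbounds \<mu> L f (grad f)"
  unfolding qbounds_def
proof (intro allI conjI)
  fix x y
  show "f y \<le> f x + grad f x \<bullet> (y - x) + L / 2 * (norm (y - x))\<^sup>2"
    using assms unfolding smooth_with_def by blast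
  define \<phi> where "\<phi> = (\<lambda>z. f z - \<mu> / 2 * (norm z)\<^sup>2)"
  define p where "p = (\<lambda>t. \<phi> (x + t *\<^sub>R (y - x)))"
  have \<phi>: "convex_on UNIV \<phi>" using cvx unfolding strongly_convex_with_def \<phi>_def .
  have "convex_on UNIV p"
  proof (rule convex_onI)
    fix t u v :: real assume "0 < t" "t < 1"
    then have "\<phi> ((1 - t) *\<^sub>R (x + u *\<^sub>R (y - x)) + t *\<^sub>R (x + v *\<^sub>R (y - x))) \<le> (1 - t) * p u + t * p v"
      using convex_onD[OF \<phi>, of t] unfolding p_def by simp
    then show "p ((1 - t) *\<^sub>R u + t *\<^sub>R v) \<le> (1 - t) * p u + t * p v"
      unfolding p_def by (simp add: algebra_simps)
  qed simp
  moreover have "(p has_real_derivative (grad f x - \<mu> *\<^sub>R x) \<bullet> (y - x)) (at 0)"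
  proof -
    have f': "(f has_derivative (\<lambda>h. h \<bullet> grad f x)) (at (x + 0 *\<^sub>R (y - x)))"
      using gderiv_grad[OF diff] unfolding gderiv_def by simp
    have 1: "((\<lambda>t. f (x + t *\<^sub>R (y - x))) has_derivative (\<lambda>t. (t *\<^sub>R (y - x)) \<bullet> grad f x)) (at 0)"
      by (rule has_derivative_compose[where f="\<lambda>t. x + t *\<^sub>R (y - x)" and g=f, OF _ f'])
         (auto intro!: derivative_eq_intros)
    have 2: "((\<lambda>t. \<mu> / 2 * (norm (x + t *\<^sub>R (y - x)))\<^sup>2) has_derivative (\<lambda>t. t * (\<mu> * (x \<bullet> (y - x))))) (at 0)"
      unfolding power2_norm_eq_inner
      by (auto intro!: derivative_eq_intros simp: fun_eq_iff algebra_simps inner_commute)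
    show ?thesis
      unfolding has_field_derivative_def p_def \<phi>_def
      by (rule has_derivative_eq_rhs[OF has_derivative_diff[OF 1 2]])
         (simp add: fun_eq_iff algebra_simps inner_commute inner_diff)
  qed
  ultimately have "p 1 - p 0 \<ge> (grad f x - \<mu> *\<^sub>R x) \<bullet> (y - x) * (1 - 0)"
    by (intro convex_on_imp_above_tangent[where A=UNIV]) auto
  then have "\<phi> x + (grad f x - \<mu> *\<^sub>R x) \<bullet> (y - x) \<le> \<phi> y" unfolding p_def by simp
  moreover have "\<mu> / 2 * (norm y)\<^sup>2 = \<mu> / 2 * (norm x)\<^sup>2 + (\<mu> *\<^sub>R x) \<bullet> (y - x) + \<mu> / 2 * (norm (y - x))\<^sup>2"
    unfolding power2_norm_eq_inner by (simp add: inner_diff inner_commute algebra_simps)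
  ultimately show "f x + grad f x \<bullet> (y - x) + \<mu> / 2 * (norm (y - x))\<^sup>2 \<le> f y"
    unfolding \<phi>_def inner_diff_left by linarith
qed

text \<open>A Euclidean space has a unit basis vector, and along it the two bounds can be
  compared.\<close>

lemma qbounds_order:
  fixes f :: "'a::euclidean_space \<Rightarrow> real"
  assumes "qbounds \<mu> L f g"
  shows "\<mu> \<le> L"
proof -
  obtain b :: 'a where "b \<in> Basis" using nonempty_Basis by blast
  then show ?thesis
    using qbounds_lower[OF assms, of 0 b] qbounds_upper[OF assms, of b 0] by simp
qed

text \<open>The direction \<open>d\<close> is free: it is the gradient itself for minimizers, a
  difference of gradients for cocoercivity, and a difference of dual points for the
  conjugate.\<close>

lemma qbounds_gradient_step:
  assumes q: "qbounds \<mu> L f g" and "0 < L"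
  shows "f (x - (1 / L) *\<^sub>R d) \<le> f x - (g x \<bullet> d) / L + (norm d)\<^sup>2 / (2 * L)"
  using qbounds_upper[OF q, of "x - (1 / L) *\<^sub>R d" x] assms(2)
  by (simp add: power_mult_distrib power2_eq_square divide_simps split: if_splits)

lemma qbounds_minimizer:
  assumes q: "qbounds \<mu> L f g" and "0 < L" and min: "\<And>y. f x \<le> f y"
  shows "g x = 0"
proof -
  have "f x \<le> f x - (norm (g x))\<^sup>2 / L + (norm (g x))\<^sup>2 / (2 * L)"
    using order_trans[OF min qbounds_gradient_step[OF assms(1,2), of x "g x"]]
    by (simp add: power2_norm_eq_inner)
  then have "(norm (g x))\<^sup>2 \<le> 0" using \<open>0 < L\<close> by (simp add: field_simps)
  then show ?thesis by simp
qed

text \<open>The auxiliary point minimizes the upper quadratic model at \<open>y\<close> of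
  \<open>f\<close> minus its linear part at \<open>x\<close>; convexity bounds the value there from
  below. This is what controls the variance of Katyusha's gradient estimate.\<close>

lemma qbounds_cocoercive:
  assumes q: "qbounds 0 L f g" and "0 < L"
  shows "(norm (g x - g y))\<^sup>2 \<le> 2 * L * (f y - f x - g x \<bullet> (y - x))"
proof -
  let ?d = "g y - g x" and ?y = "y - (1 / L) *\<^sub>R (g y - g x)"
  have "f x + g x \<bullet> (?y - x) \<le> f ?y"
    using qbounds_lower[OF q, of x ?y] by simp
  also have "\<dots> \<le> f y - (g y \<bullet> ?d) / L + (norm ?d)\<^sup>2 / (2 * L)"
    by (rule qbounds_gradient_step[OF assms])
  finally have "f x + g x \<bullet> (y - x) - (g x \<bullet> ?d) / L \<le> f y - (g y \<bullet> ?d) / L + (norm ?d)\<^sup>2 / (2 * L)"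
    by (simp add: inner_diff_right)
  moreover have "(g y \<bullet> ?d) / L - (g x \<bullet> ?d) / L = (norm ?d)\<^sup>2 / L"
    by (simp add: power2_norm_eq_inner inner_diff_left diff_divide_distrib)
  moreover have "(norm ?d)\<^sup>2 / L = 2 * ((norm ?d)\<^sup>2 / (2 * L))" by simp
  ultimately have "(norm ?d)\<^sup>2 / (2 * L) \<le> f y - f x - g x \<bullet> (y - x)" by linarith
  then show ?thesis using assms(2) by (simp add: field_simps norm_minus_commute)
qed

text \<open>A point with gradient \<open>w\<close> is a minimizer of \<open>f\<close> tilted by
  \<open>w\<close>, which exists by coercivity.\<close>

lemma qbounds_gradient_surj:
  fixes f :: "'a::euclidean_space \<Rightarrow> real"
  assumes q: "qbounds \<mu> L f g" and "0 < \<mu>"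
  shows "\<exists>\<theta>. g \<theta> = w"
proof -
  define \<phi> where "\<phi> = (\<lambda>x. f x - x \<bullet> w)"
  have q': "qbounds \<mu> L \<phi> (\<lambda>x. g x - w)"
    using qbounds_add_quadratic[OF q, of 0 w] unfolding \<phi>_def by simp
  \<comment> \<open>Beyond this radius the quadratic term of the lower bound at 0 dominates the
    linear one, so the values are at least the value at 0 and the minimum over the ball is
    global.\<close>
  define R where "R = 2 * norm (g 0 - w) / \<mu>"
  have "continuous_on (cball 0 R) \<phi>"
    using qbounds_gderiv[OF q'] unfolding gderiv_def
    by (meson continuous_at_imp_continuous_on has_derivative_continuous)
  moreover have "0 \<le> R" using assms(2) by (simp add: R_def)
  ultimately obtain \<theta> where \<theta>: "\<theta> \<in> cball 0 R" "\<And>y. y \<in> cball 0 R \<Longrightarrow> \<phi> \<theta> \<le> \<phi> y"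
    using continuous_attains_inf[of "cball 0 R" \<phi>] by auto
  have "\<phi> \<theta> \<le> \<phi> y" for y
  proof (cases "norm y \<le> R")
    case False
    have "norm (g 0 - w) \<le> \<mu> / 2 * norm y"
      using False assms(2) by (simp add: R_def field_simps)
    then have "norm (g 0 - w) * norm y \<le> \<mu> / 2 * norm y * norm y"
      by (rule mult_right_mono) simp
    moreover have "- (norm (g 0 - w) * norm y) \<le> (g 0 - w) \<bullet> y"
      using norm_cauchy_schwarz[of "- (g 0 - w)" y] by (simp del: minus_diff_eq)
    ultimately have "\<phi> 0 \<le> \<phi> y"
      using qbounds_lower[OF q', of 0 y] by (simp add: power2_eq_square)
    then show ?thesis using \<theta>(2)[of 0] \<open>0 \<le> R\<close> by simp
  qed (use \<theta> in simp)
  then have "g \<theta> - w = 0"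
    using qbounds_minimizer[OF q'] qbounds_order[OF q] assms(2) by fastforce
  then show ?thesis by auto
qed

text \<open>For strongly convex \<open>f\<close> with gradient \<open>g\<close> this is the gradient
  of the conjugate, by \<open>qbounds_conjugate\<close>; it is the exact dual gradient that Katyusha
  approximates.\<close>

definition grad_inv :: "('v \<Rightarrow> 'v) \<Rightarrow> 'v \<Rightarrow> 'v" where
  "grad_inv g w = (SOME \<theta>. g \<theta> = w)"

lemma grad_inv:
  fixes f :: "'a::euclidean_space \<Rightarrow> real"
  assumes "qbounds \<mu> L f g" "0 < \<mu>"
  shows "g (grad_inv g w) = w"
proof -
  obtain \<theta> where "g \<theta> = w" using qbounds_gradient_surj[OF assms] by blast
  then show ?thesis unfolding grad_inv_def by (metis (mono_tags) someI)
qed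

lemma conjugate_eqI:
  assumes "\<And>x. y \<bullet> x - \<phi> x \<le> y \<bullet> x0 - \<phi> x0"
  shows "conjugate \<phi> y = y \<bullet> x0 - \<phi> x0"
  unfolding conjugate_def using assms by (intro cSup_eq_maximum) auto

lemma conjugate_qbounds_aux:
  assumes q: "qbounds \<mu> L f g" and "0 < \<mu>" and w: "g \<theta> = w"
  shows "w \<bullet> x - f x \<le> w \<bullet> \<theta> - f \<theta>"
proof -
  have "0 \<le> \<mu> / 2 * (norm (x - \<theta>))\<^sup>2" using assms(2) by simp
  then show ?thesis
    using qbounds_lower[OF q, of \<theta> x] unfolding w by (simp add: inner_diff_right)
qed

lemma conjugate_qbounds_eq:
  fixes f :: "'a::euclidean_space \<Rightarrow> real"
  assumes "qbounds \<mu> L f g" "0 < \<mu>"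
  shows "conjugate f w = w \<bullet> grad_inv g w - f (grad_inv g w)"
  by (intro conjugate_eqI conjugate_qbounds_aux[OF assms] grad_inv[OF assms])

lemma young_inner:
  fixes u v :: "'v::real_inner"
  assumes "0 < a"
  shows "u \<bullet> v \<le> a / 2 * (norm u)\<^sup>2 + (norm v)\<^sup>2 / (2 * a)"
proof -
  have "0 \<le> (norm (a *\<^sub>R u - v))\<^sup>2 / (2 * a)" using assms by simp
  also have "\<dots> = a / 2 * (norm u)\<^sup>2 + (norm v)\<^sup>2 / (2 * a) - u \<bullet> v"
    using assms unfolding power2_norm_eq_inner
    by (simp add: inner_diff inner_commute field_simps)
  finally show ?thesis by simp
qed

text \<open>Lower bound: test the supremum at \<open>v\<close> with a gradient step of length 1/L
  from the maximizer at \<open>w\<close>. Upper bound: apply strong convexity between the two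
  maximizers and absorb their distance by Young's inequality.\<close>

lemma qbounds_conjugate:
  fixes f :: "'a::euclidean_space \<Rightarrow> real"
  assumes q: "qbounds \<mu> L f g" and \<mu>: "0 < \<mu>"
  shows "qbounds (1 / L) (1 / \<mu>) (conjugate f) (grad_inv g)"
  unfolding qbounds_def
proof (intro allI conjI)
  fix w v
  let ?s = "grad_inv g w" and ?t = "grad_inv g v"
  have L: "0 < L" using qbounds_order[OF q] \<mu> by simp
  have w: "g ?s = w" by (rule grad_inv[OF assms])
  note eq = conjugate_qbounds_eq[OF assms]
  have inner: "z \<bullet> (v - w) = v \<bullet> z - w \<bullet> z" for z by (simp add: inner_diff_right inner_commute)
  let ?z = "?s + (1 / L) *\<^sub>R (v - w)"
  define N P where "N = (norm (v - w))\<^sup>2 / (2 * L)" and "P = (w \<bullet> (v - w)) / L"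
  have N: "1 / L / 2 * (norm (v - w))\<^sup>2 = N" unfolding N_def by simp
  have "f ?z \<le> f ?s + P + N"
    using qbounds_gradient_step[OF q L, of ?s "w - v"] unfolding w N_def P_def
    by (simp add: inner_diff_right norm_minus_commute diff_divide_distrib algebra_simps)
  moreover have "v \<bullet> ?z = v \<bullet> ?s + P + 2 * N"
    unfolding N_def P_def
    by (simp add: power2_norm_eq_inner inner_add_right inner_diff_left inner_diff_right inner_commute
        add_divide_distrib diff_divide_distrib)
  moreover have "v \<bullet> ?z - f ?z \<le> conjugate f v"
    unfolding eq by (rule conjugate_qbounds_aux[OF assms grad_inv[OF assms]])
  ultimately show "conjugate f w + ?s \<bullet> (v - w) + 1 / L / 2 * (norm (v - w))\<^sup>2 \<le> conjugate f v"
    unfolding N eq[of w] inner[of ?s] by linarith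
  have "f ?s + w \<bullet> (?t - ?s) + \<mu> / 2 * (norm (?t - ?s))\<^sup>2 \<le> f ?t"
    using qbounds_lower[OF q, of ?s ?t] unfolding w .
  moreover have "(?t - ?s) \<bullet> (v - w) \<le> \<mu> / 2 * (norm (?t - ?s))\<^sup>2 + (norm (v - w))\<^sup>2 / (2 * \<mu>)"
    by (rule young_inner[OF \<mu>])
  ultimately show "conjugate f v \<le> conjugate f w + ?s \<bullet> (v - w) + 1 / \<mu> / 2 * (norm (v - w))\<^sup>2"
    unfolding eq using inner[of ?s] inner[of ?t] by (simp add: inner_diff)
qed

text \<open>Adding strong convexity in both directions gives strong monotonicity of
  \<open>g\<close>; Cauchy-Schwarz then cancels one factor. It bounds how far the target of a worker
  moves between two warm-started runs.\<close>

lemma grad_inv_lipschitz: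
  fixes f :: "'a::euclidean_space \<Rightarrow> real"
  assumes q: "qbounds \<mu> L f g" and \<mu>: "0 < \<mu>"
  shows "norm (grad_inv g w - grad_inv g v) \<le> norm (w - v) / \<mu>"
proof -
  let ?s = "grad_inv g w" and ?t = "grad_inv g v"
  have "\<mu> * (norm (?s - ?t))\<^sup>2 \<le> (w - v) \<bullet> (?s - ?t)"
    using qbounds_lower[OF q, of ?s ?t] qbounds_lower[OF q, of ?t ?s]
    unfolding grad_inv[OF assms] by (simp add: inner_diff norm_minus_commute)
  also have "\<dots> \<le> norm (w - v) * norm (?s - ?t)" by (rule norm_cauchy_schwarz)
  finally have "norm (?s - ?t) * (\<mu> * norm (?s - ?t)) \<le> norm (?s - ?t) * norm (w - v)"
    by (simp add: power2_eq_square algebra_simps)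
  then have "\<mu> * norm (?s - ?t) \<le> norm (w - v)"
    by (metis mult_le_cancel_left_pos norm_ge_zero order_le_less mult_zero_right)
  then show ?thesis using \<mu> by (simp add: field_simps)
qed

subsection \<open>One step of Katyusha\<close>

text \<open>The objective is itself a quadratic with Hessian 2A + \<mu>, so the three-point
  inequality of proximal steps is an equality. It also pins the choice in \<open>ARG_MIN\<close>
  down to the unique minimizer.\<close>

lemma prox_arg_min:
  fixes u g x :: "'v::real_inner"
  defines "obj \<equiv> \<lambda>A \<mu> q. A * (norm (q - u))\<^sup>2 + g \<bullet> q + (\<mu> / 2 * (norm q)\<^sup>2 - q \<bullet> x)"
  assumes "0 < A" "0 \<le> \<mu>"
  shows "obj A \<mu> (ARG_MIN (obj A \<mu>) q. True) + (A + \<mu> / 2) * (norm (q - (ARG_MIN (obj A \<mu>) q. True)))\<^sup>2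
    = obj A \<mu> q"
proof -
  define c where "c = 2 * A + \<mu>"
  \<comment> \<open>The zero of the gradient 2A (q - u) + g + \<mu> q - x.\<close>
  define q0 where "q0 = (1 / c) *\<^sub>R (2 * A) *\<^sub>R u - (1 / c) *\<^sub>R g + (1 / c) *\<^sub>R x"
  have c: "0 < c" using assms by (simp add: c_def)
  have cq0: "c *\<^sub>R q0 = (2 * A) *\<^sub>R u - g + x"
    using c by (simp add: q0_def algebra_simps)
  have eq: "obj A \<mu> q = obj A \<mu> q0 + (A + \<mu> / 2) * (norm (q - q0))\<^sup>2" for q
  proof -
    have nq: "(norm q)\<^sup>2 = (norm q0)\<^sup>2 + 2 * (q0 \<bullet> (q - q0)) + (norm (q - q0))\<^sup>2"
      unfolding power2_norm_eq_inner by (simp add: inner_diff inner_commute)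
    have nu: "(norm (q - u))\<^sup>2 = (norm (q0 - u))\<^sup>2 + 2 * ((q0 - u) \<bullet> (q - q0)) + (norm (q - q0))\<^sup>2"
      unfolding power2_norm_eq_inner by (simp add: inner_diff inner_commute)
    have gx: "g \<bullet> q = g \<bullet> q0 + g \<bullet> (q - q0)" "q \<bullet> x = q0 \<bullet> x + x \<bullet> (q - q0)"
      by (simp_all add: inner_diff_right inner_commute)
    have "0 = (c *\<^sub>R q0 - ((2 * A) *\<^sub>R u - g + x)) \<bullet> (q - q0)" unfolding cq0 by simp
    also have "\<dots> = 2 * A * ((q0 - u) \<bullet> (q - q0)) + g \<bullet> (q - q0) + \<mu> * (q0 \<bullet> (q - q0)) - x \<bullet> (q - q0)"
      by (simp add: c_def inner_diff_left inner_add_left algebra_simps)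
    finally show ?thesis
      unfolding obj_def gx nq nu by (simp add: algebra_simps)
  qed
  have pos: "0 < A + \<mu> / 2" using assms by simp
  have "is_arg_min (obj A \<mu>) (\<lambda>_. True) q0"
    unfolding is_arg_min_def not_less
  proof (intro conjI notI TrueI)
    assume "\<exists>q. True \<and> obj A \<mu> q < obj A \<mu> q0"
    then obtain q where "obj A \<mu> q < obj A \<mu> q0" by blast
    moreover have "0 \<le> (A + \<mu> / 2) * (norm (q - q0))\<^sup>2" using pos by simp
    ultimately show False using eq[of q] by linarith
  qed
  then have "is_arg_min (obj A \<mu>) (\<lambda>_. True) (ARG_MIN (obj A \<mu>) q. True)"
    unfolding arg_min_def by (rule someI)
  then have "obj A \<mu> (ARG_MIN (obj A \<mu>) q. True) \<le> obj A \<mu> q0"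
    unfolding is_arg_min_def using not_less by blast
  then have "(A + \<mu> / 2) * (norm ((ARG_MIN (obj A \<mu>) q. True) - q0))\<^sup>2 \<le> 0"
    using eq[of "ARG_MIN (obj A \<mu>) q. True"] by linarith
  then have "(ARG_MIN (obj A \<mu>) q. True) = q0"
    using pos by (simp add: mult_le_0_iff not_le)
  then show ?thesis by (simp only: eq[of q])
qed

text \<open>Variance is at most the second moment.\<close>

lemma sum_norm_diff_mean_le:
  fixes X :: "nat \<Rightarrow> 'v::real_inner"
  assumes "0 < m"
  shows "(\<Sum>j<m. (norm (X j - (1 / real m) *\<^sub>R (\<Sum>i<m. X i)))\<^sup>2) \<le> (\<Sum>j<m. (norm (X j))\<^sup>2)"
proof -
  define a where "a = (1 / real m) *\<^sub>R (\<Sum>i<m. X i)"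
  have a: "(\<Sum>j<m. X j) = real m *\<^sub>R a" using assms by (simp add: a_def)
  have "(\<Sum>j<m. (norm (X j - a))\<^sup>2) = (\<Sum>j<m. (norm (X j))\<^sup>2 - 2 * (X j \<bullet> a) + (norm a)\<^sup>2)"
    unfolding power2_norm_eq_inner by (intro sum.cong) (auto simp: inner_diff inner_commute)
  also have "\<dots> = (\<Sum>j<m. (norm (X j))\<^sup>2) - 2 * ((\<Sum>j<m. X j) \<bullet> a) + real m * (norm a)\<^sup>2"
    by (simp add: sum.distrib sum_subtractf sum_distrib_left inner_sum_left)
  also have "\<dots> = (\<Sum>j<m. (norm (X j))\<^sup>2) - real m * (norm a)\<^sup>2"
    unfolding a by (simp add: power2_norm_eq_inner)
  finally show ?thesis unfolding a_def[symmetric] by simp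
qed

text \<open>One inner step as a function of the drawn index, so that the conditional expectation
  over the draw is a plain average over \<open>j\<close>.\<close>

definition kat_step ::
  "nat \<Rightarrow> (nat \<Rightarrow> 'v::real_inner \<Rightarrow> real) \<Rightarrow> ('v \<Rightarrow> real) \<Rightarrow> real \<Rightarrow> real \<Rightarrow> 'v \<Rightarrow> 'v \<times> 'v \<Rightarrow> nat \<Rightarrow> 'v \<times> 'v" where
  "kat_step m h \<psi> L \<mu> w pz j =
     (let \<tau> = kat_tau m L \<mu>;
          u = \<tau> *\<^sub>R snd pz + (1 / 2) *\<^sub>R w + (1 - \<tau> - 1 / 2) *\<^sub>R fst pz;
          g = (1 / real m) *\<^sub>R (\<Sum>i<m. grad (h i) w) + grad (h j) u - grad (h j) w
      in (ARG_MIN (\<lambda>q. 3 * L / 2 * (norm (q - u))\<^sup>2 + g \<bullet> q + \<psi> q) q. True,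
          ARG_MIN (\<lambda>q. 1 / (2 * kat_step_size m L \<mu>) * (norm (q - snd pz))\<^sup>2 + g \<bullet> q + \<psi> q) q. True))"

lemma kat_inner_Suc:
  "kat_inner m h \<psi> L \<mu> js w pz (Suc l) = kat_step m h \<psi> L \<mu> w (kat_inner m h \<psi> L \<mu> js w pz l) (js l)"
  by (simp add: kat_step_def Let_def split_beta)

section \<open>One worker: its tilted objective and an inner step of Katyusha\<close>

locale worker =
  fixes m :: nat and f :: "nat \<Rightarrow> 'v::euclidean_space \<Rightarrow> real" and L \<mu> :: real
  assumes m: "1 \<le> m" and q: "\<And>j. j < m \<Longrightarrow> qbounds \<mu> L (f j) (grad (f j))" and \<mu>: "0 < \<mu>"
begin

definition h :: "nat \<Rightarrow> 'v \<Rightarrow> real" where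
  "h j \<theta> = f j \<theta> - \<mu> / 2 * (norm \<theta>)\<^sup>2"

definition \<psi> :: "'v \<Rightarrow> 'v \<Rightarrow> real" where
  "\<psi> x \<theta> = \<mu> / 2 * (norm \<theta>)\<^sup>2 - \<theta> \<bullet> x"

definition F :: "'v \<Rightarrow> 'v \<Rightarrow> real" where
  "F x \<theta> = average m f \<theta> - \<theta> \<bullet> x"

definition gH :: "'v \<Rightarrow> 'v" where
  "gH \<theta> = (1 / real m) *\<^sub>R (\<Sum>j<m. grad (h j) \<theta>)"

definition gf :: "'v \<Rightarrow> 'v" where
  "gf \<theta> = (1 / real m) *\<^sub>R (\<Sum>j<m. grad (f j) \<theta>)"

definition opt :: "'v \<Rightarrow> 'v" where
  "opt = grad_inv gf"

abbreviation \<tau> :: real where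
  "\<tau> \<equiv> kat_tau m L \<mu>"

abbreviation \<kappa> :: real where
  "\<kappa> \<equiv> L / \<mu>"

lemma \<mu>_le_L: "\<mu> \<le> L"
  using m qbounds_order q by force

lemma L_pos: "0 < L"
  using \<mu>_le_L \<mu> by simp

lemma qbounds_h:
  assumes "j < m"
  shows "qbounds 0 L (h j) (grad (h j))"
proof -
  have "qbounds (\<mu> + - \<mu>) (L + - \<mu>) (h j) (\<lambda>x. grad (f j) x + - \<mu> *\<^sub>R x - 0)"
    using qbounds_add_quadratic[OF q[OF assms], of "- \<mu>" 0] unfolding h_def by simp
  then have "qbounds 0 L (h j) (\<lambda>x. grad (f j) x + - \<mu> *\<^sub>R x - 0)"
    by (rule qbounds_mono) (use \<mu> in auto)
  moreover from this have "grad (h j) = (\<lambda>x. grad (f j) x + - \<mu> *\<^sub>R x - 0)"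
    using qbounds_grad by blast
  ultimately show ?thesis by simp
qed

lemma qbounds_H: "qbounds 0 L (average m h) gH"
  unfolding gH_def using m by (intro qbounds_average qbounds_h) auto

lemma qbounds_f: "qbounds \<mu> L (average m f) gf"
  unfolding gf_def using m by (intro qbounds_average q) auto

lemma gf_opt: "gf (opt x) = x"
  unfolding opt_def by (rule grad_inv[OF qbounds_f \<mu>])

lemma F_eq: "F x \<theta> = average m h \<theta> + \<psi> x \<theta>"
  using m by (simp add: F_def \<psi>_def average_def h_def sum_subtractf diff_divide_distrib)

lemma qbounds_F: "qbounds \<mu> L (F x) (\<lambda>\<theta>. gf \<theta> - x)"
  using qbounds_add_quadratic[OF qbounds_f, of 0 x] unfolding F_def by simp

lemma F_opt_lower: "\<mu> / 2 * (norm (\<theta> - opt x))\<^sup>2 \<le> F x \<theta> - F x (opt x)"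
  using qbounds_lower[OF qbounds_F, of x "opt x" \<theta>] gf_opt[of x] by simp

lemma F_opt_upper: "F x \<theta> - F x (opt x) \<le> L / 2 * (norm (\<theta> - opt x))\<^sup>2"
  using qbounds_upper[OF qbounds_F, of x \<theta> "opt x"] gf_opt[of x] by simp

lemma F_opt_le: "F x (opt x) \<le> F x \<theta>"
  using F_opt_lower[of \<theta> x] \<mu> by (smt (verit) mult_nonneg_nonneg zero_le_power2 divide_nonneg_nonneg)

lemma qbounds_\<psi>: "qbounds \<mu> \<mu> (\<psi> x) (\<lambda>\<theta>. \<mu> *\<^sub>R \<theta> - x)"
proof -
  have "qbounds 0 0 (\<lambda>x::'v. 0) (\<lambda>x. 0)" by (simp add: qbounds_def)
  from qbounds_add_quadratic[OF this, of \<mu> x] show ?thesis unfolding \<psi>_def by simp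
qed

lemma \<tau>_bounds: "0 < \<tau>" "\<tau> \<le> 1 / 2"
  using m \<mu> L_pos by (auto simp: kat_tau_def)

text \<open>Jensen for three points: the tangent at the combination lies below \<psi> at each point,
  and its weighted linear parts cancel.\<close>

lemma \<psi>_convex_combination:
  "\<psi> x (\<tau> *\<^sub>R z + (1 / 2) *\<^sub>R w + (1 - \<tau> - 1 / 2) *\<^sub>R p)
    \<le> \<tau> * \<psi> x z + 1 / 2 * \<psi> x w + (1 - \<tau> - 1 / 2) * \<psi> x p"
proof -
  let ?v = "\<tau> *\<^sub>R z + (1 / 2) *\<^sub>R w + (1 - \<tau> - 1 / 2) *\<^sub>R p"
  let ?g = "\<mu> *\<^sub>R ?v - x"
  have lin: "\<psi> x ?v + ?g \<bullet> (y - ?v) \<le> \<psi> x y" for y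
    using qbounds_lower[OF qbounds_\<psi>, of x ?v y] \<mu> by (smt (verit) mult_nonneg_nonneg zero_le_power2 divide_nonneg_nonneg)
  have "\<tau> * (\<psi> x ?v + ?g \<bullet> (z - ?v)) \<le> \<tau> * \<psi> x z"
    "1 / 2 * (\<psi> x ?v + ?g \<bullet> (w - ?v)) \<le> 1 / 2 * \<psi> x w"
    "(1 - \<tau> - 1 / 2) * (\<psi> x ?v + ?g \<bullet> (p - ?v)) \<le> (1 - \<tau> - 1 / 2) * \<psi> x p"
    using \<tau>_bounds by (intro mult_left_mono lin; simp)+
  moreover have "\<tau> * (?g \<bullet> (z - ?v)) + 1 / 2 * (?g \<bullet> (w - ?v)) + (1 - \<tau> - 1 / 2) * (?g \<bullet> (p - ?v)) = ?g \<bullet> 0"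
    unfolding inner_scaleR_right[symmetric] inner_add_right[symmetric]
  proof (rule arg_cong[where f="\<lambda>y. ?g \<bullet> y"])
    have "a *\<^sub>R (z - v) + b *\<^sub>R (w - v) + c *\<^sub>R (p - v) = a *\<^sub>R z + b *\<^sub>R w + c *\<^sub>R p - (a + b + c) *\<^sub>R v"
      for a b c :: real and v by (simp add: algebra_simps)
    then show "\<tau> *\<^sub>R (z - ?v) + (1 / 2) *\<^sub>R (w - ?v) + (1 - \<tau> - 1 / 2) *\<^sub>R (p - ?v) = 0" by simp
  qed
  moreover have "\<tau> * \<psi> x ?v + 1 / 2 * \<psi> x ?v + (1 - \<tau> - 1 / 2) * \<psi> x ?v = \<psi> x ?v"
    by (simp add: algebra_simps)
  ultimately show ?thesis unfolding distrib_left inner_zero_right by linarith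
qed

lemma step_size: "1 / (2 * kat_step_size m L \<mu>) = 3 * \<tau> * L / 2"
  by (simp add: kat_step_size_def)

text \<open>The coefficient 3L/2 of the \<open>p\<close>-step is spent as L/2 for the smoothness of
  the average of \<open>h\<close> and L for Young's inequality on the gradient error, which leaves
  that error with factor 1/(4L). The \<open>z\<close>-step contributes the exact square from
  \<open>prox_arg_min\<close>.\<close>

lemma kat_step_sample:
  fixes x w p z :: 'v and j :: nat and u G
  defines "u \<equiv> \<tau> *\<^sub>R z + (1 / 2) *\<^sub>R w + (1 - \<tau> - 1 / 2) *\<^sub>R p"
  defines "G \<equiv> gH w + grad (h j) u - grad (h j) w"
  defines "p' \<equiv> fst (kat_step m h (\<psi> x) L \<mu> w (p, z) j)"
    and "z' \<equiv> snd (kat_step m h (\<psi> x) L \<mu> w (p, z) j)"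
  shows "F x p' + \<tau> * ((3 * \<tau> * L / 2 + \<mu> / 2) * (norm (z' - y))\<^sup>2)
    \<le> average m h u + (norm (G - gH u))\<^sup>2 / (4 * L) + \<tau> * (G \<bullet> (y - z)) + \<tau> * \<psi> x y
      + \<tau> * (3 * \<tau> * L / 2 * (norm (y - z))\<^sup>2) + 1 / 2 * \<psi> x w + (1 - \<tau> - 1 / 2) * \<psi> x p"
proof -
  define A where "A = 3 * \<tau> * L / 2"
  have A: "0 < A" "0 < 3 * L / 2" using \<tau>_bounds L_pos by (auto simp: A_def)
  have p': "p' = (ARG_MIN (\<lambda>q. 3 * L / 2 * (norm (q - u))\<^sup>2 + G \<bullet> q + (\<mu> / 2 * (norm q)\<^sup>2 - q \<bullet> x)) q. True)"
    unfolding p'_def kat_step_def Let_def G_def u_def gH_def \<psi>_def by simp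
  have z': "z' = (ARG_MIN (\<lambda>q. A * (norm (q - z))\<^sup>2 + G \<bullet> q + (\<mu> / 2 * (norm q)\<^sup>2 - q \<bullet> x)) q. True)"
    unfolding z'_def kat_step_def Let_def G_def u_def gH_def \<psi>_def A_def step_size by simp
  have P: "3 * L / 2 * (norm (p' - u))\<^sup>2 + G \<bullet> p' + \<psi> x p' \<le> 3 * L / 2 * (norm (v - u))\<^sup>2 + G \<bullet> v + \<psi> x v" for v
  proof -
    have "0 \<le> (3 * L / 2 + \<mu> / 2) * (norm (v - p'))\<^sup>2" using A \<mu> by simp
    then show ?thesis
      using prox_arg_min[OF A(2), of \<mu> u G x v] \<mu> unfolding p'[symmetric] \<psi>_def by simp
  qed
  have Z: "A * (norm (z' - z))\<^sup>2 + G \<bullet> z' + \<psi> x z' + (A + \<mu> / 2) * (norm (y - z'))\<^sup>2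
      = A * (norm (y - z))\<^sup>2 + G \<bullet> y + \<psi> x y"
    using prox_arg_min[OF A(1), of \<mu> z G x y] \<mu> unfolding z'[symmetric] \<psi>_def by simp
  \<comment> \<open>The competitor for \<open>p'\<close>: the coupling that defines \<open>u\<close>
    with \<open>z\<close> replaced by \<open>z'\<close>, so that it differs from \<open>u\<close> by
    \<tau> (z' - z). The step size makes 3L/2 times \<tau> squared equal to \<tau> A, which matches
    the \<open>z\<close>-objective.\<close>
  let ?v = "\<tau> *\<^sub>R z' + (1 / 2) *\<^sub>R w + (1 - \<tau> - 1 / 2) *\<^sub>R p"
  have vu: "?v - u = \<tau> *\<^sub>R (z' - z)" unfolding u_def by (simp add: algebra_simps)
  have "3 * L / 2 * (norm (?v - u))\<^sup>2 = \<tau> * (A * (norm (z' - z))\<^sup>2)"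
    unfolding vu A_def by (simp add: power_mult_distrib power2_eq_square)
  moreover have "G \<bullet> ?v = G \<bullet> u + \<tau> * (G \<bullet> (z' - z))"
    using vu by (metis add_diff_cancel_left' diff_add_cancel inner_add_right inner_scaleR_right add.commute)
  moreover have "\<psi> x ?v \<le> \<tau> * \<psi> x z' + 1 / 2 * \<psi> x w + (1 - \<tau> - 1 / 2) * \<psi> x p"
    by (rule \<psi>_convex_combination)
  moreover have "average m h p' \<le> average m h u + gH u \<bullet> (p' - u) + L / 2 * (norm (p' - u))\<^sup>2"
    by (rule qbounds_upper[OF qbounds_H])
  moreover have "- (G - gH u) \<bullet> (p' - u) \<le> (norm (- (G - gH u)))\<^sup>2 / (4 * L) + L * (norm (p' - u))\<^sup>2"
    using young_inner[of "2 * L" "p' - u" "- (G - gH u)"] L_pos by (simp add: inner_commute del: minus_diff_eq)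
  ultimately have main: "F x p' \<le> average m h u + (norm (G - gH u))\<^sup>2 / (4 * L) + \<tau> * (A * (norm (z' - z))\<^sup>2)
      + \<tau> * (G \<bullet> (z' - z)) + \<tau> * \<psi> x z' + 1 / 2 * \<psi> x w + (1 - \<tau> - 1 / 2) * \<psi> x p"
    using P[of ?v] unfolding F_eq
    by (simp add: inner_diff_left inner_diff_right norm_minus_commute)
  have "\<tau> * (A * (norm (z' - z))\<^sup>2 + G \<bullet> z' + \<psi> x z' + (A + \<mu> / 2) * (norm (y - z'))\<^sup>2)
      = \<tau> * (A * (norm (y - z))\<^sup>2 + G \<bullet> y + \<psi> x y)"
    unfolding Z ..
  with main show ?thesis
    unfolding A_def[symmetric] norm_minus_commute[of z' y] distrib_left inner_diff_right right_diff_distrib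
    by linarith
qed

text \<open>The estimate \<open>G j\<close> is unbiased, and its variance is paid by the Bregman
  divergence of the snapshot. The snapshot weight 1/2 is such that the linear part of this
  divergence cancels the snapshot's share of the coupling.\<close>

lemma kat_step_average:
  fixes x w y :: 'v and pz :: "'v \<times> 'v"
  defines "st \<equiv> kat_step m h (\<psi> x) L \<mu> w pz"
  shows "(\<Sum>j<m. F x (fst (st j)) + \<tau> * ((3 * \<tau> * L / 2 + \<mu> / 2) * (norm (snd (st j) - y))\<^sup>2)) / real m
    \<le> \<tau> * F x y + 1 / 2 * F x w + (1 - \<tau> - 1 / 2) * F x (fst pz) + \<tau> * (3 * \<tau> * L / 2 * (norm (snd pz - y))\<^sup>2)"
proof -
  obtain p z where pz: "pz = (p, z)" by fastforce
  define u where "u = \<tau> *\<^sub>R z + (1 / 2) *\<^sub>R w + (1 - \<tau> - 1 / 2) *\<^sub>R p"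
  define G where "G = (\<lambda>j. gH w + grad (h j) u - grad (h j) w)"
  define K where "K = average m h u + \<tau> * \<psi> x y
      + \<tau> * (3 * \<tau> * L / 2 * (norm (y - z))\<^sup>2) + 1 / 2 * \<psi> x w + (1 - \<tau> - 1 / 2) * \<psi> x p"
  have m': "0 < real m" using m by simp
  have "(\<Sum>j<m. F x (fst (st j)) + \<tau> * ((3 * \<tau> * L / 2 + \<mu> / 2) * (norm (snd (st j) - y))\<^sup>2))
    \<le> (\<Sum>j<m. K + (norm (G j - gH u))\<^sup>2 / (4 * L) + \<tau> * (G j \<bullet> (y - z)))"
    unfolding st_def pz G_def u_def K_def
    by (intro sum_mono order_trans[OF kat_step_sample]) simp
  also have "\<dots> = real m * K + (\<Sum>j<m. (norm (G j - gH u))\<^sup>2) / (4 * L) + \<tau> * ((\<Sum>j<m. G j) \<bullet> (y - z))"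
    by (simp add: sum.distrib sum_distrib_left sum_divide_distrib inner_sum_left)
  also have "(\<Sum>j<m. G j) = real m *\<^sub>R gH u"
    using m' unfolding G_def sum_subtractf sum.distrib gH_def by (simp add: sum_constant_scaleR)
  \<comment> \<open>Variance at most second moment, then cocoercivity: the factor 2L against 1/(4L)
    gives 1/2.\<close>
  also have "(\<Sum>j<m. (norm (G j - gH u))\<^sup>2) / (4 * L)
      \<le> real m * (1 / 2 * (average m h w - average m h u - gH u \<bullet> (w - u)))"
  proof -
    have eq: "G j - gH u = (grad (h j) u - grad (h j) w) - (1 / real m) *\<^sub>R (\<Sum>i<m. grad (h i) u - grad (h i) w)" for j
      unfolding G_def gH_def sum_subtractf by (simp add: algebra_simps)
    have "(\<Sum>j<m. (norm (G j - gH u))\<^sup>2) \<le> (\<Sum>j<m. (norm (grad (h j) u - grad (h j) w))\<^sup>2)"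
      unfolding eq using sum_norm_diff_mean_le[of m "\<lambda>j. grad (h j) u - grad (h j) w"] m by simp
    also have "\<dots> \<le> (\<Sum>j<m. 2 * L * (h j w - h j u - grad (h j) u \<bullet> (w - u)))"
      by (intro sum_mono qbounds_cocoercive qbounds_h L_pos) simp
    also have "\<dots> = 2 * L * ((\<Sum>j<m. h j w) - (\<Sum>j<m. h j u) - (\<Sum>j<m. grad (h j) u) \<bullet> (w - u))"
      by (simp only: sum_distrib_left[symmetric] sum_subtractf inner_sum_left)
    also have "\<dots> = real m * (2 * L * (average m h w - average m h u - gH u \<bullet> (w - u)))"
      using m' by (simp add: average_def gH_def field_simps)
    finally show ?thesis using L_pos by (simp add: divide_le_eq mult_ac)
  qed
  finally have "(\<Sum>j<m. F x (fst (st j)) + \<tau> * ((3 * \<tau> * L / 2 + \<mu> / 2) * (norm (snd (st j) - y))\<^sup>2))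
    \<le> real m * (K + 1 / 2 * (average m h w - average m h u - gH u \<bullet> (w - u)) + \<tau> * (gH u \<bullet> (y - z)))"
    by (simp add: distrib_left mult_ac)
  then have "(\<Sum>j<m. F x (fst (st j)) + \<tau> * ((3 * \<tau> * L / 2 + \<mu> / 2) * (norm (snd (st j) - y))\<^sup>2)) / real m
    \<le> K + 1 / 2 * (average m h w - average m h u - gH u \<bullet> (w - u)) + \<tau> * (gH u \<bullet> (y - z))"
    using m' by (simp add: divide_le_eq mult.commute)
  \<comment> \<open>The definition of \<open>u\<close> expresses \<tau> (y - z) through differences
    to \<open>u\<close> alone; convexity is then applied at \<open>y\<close> and \<open>p\<close>,
    while the \<open>w\<close> term cancels.\<close>
  also have "\<tau> * (gH u \<bullet> (y - z)) = \<tau> * (gH u \<bullet> (y - u)) + 1 / 2 * (gH u \<bullet> (w - u)) + (1 - \<tau> - 1 / 2) * (gH u \<bullet> (p - u))"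
    unfolding inner_scaleR_right[symmetric] inner_add_right[symmetric]
  proof (rule arg_cong[where f="\<lambda>y. gH u \<bullet> y"])
    have "a *\<^sub>R (y - v) + b *\<^sub>R (w - v) + c *\<^sub>R (p - v) = a *\<^sub>R y + b *\<^sub>R w + c *\<^sub>R p - (a + b + c) *\<^sub>R v"
      for a b c :: real and v by (simp add: algebra_simps)
    from this[of \<tau> u "1 / 2" "1 - \<tau> - 1 / 2"]
    have "\<tau> *\<^sub>R (y - u) + (1 / 2) *\<^sub>R (w - u) + (1 - \<tau> - 1 / 2) *\<^sub>R (p - u)
        = \<tau> *\<^sub>R y + (1 / 2) *\<^sub>R w + (1 - \<tau> - 1 / 2) *\<^sub>R p - u" by simp
    then show "\<tau> *\<^sub>R (y - z) = \<tau> *\<^sub>R (y - u) + (1 / 2) *\<^sub>R (w - u) + (1 - \<tau> - 1 / 2) *\<^sub>R (p - u)"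
      unfolding u_def by (simp only:) (simp add: scaleR_diff_right)
  qed
  also have "\<tau> * (gH u \<bullet> (y - u)) \<le> \<tau> * (average m h y - average m h u)"
    using qbounds_lower[OF qbounds_H, of u y] \<tau>_bounds by (intro mult_left_mono) auto
  also have "(1 - \<tau> - 1 / 2) * (gH u \<bullet> (p - u)) \<le> (1 - \<tau> - 1 / 2) * (average m h p - average m h u)"
    using qbounds_lower[OF qbounds_H, of u p] \<tau>_bounds by (intro mult_left_mono) auto
  finally show ?thesis
    unfolding K_def F_eq pz fst_conv snd_conv norm_minus_commute[of z y] by (simp add: algebra_simps)
qed

end

subsection \<open>Symmetric matrices and the network\<close>

lemma inner_symmetric_matrix:
  fixes A :: "real^'n^'n"
  assumes "transpose A = A"
  shows "x \<bullet> (A *v y) = (A *v x) \<bullet> y"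
  by (metis assms dot_lmul_matrix vector_transpose_matrix)

text \<open>A minimizer \<open>v\<close> of the form over the unit sphere of the invariant subspace
  is an eigenvector: its residual \<open>r\<close> stays in the subspace, and moving along
  \<open>r\<close> changes the form to first order by twice the squared norm of \<open>r\<close>,
  which must vanish.\<close>

lemma symmetric_Rayleigh_minimum:
  fixes A :: "real^'n^'n"
  assumes sym: "transpose A = A" and S: "subspace S" "S \<noteq> {0}" and inv: "\<And>v. v \<in> S \<Longrightarrow> A *v v \<in> S"
  obtains a v where "v \<in> S" "v \<noteq> 0" "A *v v = a *\<^sub>R v" "\<And>w. w \<in> S \<Longrightarrow> a * (w \<bullet> w) \<le> w \<bullet> (A *v w)"
proof -
  have "closed S" by (rule closed_subspace[OF S(1)])
  then have comp: "compact (sphere 0 1 \<inter> S)" by (intro compact_Int_closed) auto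
  obtain s where s: "s \<in> S" "s \<noteq> 0" using S subspace_0 by blast
  then have ne: "sphere 0 1 \<inter> S \<noteq> {}"
    using subspace_scale[OF S(1), of s "1 / norm s"]
    by (intro notI) (auto dest!: equals0D[of _ "(1 / norm s) *\<^sub>R s"])
  have "continuous_on (sphere 0 1 \<inter> S) (\<lambda>v. v \<bullet> (A *v v))"
    by (intro continuous_intros linear_continuous_on_compose[OF continuous_on_id]) auto
  then obtain v where v: "v \<in> sphere 0 1 \<inter> S"
    and min: "\<And>w. w \<in> sphere 0 1 \<inter> S \<Longrightarrow> v \<bullet> (A *v v) \<le> w \<bullet> (A *v w)"
    using continuous_attains_inf[OF comp ne] by blast
  define a where "a = v \<bullet> (A *v v)"
  have vv: "v \<bullet> v = 1" "v \<in> S" using v by (auto simp: norm_eq_1)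
  have le: "a * (w \<bullet> w) \<le> w \<bullet> (A *v w)" if "w \<in> S" for w
  proof (cases "w = 0")
    case False
    have "a \<le> ((1 / norm w) *\<^sub>R w) \<bullet> (A *v ((1 / norm w) *\<^sub>R w))"
      unfolding a_def using False that subspace_scale[OF S(1)] by (intro min) auto
    also have "\<dots> = (w \<bullet> (A *v w)) / (w \<bullet> w)"
      by (simp add: matrix_vector_mult_scaleR dot_square_norm power2_eq_square)
    finally show ?thesis using False by (simp add: field_simps)
  qed simp
  have "A *v v = a *\<^sub>R v"
  proof -
    define r where "r = A *v v - a *\<^sub>R v"
    have r: "r \<in> S" unfolding r_def using S(1) inv vv(2) by (intro subspace_diff subspace_scale) auto
    define B where "B = r \<bullet> (A *v r) - a * (r \<bullet> r)"
    have "0 \<le> 2 * t * (r \<bullet> r) + t\<^sup>2 * B" for t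
    proof -
      have "a * ((v + t *\<^sub>R r) \<bullet> (v + t *\<^sub>R r)) \<le> (v + t *\<^sub>R r) \<bullet> (A *v (v + t *\<^sub>R r))"
        by (intro le subspace_add[OF S(1)] subspace_scale[OF S(1)] vv r)
      moreover have "r \<bullet> (A *v v) = r \<bullet> r + a * (r \<bullet> v)"
        unfolding r_def by (simp add: inner_diff_right)
      moreover have "v \<bullet> (A *v r) = r \<bullet> (A *v v)"
        using inner_symmetric_matrix[OF sym, of v r] by (simp add: inner_commute)
      moreover have "v \<bullet> (A *v v) = a * (v \<bullet> v)" using vv by (simp add: a_def)
      moreover have "v \<bullet> r = r \<bullet> v" by (rule inner_commute)
      ultimately show ?thesis
        by (simp add: B_def matrix_vector_right_distrib matrix_vector_mult_scaleR inner_add_left inner_add_right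
            algebra_simps power2_eq_square)
    qed
    \<comment> \<open>A step this short lets the quadratic term undo at most half of the linear
      decrease; the added 1 keeps the denominator positive.\<close>
    from this[of "- (r \<bullet> r) / (1 + \<bar>B\<bar>)"]
    have "0 \<le> - 2 * (r \<bullet> r)\<^sup>2 / (1 + \<bar>B\<bar>) + (r \<bullet> r)\<^sup>2 * B / (1 + \<bar>B\<bar>)\<^sup>2"
      by (simp add: power2_eq_square power_divide)
    also have "\<dots> \<le> - (r \<bullet> r)\<^sup>2 / (1 + \<bar>B\<bar>)"
    proof -
      have "B / (1 + \<bar>B\<bar>) \<le> 1" by simp
      then have "(r \<bullet> r)\<^sup>2 / (1 + \<bar>B\<bar>) * (B / (1 + \<bar>B\<bar>)) \<le> (r \<bullet> r)\<^sup>2 / (1 + \<bar>B\<bar>) * 1"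
        by (intro mult_left_mono) auto
      then show ?thesis by (simp add: power2_eq_square)
    qed
    finally have "(r \<bullet> r)\<^sup>2 / (1 + \<bar>B\<bar>) \<le> 0" by simp
    then have "r = 0" using abs_ge_zero[of B] by (auto simp: divide_le_0_iff simp del: abs_ge_zero)
    then show ?thesis by (simp add: r_def)
  qed
  then show thesis using that[OF vv(2) _ _ le] vv(1) by force
qed

lemma eigenvalue_iff:
  fixes A :: "real^'n^'n"
  assumes "eigenvalues_desc A \<sigma>"
  shows "(\<exists>v. v \<noteq> 0 \<and> A *v v = a *\<^sub>R v) \<longleftrightarrow> (\<exists>r\<in>{1..CARD('n)}. a = \<sigma> r)"
proof -
  have "mat a *v v = a *\<^sub>R v" for v :: "real^'n"
    by (simp add: matrix_vector_mult_def mat_def vec_eq_iff if_distrib[where f="\<lambda>x. x * _"] cong: if_cong)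
  then have "(\<exists>v. v \<noteq> 0 \<and> A *v v = a *\<^sub>R v) \<longleftrightarrow> \<not> (\<forall>v. (mat a - A) *v v = 0 \<longrightarrow> v = 0)"
    unfolding matrix_vector_mult_diff_rdistrib right_minus_eq by metis
  also have "\<dots> \<longleftrightarrow> det (mat a - A) = 0"
    using matrix_left_invertible_ker[of "mat a - A"] invertible_left_inverse invertible_det_nz by metis
  also have "\<dots> \<longleftrightarrow> (\<exists>r\<in>{1..CARD('n)}. a = \<sigma> r)"
    using assms unfolding eigenvalues_desc_def by simp
  finally show ?thesis .
qed

lemma norm_matrix_vector_mult_le:
  fixes A :: "real^'n^'m"
  shows "norm (A *v v) \<le> norm A * norm v"
proof (rule power2_le_imp_le)
  have "(norm (A *v v))\<^sup>2 = (\<Sum>i\<in>UNIV. (A $ i \<bullet> v)\<^sup>2)"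
    unfolding power2_norm_eq_inner inner_vec_def[of "A *v v"] matrix_vector_mul_component
    by (simp add: power2_eq_square)
  also have "\<dots> \<le> (\<Sum>i\<in>UNIV. (A $ i \<bullet> A $ i) * (v \<bullet> v))"
    by (intro sum_mono Cauchy_Schwarz_ineq)
  also have "\<dots> = (norm A * norm v)\<^sup>2"
    by (simp add: power_mult_distrib power2_norm_eq_inner inner_vec_def[of A] sum_distrib_right)
  finally show "(norm (A *v v))\<^sup>2 \<le> (norm A * norm v)\<^sup>2" .
qed simp

text \<open>One coordinate across all workers. Right multiplication by \<open>A\<close> acts on it
  as the transpose of \<open>A\<close>, so statements about matrices reduce to vectors indexed by
  workers.\<close>

definition coord :: "'a::euclidean_space \<Rightarrow> 'a^'n \<Rightarrow> real^'n" where
  "coord b X = (\<chi> i. X $ i \<bullet> b)"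

lemma inner_coord:
  fixes X Y :: "'a::euclidean_space^'n"
  shows "X \<bullet> Y = (\<Sum>b\<in>Basis. coord b X \<bullet> coord b Y)"
proof -
  have "X \<bullet> Y = (\<Sum>i\<in>UNIV. \<Sum>b\<in>Basis. (X $ i \<bullet> b) * (Y $ i \<bullet> b))"
    unfolding inner_vec_def by (intro sum.cong refl euclidean_inner)
  also have "\<dots> = (\<Sum>b\<in>Basis. coord b X \<bullet> coord b Y)"
    by (subst sum.swap) (simp add: coord_def inner_vec_def[of "vec_lambda _"])
  finally show ?thesis .
qed

lemma coord_rmult: "coord b (rmult X A) = transpose A *v coord b X"
  by (simp add: coord_def rmult_def matrix_vector_mult_def transpose_def vec_eq_iff inner_sum_left)

lemma linear_rmult: "linear (\<lambda>X. rmult X A)"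
  by (rule linearI) (simp_all add: rmult_def vec_eq_iff scaleR_add_right sum.distrib scaleR_sum_right mult.commute)

lemmas rmult_diff = linear_diff[OF linear_rmult]
  and rmult_add = linear_add[OF linear_rmult]
  and rmult_scaleR = linear_scale[OF linear_rmult]
  and rmult_0 = linear_0[OF linear_rmult]

lemma rmult_rmult: "rmult (rmult X A) B = rmult X (A ** B)"
proof -
  have "(\<Sum>j\<in>UNIV. B $ j $ i *\<^sub>R (\<Sum>k\<in>UNIV. A $ k $ j *\<^sub>R X $ k))
      = (\<Sum>k\<in>UNIV. (\<Sum>j\<in>UNIV. A $ k $ j * B $ j $ i) *\<^sub>R X $ k)" for i
    unfolding scaleR_sum_right scaleR_sum_left by (subst sum.swap) (simp add: mult.commute)
  then show ?thesis by (simp add: rmult_def matrix_matrix_mult_def vec_eq_iff)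
qed

lemma inner_rmult:
  fixes X Y :: "'a::euclidean_space^'n"
  assumes "transpose A = A"
  shows "rmult X A \<bullet> Y = X \<bullet> rmult Y A"
  unfolding inner_coord[of "rmult X A" Y] inner_coord[of X "rmult Y A"] coord_rmult assms
    inner_symmetric_matrix[OF assms] ..

section \<open>Spectral bounds for the network matrix\<close>

locale network =
  fixes U sqrtU :: "real^'n^'n" and \<sigma> :: "nat \<Rightarrow> real"
  assumes card: "2 \<le> CARD('n)"
    and U_psd: "pos_semidef U"
    and U_null: "{v. U *v v = 0} = span {\<chi> i. 1}"
    and U_eig: "eigenvalues_desc U \<sigma>" "\<sigma> (CARD('n) - 1) > 0" "\<sigma> CARD('n) = 0"
    and sqrtU: "pos_semidef sqrtU" "sqrtU ** sqrtU = U"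
begin

lemma U_sym: "transpose U = U" and sqrtU_sym: "transpose sqrtU = sqrtU"
  using U_psd sqrtU by (auto simp: pos_semidef_def)

lemma \<sigma>_mono: "1 \<le> r \<Longrightarrow> r \<le> s \<Longrightarrow> s \<le> CARD('n) \<Longrightarrow> \<sigma> s \<le> \<sigma> r"
  using U_eig(1) unfolding eigenvalues_desc_def by blast

lemma \<sigma>1: "\<sigma> (CARD('n) - 1) \<le> \<sigma> 1" "0 < \<sigma> 1"
proof -
  show "\<sigma> (CARD('n) - 1) \<le> \<sigma> 1" using card by (intro \<sigma>_mono) auto
  then show "0 < \<sigma> 1" using U_eig(2) by simp
qed

text \<open>The Rayleigh minimum of \<open>- U\<close> is attained at an eigenvector, whose
  eigenvalue for \<open>U\<close> is one of the \<sigma>.\<close>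

lemma quadratic_form_upper: "w \<bullet> (U *v w) \<le> \<sigma> 1 * (w \<bullet> w)"
proof -
  have neg: "(- U) *v v = - (U *v v)" for v
    by (simp add: matrix_vector_mult_def vec_eq_iff sum_negf)
  have "transpose (- U) = - U" using U_sym by (simp add: transpose_def vec_eq_iff)
  moreover have "(UNIV :: (real^'n) set) \<noteq> {0}"
    by (metis UNIV_I axis_eq_0_iff singletonD zero_neq_one)
  ultimately obtain a v where v: "v \<noteq> 0" "(- U) *v v = a *\<^sub>R v" "a * (w \<bullet> w) \<le> w \<bullet> ((- U) *v w)"
    using symmetric_Rayleigh_minimum[of "- U" UNIV] by (metis UNIV_I subspace_UNIV)
  from v(2) have "U *v v = (- a) *\<^sub>R v" unfolding neg by (metis add.inverse_inverse scaleR_minus_left)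
  then obtain r where r: "r \<in> {1..CARD('n)}" "- a = \<sigma> r"
    using eigenvalue_iff[OF U_eig(1)] v(1) by metis
  then have "- a \<le> \<sigma> 1" using \<sigma>_mono[of 1 r] by auto
  then have "- a * (w \<bullet> w) \<le> \<sigma> 1 * (w \<bullet> w)" by (intro mult_right_mono) auto
  then show ?thesis using v(3) unfolding neg by simp
qed

lemma U_one: "U *v (\<chi> i. 1) = 0"
  using U_null span_base[of "\<chi> i. 1" "{\<chi> i. 1}"] by blast

text \<open>The orthogonal complement of the constant vector is invariant and meets the kernel of
  \<open>U\<close> only in 0, so the Rayleigh minimum on it is a positive eigenvalue.\<close>

lemma quadratic_form_lower:
  assumes "w \<bullet> (\<chi> i. 1) = 0"
  shows "\<sigma> (CARD('n) - 1) * (w \<bullet> w) \<le> w \<bullet> (U *v w)"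
proof (cases "w = 0")
  case False
  define S where "S = {v :: real^'n. v \<bullet> (\<chi> i. 1) = 0}"
  have "subspace S" unfolding S_def by (rule subspace_hyperplane2)
  moreover have "S \<noteq> {0}" using assms False by (auto simp: S_def)
  moreover have "U *v v \<in> S" for v
    unfolding S_def using inner_symmetric_matrix[OF U_sym, of v "\<chi> i. 1"] U_one by simp
  ultimately obtain a v where v: "v \<in> S" "v \<noteq> 0" "U *v v = a *\<^sub>R v"
    and le: "\<And>w. w \<in> S \<Longrightarrow> a * (w \<bullet> w) \<le> w \<bullet> (U *v w)"
    using symmetric_Rayleigh_minimum[OF U_sym] by metis
  have "a \<noteq> 0"
  proof
    assume "a = 0"
    then have "v \<in> span {\<chi> i. 1}" using v(3) U_null by auto
    then obtain t where "v = t *\<^sub>R (\<chi> i. 1)" by (auto simp: span_singleton)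
    then have "v \<bullet> v = t * (v \<bullet> (\<chi> i. 1))" by simp
    then show False using v by (simp add: S_def)
  qed
  moreover have "0 \<le> a * (v \<bullet> v)"
    using U_psd v(3) unfolding pos_semidef_def by (metis inner_scaleR_right)
  then have "0 \<le> a" using v(2) by (metis inner_gt_zero_iff zero_le_mult_iff not_less)
  moreover obtain r where r: "r \<in> {1..CARD('n)}" "a = \<sigma> r"
    using eigenvalue_iff[OF U_eig(1)] v by metis
  \<comment> \<open>The last eigenvalue is 0 and \<open>a\<close> is not, so the index is at most n
    - 1 and monotonicity applies.\<close>
  ultimately have "r \<noteq> CARD('n)" using U_eig(3) by auto
  then have "\<sigma> (CARD('n) - 1) \<le> a" unfolding r(2) using r(1) card by (intro \<sigma>_mono) auto
  then have "\<sigma> (CARD('n) - 1) * (w \<bullet> w) \<le> a * (w \<bullet> w)" by (intro mult_right_mono) auto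
  then show ?thesis using le[of w] assms by (simp add: S_def)
qed simp

lemma norm_sqrtU_mult: "(norm (sqrtU *v v))\<^sup>2 = v \<bullet> (U *v v)"
  unfolding power2_norm_eq_inner inner_symmetric_matrix[OF sqrtU_sym, symmetric]
    matrix_vector_mul_assoc sqrtU(2) ..

text \<open>The Frobenius norm dominates the operator norm, here at a top eigenvector. It converts
  the norm of \<open>sqrtU\<close> in the parameters c and \<gamma> into spectral
  quantities.\<close>

lemma \<sigma>1_le_norm: "\<sigma> 1 \<le> (norm sqrtU)\<^sup>2"
proof -
  obtain v where v: "v \<noteq> 0" "U *v v = \<sigma> 1 *\<^sub>R v"
    using eigenvalue_iff[OF U_eig(1), of "\<sigma> 1"] by fastforce
  have "\<sigma> 1 * (norm v)\<^sup>2 = (norm (sqrtU *v v))\<^sup>2"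
    unfolding norm_sqrtU_mult v(2) by (simp add: power2_norm_eq_inner)
  also have "\<dots> \<le> (norm sqrtU)\<^sup>2 * (norm v)\<^sup>2"
    using power_mono[OF norm_matrix_vector_mult_le, of sqrtU v 2] by (simp add: power_mult_distrib)
  finally show ?thesis using v(1) by simp
qed

lemma norm_rmult_sqrtU:
  fixes X :: "'a::euclidean_space^'n"
  shows "(norm (rmult X sqrtU))\<^sup>2 = (\<Sum>b\<in>Basis. coord b X \<bullet> (U *v coord b X))"
  unfolding power2_norm_eq_inner inner_coord[of "rmult X sqrtU" "rmult X sqrtU"] coord_rmult sqrtU_sym
  by (simp add: norm_sqrtU_mult[symmetric] power2_norm_eq_inner)

lemma norm_rmult_sqrtU_upper:
  fixes X :: "'a::euclidean_space^'n"
  shows "(norm (rmult X sqrtU))\<^sup>2 \<le> \<sigma> 1 * (norm X)\<^sup>2"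
  unfolding norm_rmult_sqrtU power2_norm_eq_inner[of X] inner_coord[of X X] sum_distrib_left
  by (intro sum_mono quadratic_form_upper)

lemma norm_rmult_sqrtU_lower:
  fixes X :: "'a::euclidean_space^'n"
  assumes "(\<Sum>i\<in>UNIV. X $ i) = 0"
  shows "\<sigma> (CARD('n) - 1) * (norm X)\<^sup>2 \<le> (norm (rmult X sqrtU))\<^sup>2"
  unfolding norm_rmult_sqrtU power2_norm_eq_inner[of X] inner_coord[of X X] sum_distrib_left
proof (intro sum_mono quadratic_form_lower)
  fix b :: 'a
  have "coord b X \<bullet> (\<chi> i. 1) = (\<Sum>i\<in>UNIV. X $ i) \<bullet> b"
    by (simp add: coord_def inner_vec_def[of "vec_lambda _"] inner_sum_left)
  then show "coord b X \<bullet> (\<chi> i. 1) = 0" using assms by simp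
qed

lemma sqrtU_one: "sqrtU *v (\<chi> i. 1) = 0"
  using norm_sqrtU_mult[of "\<chi> i. 1"] U_one by simp

text \<open>Every update of the auxiliary sequences has this form, which keeps their column sums at
  zero.\<close>

lemma sum_rmult_sqrtU:
  fixes X :: "'a::euclidean_space^'n"
  shows "(\<Sum>i\<in>UNIV. rmult X sqrtU $ i) = 0"
proof -
  have "(\<Sum>i\<in>UNIV. rmult X sqrtU $ i) = (\<Sum>j\<in>UNIV. (sqrtU *v (\<chi> i. 1)) $ j *\<^sub>R X $ j)"
    unfolding rmult_def by (simp add: matrix_vector_mult_def scaleR_sum_left) (subst sum.swap, simp)
  then show ?thesis unfolding sqrtU_one by simp
qed

text \<open>The dual objective is constant along equal columns, so a minimizer among zero column
  sums is a global one.\<close>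

lemma rmult_const_sqrtU:
  fixes a :: "'a::euclidean_space"
  shows "rmult (\<chi> i. a) sqrtU = 0"
proof -
  have "(\<Sum>j\<in>UNIV. sqrtU $ j $ i) = (transpose sqrtU *v (\<chi> i. 1)) $ i" for i
    by (simp add: matrix_vector_mult_def transpose_def)
  then have "(\<Sum>j\<in>UNIV. sqrtU $ j $ i) = 0" for i
    unfolding sqrtU_sym sqrtU_one by simp
  then show ?thesis by (simp add: rmult_def vec_eq_iff flip: scaleR_sum_left)
qed

end

subsection \<open>Random variables determined by finitely many samples\<close>

locale sampling = prob_space M for M :: "'w measure" +
  fixes m :: nat and J :: "'t \<Rightarrow> 'w \<Rightarrow> nat"
  assumes m_pos: "1 \<le> m"
    and J_indep: "indep_vars (\<lambda>_. count_space {..<m}) J UNIV"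
    and J_unif: "\<And>t. distr M (count_space {..<m}) (J t) = uniform_count_measure {..<m}"
begin

text \<open>Stated by comparing two outcomes instead of through a generated sigma-algebra: it is
  then preserved by arbitrary functions, including \<open>ARG_MIN\<close> and the branching of the
  lazy condition, without measurability conditions.\<close>

definition determined :: "'t set \<Rightarrow> ('w \<Rightarrow> 'b) \<Rightarrow> bool" where
  "determined A X \<longleftrightarrow> finite A \<and>
     (\<forall>\<omega>\<in>space M. \<forall>\<omega>'\<in>space M. (\<forall>t\<in>A. J t \<omega> = J t \<omega>') \<longrightarrow> X \<omega> = X \<omega>')"

lemma determinedI:
  assumes "finite A"
    and "\<And>\<omega> \<omega>'. \<omega> \<in> space M \<Longrightarrow> \<omega>' \<in> space M \<Longrightarrow> (\<And>t. t \<in> A \<Longrightarrow> J t \<omega> = J t \<omega>') \<Longrightarrow> X \<omega> = X \<omega>'"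
  shows "determined A X"
  using assms unfolding determined_def by blast

lemma determinedD:
  assumes "determined A X" "\<omega> \<in> space M" "\<omega>' \<in> space M" "\<And>t. t \<in> A \<Longrightarrow> J t \<omega> = J t \<omega>'"
  shows "X \<omega> = X \<omega>'"
  using assms unfolding determined_def by blast

lemma determined_comp: "determined A X \<Longrightarrow> determined A (\<lambda>\<omega>. g (X \<omega>))"
  unfolding determined_def by metis

lemma determined_comp2: "determined A X \<Longrightarrow> determined A Y \<Longrightarrow> determined A (\<lambda>\<omega>. g (X \<omega>) (Y \<omega>))"
  unfolding determined_def by metis

lemma determined_mono: "determined A X \<Longrightarrow> A \<subseteq> B \<Longrightarrow> finite B \<Longrightarrow> determined B X"
  unfolding determined_def by blast

lemma J_measurable: "J t \<in> measurable M (count_space {..<m})"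
  using J_indep unfolding indep_vars_def by simp

lemma J_less: "\<omega> \<in> space M \<Longrightarrow> J t \<omega> < m"
  using measurable_space[OF J_measurable] by simp

text \<open>The factor \<open>g\<close> evaluates \<open>X\<close> at a chosen outcome with the same
  samples.\<close>

lemma determined_factor:
  assumes "determined A X"
  obtains g where "\<And>\<omega>. \<omega> \<in> space M \<Longrightarrow> X \<omega> = g (restrict (\<lambda>t. J t \<omega>) A)"
proof
  fix \<omega> assume \<omega>: "\<omega> \<in> space M"
  let ?P = "\<lambda>\<omega>'. \<omega>' \<in> space M \<and> restrict (\<lambda>t. J t \<omega>') A = restrict (\<lambda>t. J t \<omega>) A"
  define \<omega>' where "\<omega>' = (SOME \<omega>'. ?P \<omega>')"
  have "?P \<omega>'" unfolding \<omega>'_def by (rule someI[of ?P \<omega>]) (use \<omega> in simp)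
  then have "J t \<omega>' = J t \<omega>" if "t \<in> A" for t
    using that by (metis restrict_apply')
  then have "X \<omega> = X \<omega>'"
    using \<omega> \<open>?P \<omega>'\<close> by (intro determinedD[OF assms]) auto
  then show "X \<omega> = (\<lambda>y. X (SOME \<omega>'. \<omega>' \<in> space M \<and> restrict (\<lambda>t. J t \<omega>') A = y)) (restrict (\<lambda>t. J t \<omega>) A)"
    unfolding \<omega>'_def .
qed

lemma measurable_finite_samples:
  assumes "finite A"
  shows "(g :: ('t \<Rightarrow> nat) \<Rightarrow> real) \<in> borel_measurable (PiM A (\<lambda>_. count_space {..<m}))"
  using assms by (subst count_space_PiM_finite) auto

lemma samples_measurable:
  "(\<lambda>\<omega>. restrict (\<lambda>t. J t \<omega>) A) \<in> measurable M (PiM A (\<lambda>_. count_space {..<m}))"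
  by (intro measurable_restrict J_measurable)

text \<open>A finite product of finite discrete spaces is discrete, so \<open>g\<close> is
  measurable; it is bounded by the sum of its absolute values over all sample vectors.\<close>

lemma determined_integrable:
  fixes X :: "'w \<Rightarrow> real"
  assumes "determined A X"
  shows "integrable M X"
proof -
  have A: "finite A" using assms by (simp add: determined_def)
  obtain g where g: "\<And>\<omega>. \<omega> \<in> space M \<Longrightarrow> X \<omega> = g (restrict (\<lambda>t. J t \<omega>) A)"
    using determined_factor[OF assms] by blast
  have "finite (PiE A (\<lambda>_. {..<m}))" using A by (intro finite_PiE) auto
  then have bound: "\<bar>g (restrict (\<lambda>t. J t \<omega>) A)\<bar> \<le> (\<Sum>y\<in>PiE A (\<lambda>_. {..<m}). \<bar>g y\<bar>)" if "\<omega> \<in> space M" for \<omega>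
    using J_less[OF that] by (intro member_le_sum) auto
  have "integrable M (\<lambda>\<omega>. g (restrict (\<lambda>t. J t \<omega>) A))"
    using measurable_compose[OF samples_measurable measurable_finite_samples[OF A]] bound
    by (intro integrable_const_bound[where B="\<Sum>y\<in>PiE A (\<lambda>_. {..<m}). \<bar>g y\<bar>"] AE_I2) auto
  then show ?thesis using g by (simp cong: Bochner_Integration.integrable_cong)
qed

lemma expectation_sample_eq: 
  assumes "r < m"
  shows "expectation (\<lambda>\<omega>. if J t \<omega> = r then 1 else 0) = 1 / real m"
proof -
  have "expectation (\<lambda>\<omega>. if J t \<omega> = r then 1 else 0) = expectation (indicator (J t -` {r} \<inter> space M))"
    by (intro Bochner_Integration.integral_cong) (auto simp: indicator_def)
  also have "\<dots> = measure M (J t -` {r} \<inter> space M)" by simp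
  also have "\<dots> = measure (distr M (count_space {..<m}) (J t)) {r}"
    using assms J_measurable by (subst measure_distr) auto
  also have "\<dots> = 1 / real m"
    unfolding J_unif using assms by (subst measure_uniform_count_measure) auto
  finally show ?thesis .
qed

text \<open>The tower property for a fresh uniform sample. Split by the value \<open>r\<close> of
  the sample: since \<open>t\<close> is outside \<open>A\<close>, the indicator of that value is
  independent of \<open>X\<close> and has mean 1/m.\<close>

lemma expectation_resample:
  fixes \<Psi> :: "'b \<Rightarrow> nat \<Rightarrow> real"
  assumes X: "determined A X" and t: "t \<notin> A"
  shows "expectation (\<lambda>\<omega>. \<Psi> (X \<omega>) (J t \<omega>)) = expectation (\<lambda>\<omega>. (\<Sum>r<m. \<Psi> (X \<omega>) r) / real m)"
proof -
  have A: "finite A" using assms by (simp add: determined_def)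
  obtain g where g: "\<And>\<omega>. \<omega> \<in> space M \<Longrightarrow> X \<omega> = g (restrict (\<lambda>t. J t \<omega>) A)"
    using determined_factor[OF X] by blast
  have int: "integrable M (\<lambda>\<omega>. \<Psi> (X \<omega>) r)" for r
    by (rule determined_integrable[OF determined_comp[OF X, of "\<lambda>b. \<Psi> b r"]])
  have Jint: "integrable M (\<lambda>\<omega>. if J t \<omega> = r then 1 else 0 :: real)" for r
    by (rule determined_integrable[where A="{t}"]) (rule determinedI, auto)
  have ind: "indep_var borel (\<lambda>\<omega>. \<Psi> (g (restrict (\<lambda>t. J t \<omega>) A)) r) borel (\<lambda>\<omega>. if J t \<omega> = r then 1 else 0 :: real)" for r
  proof -
    have "indep_var borel ((\<lambda>y. \<Psi> (g y) r) \<circ> (\<lambda>\<omega>. restrict (\<lambda>t. J t \<omega>) A))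
        borel ((\<lambda>y. if y t = r then 1 else 0 :: real) \<circ> (\<lambda>\<omega>. restrict (\<lambda>t. J t \<omega>) {t}))"
      using t A by (intro indep_var_compose[OF indep_var_restrict[OF J_indep, of A "{t}"]]
          measurable_finite_samples) auto
    then show ?thesis by (simp add: o_def)
  qed
  have eq: "expectation (\<lambda>\<omega>. \<Psi> (X \<omega>) r * (if J t \<omega> = r then 1 else 0)) = expectation (\<lambda>\<omega>. \<Psi> (X \<omega>) r) / real m"
    and int2: "integrable M (\<lambda>\<omega>. \<Psi> (X \<omega>) r * (if J t \<omega> = r then 1 else 0))" if "r < m" for r
  proof -
    have int': "integrable M (\<lambda>\<omega>. \<Psi> (g (restrict (\<lambda>t. J t \<omega>) A)) r)"
      using int[of r] g by (simp cong: Bochner_Integration.integrable_cong)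
    have "expectation (\<lambda>\<omega>. \<Psi> (g (restrict (\<lambda>t. J t \<omega>) A)) r * (if J t \<omega> = r then 1 else 0))
        = expectation (\<lambda>\<omega>. \<Psi> (g (restrict (\<lambda>t. J t \<omega>) A)) r) * (1 / real m)"
      unfolding expectation_sample_eq[OF that, of t, symmetric]
      by (rule indep_var_lebesgue_integral[OF ind int' Jint])
    then show "expectation (\<lambda>\<omega>. \<Psi> (X \<omega>) r * (if J t \<omega> = r then 1 else 0)) = expectation (\<lambda>\<omega>. \<Psi> (X \<omega>) r) / real m"
      using g by (simp cong: Bochner_Integration.integral_cong)
    have "integrable M (\<lambda>\<omega>. \<Psi> (g (restrict (\<lambda>t. J t \<omega>) A)) r * (if J t \<omega> = r then 1 else 0))"
      by (rule indep_var_integrable[OF ind int' Jint])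
    then show "integrable M (\<lambda>\<omega>. \<Psi> (X \<omega>) r * (if J t \<omega> = r then 1 else 0))"
      using g by (simp cong: Bochner_Integration.integrable_cong)
  qed
  have "expectation (\<lambda>\<omega>. \<Psi> (X \<omega>) (J t \<omega>)) = expectation (\<lambda>\<omega>. \<Sum>r<m. \<Psi> (X \<omega>) r * (if J t \<omega> = r then 1 else 0))"
    using J_less by (intro Bochner_Integration.integral_cong) (auto simp: if_distrib[where f="\<lambda>x. _ * x"] cong: if_cong)
  also have "\<dots> = (\<Sum>r<m. expectation (\<lambda>\<omega>. \<Psi> (X \<omega>) r * (if J t \<omega> = r then 1 else 0)))"
    by (rule Bochner_Integration.integral_sum) (use int2 in simp)
  also have "\<dots> = (\<Sum>r<m. expectation (\<lambda>\<omega>. \<Psi> (X \<omega>) r)) / real m"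
    unfolding sum_divide_distrib by (intro sum.cong) (use eq in auto)
  also have "\<dots> = expectation (\<lambda>\<omega>. (\<Sum>r<m. \<Psi> (X \<omega>) r) / real m)"
    using int by (simp add: Bochner_Integration.integral_sum)
  finally show ?thesis .
qed

end

subsection \<open>Linear convergence of Katyusha\<close>

lemma kat_inner_cong:
  assumes "\<And>l'. l' < l \<Longrightarrow> js l' = js' l'"
  shows "kat_inner m h \<psi> L \<mu> js w pz l = kat_inner m h \<psi> L \<mu> js' w pz l"
  using assms by (induction l) (simp_all del: kat_inner.simps(2) add: kat_inner_Suc)

lemma kat_epochs_Suc:
  fixes m e :: nat and h :: "nat \<Rightarrow> 'v::real_inner \<Rightarrow> real" and \<psi> L \<mu> js \<theta>0
  defines "run \<equiv> kat_inner m h \<psi> L \<mu> (js e) (fst (kat_epochs m h \<psi> L \<mu> js \<theta>0 e)) (snd (kat_epochs m h \<psi> L \<mu> js \<theta>0 e))"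
    and "\<theta> \<equiv> 1 + kat_step_size m L \<mu> * \<mu>"
  shows "kat_epochs m h \<psi> L \<mu> js \<theta>0 (Suc e)
    = ((1 / (\<Sum>l<2 * m. \<theta> ^ l)) *\<^sub>R (\<Sum>l<2 * m. \<theta> ^ l *\<^sub>R fst (run (Suc l))), run (2 * m))"
  by (simp add: run_def \<theta>_def Let_def split_beta del: kat_inner.simps(2))

lemma kat_epochs_cong:
  assumes "\<And>e' l. e' < e \<Longrightarrow> l < 2 * m \<Longrightarrow> js e' l = js' e' l"
  shows "kat_epochs m h \<psi> L \<mu> js \<theta>0 e = kat_epochs m h \<psi> L \<mu> js' \<theta>0 e"
  using assms
proof (induction e)
  case (Suc e)
  have "kat_inner m h \<psi> L \<mu> (js e) w pz l = kat_inner m h \<psi> L \<mu> (js' e) w pz l" if "l \<le> 2 * m" for w pz l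
    using that Suc.prems by (intro kat_inner_cong) auto
  moreover have "kat_epochs m h \<psi> L \<mu> js \<theta>0 e = kat_epochs m h \<psi> L \<mu> js' \<theta>0 e"
    using Suc by simp
  ultimately show ?case
    unfolding kat_epochs_Suc by (auto intro!: arg_cong2[where f=scaleR] sum.cong simp del: kat_inner.simps(2))
qed simp

text \<open>The recursion multiplied by \<open>\<theta> ^ l\<close> telescopes in \<open>Z\<close> and, after a shift of index, almost
  telescopes in \<open>D\<close>.\<close>

lemma weighted_telescope:
  fixes D Z :: "nat \<Rightarrow> real"
  assumes step: "\<And>l. l < N \<Longrightarrow> D (Suc l) + b * \<theta> * Z (Suc l) \<le> d / 2 + a * D l + b * Z l"
    and "0 \<le> \<theta>"
  shows "(1 - a * \<theta>) * (\<Sum>l<N. \<theta> ^ l * D (Suc l)) + \<theta> ^ N * (a * D N + b * Z N)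
    \<le> d / 2 * (\<Sum>l<N. \<theta> ^ l) + (a * D 0 + b * Z 0)"
  using step
proof (induction N)
  case (Suc N)
  have "\<theta> ^ N * (D (Suc N) + b * \<theta> * Z (Suc N)) \<le> \<theta> ^ N * (d / 2 + a * D N + b * Z N)"
    using Suc.prems[of N] assms(2) by (intro mult_left_mono) auto
  moreover have "(1 - a * \<theta>) * (\<Sum>l<N. \<theta> ^ l * D (Suc l)) + \<theta> ^ N * (a * D N + b * Z N)
    \<le> d / 2 * (\<Sum>l<N. \<theta> ^ l) + (a * D 0 + b * Z 0)"
    using Suc by simp
  ultimately show ?case by (simp add: algebra_simps)
qed simp

context worker
begin

definition \<theta> :: real where
  "\<theta> = 1 + kat_step_size m L \<mu> * \<mu>"

definition S :: real where
  "S = (\<Sum>l<2 * m. \<theta> ^ l)"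

text \<open>The right-hand side of \<open>weighted_telescope\<close> with a = 1/2 - \<tau> and b =
  \<tau> (3\<tau>L/2), as a function of the state \<open>(w, (p, z))\<close> that enters an
  epoch.\<close>

definition \<Phi> :: "'v \<Rightarrow> 'v \<times> ('v \<times> 'v) \<Rightarrow> real" where
  "\<Phi> x st = S / 2 * (F x (fst st) - F x (opt x)) + (1 / 2 - \<tau>) * (F x (fst (snd st)) - F x (opt x))
     + \<tau> * (3 * \<tau> * L / 2) * (norm (snd (snd st) - opt x))\<^sup>2"

lemma \<theta>_ge_1: "1 \<le> \<theta>"
  using \<tau>_bounds L_pos \<mu> by (simp add: \<theta>_def kat_step_size_def)

lemma S_ge_2: "2 \<le> S"
proof -
  have "(\<Sum>l<2 * m. 1) \<le> (\<Sum>l<2 * m. \<theta> ^ l)"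
    using \<theta>_ge_1 by (intro sum_mono one_le_power)
  then have "real (2 * m) \<le> S" unfolding S_def by simp
  then show ?thesis using m by simp
qed

text \<open>Strong convexity of \<psi> enlarges the distance coefficient of a step exactly by
  \<theta>, which is why powers of \<theta> weight the snapshot average.\<close>

lemma step_size_strong_convexity: "3 * \<tau> * L / 2 + \<mu> / 2 = 3 * \<tau> * L / 2 * \<theta>"
  using \<tau>_bounds L_pos by (simp add: \<theta>_def kat_step_size_def field_simps)

lemma \<tau>_sq_le: "\<tau>\<^sup>2 \<le> 2 * real m * \<mu> / (3 * L)"
proof -
  have "\<tau>\<^sup>2 \<le> (sqrt (2 * real m * \<mu> / (3 * L)))\<^sup>2"
    using \<tau>_bounds by (intro power_mono) (auto simp: kat_tau_def)
  then show ?thesis using \<mu> L_pos by simp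
qed

lemma \<tau>_cases: "\<tau> = 1 / 2 \<or> \<tau> = sqrt (2 * real m * \<mu> / (3 * L))"
  unfolding kat_tau_def min_def by simp

text \<open>By Bernoulli it is enough that 2m (\<theta> - 1) = 2m\<mu>/(3\<tau>L) is at least
  \<tau>, which is \<open>\<tau>_sq_le\<close>.\<close>

lemma \<theta>_power_ge: "1 + \<tau> \<le> \<theta> ^ (2 * m)"
proof -
  have "\<tau> \<le> 2 * real m * (kat_step_size m L \<mu> * \<mu>)"
    using \<tau>_sq_le \<tau>_bounds L_pos by (simp add: kat_step_size_def field_simps power2_eq_square)
  moreover have "1 + real (2 * m) * (\<theta> - 1) \<le> (1 + (\<theta> - 1)) ^ (2 * m)"
    using \<theta>_ge_1 by (intro Bernoulli_inequality) simp
  ultimately show ?thesis by (simp add: \<theta>_def)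
qed

text \<open>The left-hand side is 1 + \<tau> times the coefficient 1/2 that the averaged gaps have
  in the next potential. If \<tau> is below 1/2 it equals the square root, and then \<theta> - 1 =
  \<tau>/(2m).\<close>

lemma \<theta>_contraction: "(1 + \<tau>) / 2 \<le> 1 - (1 / 2 - \<tau>) * \<theta>"
proof (cases "\<tau> = 1 / 2")
  case False
  then have "\<tau> = sqrt (2 * real m * \<mu> / (3 * L))" using \<tau>_cases by blast
  then have "\<tau>\<^sup>2 = 2 * real m * \<mu> / (3 * L)" using \<mu> L_pos by simp
  then have "kat_step_size m L \<mu> * \<mu> = \<tau> / (2 * real m)"
    using \<tau>_bounds L_pos m by (simp add: kat_step_size_def field_simps power2_eq_square)
  also have "\<dots> \<le> \<tau> / 2" using \<tau>_bounds m by (intro divide_left_mono) auto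
  finally have "(1 / 2 - \<tau>) * (kat_step_size m L \<mu> * \<mu>) \<le> (1 / 2 - \<tau>) * (\<tau> / 2)"
    using \<tau>_bounds by (intro mult_left_mono) auto
  also have "\<dots> \<le> \<tau> / 2" using \<tau>_bounds by (simp add: algebra_simps)
  finally show ?thesis by (simp add: \<theta>_def field_simps)
next
  case True
  show ?thesis unfolding True by simp
qed

lemma F_weighted_average:
  "S * (F x ((1 / S) *\<^sub>R (\<Sum>l<2 * m. \<theta> ^ l *\<^sub>R p l)) - F x (opt x)) \<le> (\<Sum>l<2 * m. \<theta> ^ l * (F x (p l) - F x (opt x)))"
proof -
  let ?v = "(1 / S) *\<^sub>R (\<Sum>l<2 * m. \<theta> ^ l *\<^sub>R p l)"
  let ?g = "gf ?v - x"
  have "F x ?v + ?g \<bullet> (p l - ?v) \<le> F x (p l)" for l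
  proof -
    have "0 \<le> \<mu> / 2 * (norm (p l - ?v))\<^sup>2" using \<mu> by simp
    then show ?thesis using qbounds_lower[OF qbounds_F, of x ?v "p l"] by linarith
  qed
  then have "(\<Sum>l<2 * m. \<theta> ^ l * (F x ?v + ?g \<bullet> (p l - ?v) - F x (opt x)))
      \<le> (\<Sum>l<2 * m. \<theta> ^ l * (F x (p l) - F x (opt x)))"
    using \<theta>_ge_1 by (intro sum_mono mult_left_mono) auto
  also have "(\<Sum>l<2 * m. \<theta> ^ l * (F x ?v + ?g \<bullet> (p l - ?v) - F x (opt x)))
      = S * (F x ?v - F x (opt x)) + ?g \<bullet> (\<Sum>l<2 * m. \<theta> ^ l *\<^sub>R (p l - ?v))"
    unfolding inner_sum_right S_def sum_distrib_right sum.distrib[symmetric]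
    by (intro sum.cong) (auto simp: algebra_simps)
  also have "(\<Sum>l<2 * m. \<theta> ^ l *\<^sub>R (p l - ?v)) = (\<Sum>l<2 * m. \<theta> ^ l *\<^sub>R p l) - S *\<^sub>R ?v"
    by (simp only: scaleR_diff_right sum_subtractf S_def scaleR_sum_left)
  also have "\<dots> = 0" using S_ge_2 by simp
  finally show ?thesis by simp
qed

lemma \<Phi>_lower: "S * \<mu> / 4 * (norm (fst st - opt x))\<^sup>2 \<le> \<Phi> x st"
proof -
  have "S / 2 * (\<mu> / 2 * (norm (fst st - opt x))\<^sup>2) \<le> S / 2 * (F x (fst st) - F x (opt x))"
    using S_ge_2 by (intro mult_left_mono F_opt_lower) auto
  moreover have "0 \<le> (1 / 2 - \<tau>) * (F x (fst (snd st)) - F x (opt x))"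
    using \<tau>_bounds F_opt_le by (intro mult_nonneg_nonneg) auto
  moreover have "0 \<le> \<tau> * (3 * \<tau> * L / 2) * (norm (snd (snd st) - opt x))\<^sup>2"
    using \<tau>_bounds L_pos by simp
  moreover have "S * \<mu> / 4 * (norm (fst st - opt x))\<^sup>2 = S / 2 * (\<mu> / 2 * (norm (fst st - opt x))\<^sup>2)" by simp
  ultimately show ?thesis unfolding \<Phi>_def by linarith
qed

text \<open>With all three points equal to \<open>y\<close> the terms are at most S N/4, N/4 and
  3N/8; since S is at least 2, the last two cost at most 5 S N/16.\<close>

lemma \<Phi>_start: "\<Phi> x (y, (y, y)) \<le> 9 / 16 * S * L * (norm (y - opt x))\<^sup>2"
proof -
  define N where "N = L * (norm (y - opt x))\<^sup>2"
  have N: "0 \<le> N" using L_pos by (simp add: N_def)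
  have F: "F x y - F x (opt x) \<le> N / 2" using F_opt_upper[of x y] by (simp add: N_def)
  have "S / 2 * (F x y - F x (opt x)) \<le> S / 2 * (N / 2)" using S_ge_2 F by (intro mult_left_mono) auto
  moreover have "(1 / 2 - \<tau>) * (F x y - F x (opt x)) \<le> 1 / 2 * (N / 2)"
    using \<tau>_bounds F F_opt_le[of x y] by (intro mult_mono) auto
  moreover have "\<tau> * \<tau> * N \<le> 1 / 2 * (1 / 2) * N"
    using \<tau>_bounds N by (intro mult_right_mono mult_mono) auto
  moreover have "2 * N \<le> S * N" using S_ge_2 N by (intro mult_right_mono) auto
  moreover have "\<tau> * (3 * \<tau> * L / 2) * (norm (y - opt x))\<^sup>2 = 3 / 2 * (\<tau> * \<tau> * N)" by (simp add: N_def)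
  moreover have "9 / 16 * S * L * (norm (y - opt x))\<^sup>2 = 9 / 16 * (S * N)" by (simp add: N_def)
  moreover have "S / 2 * (N / 2) = (S * N) / 4" by simp
  ultimately show ?thesis unfolding \<Phi>_def fst_conv snd_conv by linarith
qed

text \<open>The constant 9/4 is the quotient of 9/16 in \<open>\<Phi>_start\<close> and 1/4 in
  \<open>\<Phi>_lower\<close>. In both cases of \<tau> the product of \<tau> and 1 + sqrt (K/m) is
  at least 1/2, so \<tau> E dominates a multiple of the logarithm, and ln (1 + \<tau>) is at least
  \<tau>/2.\<close>

lemma contraction_factor:
  assumes c: "0 < c" "c \<le> 8 / 9" and K: "\<kappa> \<le> K" and E: "100 * (1 + sqrt (K / real m)) * ln (2 * K / c) \<le> real E"
  shows "9 / 4 * \<kappa> / (1 + \<tau>) ^ E \<le> c / 2"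
proof -
  have \<kappa>1: "1 \<le> \<kappa>" using \<mu>_le_L \<mu> by simp
  have lnpos: "0 \<le> ln (2 * K / c)"
  proof -
    have "1 \<le> 2 * K / c" using c \<kappa>1 K by (simp add: field_simps)
    then show ?thesis by simp
  qed
  have sq: "0 \<le> sqrt (K / real m)" using \<kappa>1 K by (intro real_sqrt_ge_zero) auto
  have "1 / 2 \<le> \<tau> * (1 + sqrt (K / real m))"
  proof (cases "\<tau> = 1 / 2")
    case True
    show ?thesis using sq unfolding True by simp
  next
    case False
    then have "\<tau> = sqrt (2 * real m * \<mu> / (3 * L))" using \<tau>_cases by blast
    then have "\<tau> * sqrt (\<kappa> / real m) = sqrt (2 / 3)"
      using m \<mu> L_pos by (simp flip: real_sqrt_mult)
    moreover have "1 / 2 \<le> sqrt (2 / 3)" by (rule real_le_rsqrt) (simp add: power2_eq_square)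
    moreover have "\<tau> * sqrt (\<kappa> / real m) \<le> \<tau> * sqrt (K / real m)"
      using \<tau>_bounds divide_right_mono[OF K, of "real m"] by (intro mult_left_mono) auto
    ultimately show ?thesis using \<tau>_bounds by (simp add: distrib_left)
  qed
  then have "100 * (1 / 2) * ln (2 * K / c) \<le> 100 * (\<tau> * (1 + sqrt (K / real m))) * ln (2 * K / c)"
    using lnpos by (intro mult_right_mono mult_left_mono) auto
  also have "\<dots> = \<tau> * (100 * (1 + sqrt (K / real m)) * ln (2 * K / c))" by simp
  also have "\<dots> \<le> \<tau> * real E" using \<tau>_bounds by (intro mult_left_mono E) auto
  finally have 1: "50 * ln (2 * K / c) \<le> \<tau> * real E" by simp
  have "1 - 1 / (1 + \<tau>) \<le> ln (1 + \<tau>)"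
    using ln_le_minus_one[of "1 / (1 + \<tau>)"] \<tau>_bounds by (simp add: ln_div)
  moreover have "\<tau> / 2 \<le> 1 - 1 / (1 + \<tau>)"
    using \<tau>_bounds by (simp add: field_simps power2_eq_square)
  ultimately have "\<tau> / 2 * real E \<le> ln (1 + \<tau>) * real E" by (intro mult_right_mono) auto
  with 1 lnpos have "2 * ln (2 * K / c) \<le> real E * ln (1 + \<tau>)" by (simp add: mult.commute)
  then have "ln ((2 * K / c)\<^sup>2) \<le> ln ((1 + \<tau>) ^ E)"
    using \<tau>_bounds c K \<kappa>1 by (simp add: ln_realpow)
  then have P: "(2 * K / c)\<^sup>2 \<le> (1 + \<tau>) ^ E"
    using \<tau>_bounds c K \<kappa>1 by (subst (asm) ln_le_cancel_iff) auto
  \<comment> \<open>Squaring 2K/c leaves a second factor c besides the one wanted; the bound 8/9 on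
    it turns 9/16 into 1/2.\<close>
  have "9 / 4 * \<kappa> / (1 + \<tau>) ^ E \<le> 9 / 4 * K / (2 * K / c)\<^sup>2"
    using K \<kappa>1 P c \<tau>_bounds by (intro frac_le) auto
  also have "\<dots> = 9 / 16 * c * (c / K)" using K \<kappa>1 c by (simp add: power2_eq_square field_simps)
  also have "\<dots> \<le> 9 / 16 * c * (c / 1)" using K \<kappa>1 c by (intro mult_left_mono divide_left_mono) auto
  also have "\<dots> \<le> 9 / 16 * c * (8 / 9)" using c by (intro mult_left_mono) auto
  also have "\<dots> = c / 2" by simp
  finally show ?thesis .
qed

end

section \<open>Katyusha with random samples and random starting data\<close>

locale sampled_worker = worker m f L \<mu> + sampling M m J
  for m :: nat and f :: "nat \<Rightarrow> 'v::euclidean_space \<Rightarrow> real" and L \<mu> :: real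
    and M :: "'w measure" and J :: "'t \<Rightarrow> 'w \<Rightarrow> nat"
begin

text \<open>In expectation \<open>kat_step_average\<close> becomes a recursion for the two real
  sequences \<open>D\<close> and \<open>Z\<close>, to which \<open>weighted_telescope\<close>
  applies; convexity passes from the weighted gaps to the gap of the new snapshot. The data may be
  random as long as the epoch's samples are new.\<close>

lemma epoch_contraction:
  fixes x w :: "'w \<Rightarrow> 'v" and pz :: "'w \<Rightarrow> 'v \<times> 'v" and t :: "nat \<Rightarrow> 't"
  assumes x: "determined A x" and w: "determined A w" and pz: "determined A pz"
    and t: "inj_on t {..<2 * m}" "t ` {..<2 * m} \<inter> A = {}"
  defines "run \<equiv> \<lambda>\<omega>. kat_inner m h (\<psi> (x \<omega>)) L \<mu> (\<lambda>l. J (t l) \<omega>) (w \<omega>) (pz \<omega>)"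
  defines "w' \<equiv> \<lambda>\<omega>. (1 / S) *\<^sub>R (\<Sum>l<2 * m. \<theta> ^ l *\<^sub>R fst (run \<omega> (Suc l)))"
  shows "(1 + \<tau>) * expectation (\<lambda>\<omega>. \<Phi> (x \<omega>) (w' \<omega>, run \<omega> (2 * m))) \<le> expectation (\<lambda>\<omega>. \<Phi> (x \<omega>) (w \<omega>, pz \<omega>))"
proof -
  define A' where "A' = (\<lambda>l. A \<union> t ` {..<l})"
  have finA: "finite A" using x by (simp add: determined_def)
  have run: "determined (A' l) (\<lambda>\<omega>. run \<omega> l)" for l
  proof (rule determinedI)
    fix \<omega> \<omega>' assume *: "\<omega> \<in> space M" "\<omega>' \<in> space M" "\<And>q. q \<in> A' l \<Longrightarrow> J q \<omega> = J q \<omega>'"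
    then have A: "\<And>q. q \<in> A \<Longrightarrow> J q \<omega> = J q \<omega>'" by (simp add: A'_def)
    then have eq: "x \<omega> = x \<omega>'" "w \<omega> = w \<omega>'" "pz \<omega> = pz \<omega>'"
      using determinedD[OF x *(1,2)] determinedD[OF w *(1,2)] determinedD[OF pz *(1,2)] by blast+
    show "run \<omega> l = run \<omega>' l"
      unfolding run_def eq using * by (intro kat_inner_cong) (auto simp: A'_def)
  qed (use finA in \<open>simp add: A'_def\<close>)
  have xA: "determined (A' l) x" and wA: "determined (A' l) w" for l
    using finA by (auto simp: A'_def intro!: determined_mono[OF x] determined_mono[OF w])
  define xw where "xw = (\<lambda>l \<omega>. (x \<omega>, w \<omega>, run \<omega> l))"
  have xw: "determined (A' l) (xw l)" for l
    unfolding xw_def using determined_comp2[OF xA determined_comp2[OF wA run]] .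
  have int: "integrable M (\<lambda>\<omega>. g (xw l \<omega>))" for g :: "_ \<Rightarrow> real" and l
    by (rule determined_integrable[OF determined_comp[OF xw]])
  define gap where "gap = (\<lambda>x y. F x y - F x (opt x))"
  define B where "B = 3 * \<tau> * L / 2"
  have \<Phi>_eq: "\<Phi> y st = S / 2 * gap y (fst st) + (1 / 2 - \<tau>) * gap y (fst (snd st))
      + \<tau> * B * (norm (snd (snd st) - opt y))\<^sup>2" for y st
    by (simp add: \<Phi>_def gap_def B_def)
  define D where "D = (\<lambda>l. expectation (\<lambda>\<omega>. gap (x \<omega>) (fst (run \<omega> l))))"
  define Z where "Z = (\<lambda>l. expectation (\<lambda>\<omega>. (norm (snd (run \<omega> l) - opt (x \<omega>)))\<^sup>2))"
  define dw where "dw = expectation (\<lambda>\<omega>. gap (x \<omega>) (w \<omega>))"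
  have intD: "integrable M (\<lambda>\<omega>. gap (x \<omega>) (fst (run \<omega> l)))" for l
    using int[of "\<lambda>(x, w, r). gap x (fst r)" l] by (simp add: xw_def)
  have intZ: "integrable M (\<lambda>\<omega>. (norm (snd (run \<omega> l) - opt (x \<omega>)))\<^sup>2)" for l
    using int[of "\<lambda>(x, w, r). (norm (snd r - opt x))\<^sup>2" l] by (simp add: xw_def)
  have intw: "integrable M (\<lambda>\<omega>. gap (x \<omega>) (w \<omega>))"
    using int[of "\<lambda>(x, w, r). gap x w" 0] by (simp add: xw_def)
  have step: "D (Suc l) + \<tau> * B * \<theta> * Z (Suc l) \<le> dw / 2 + (1 / 2 - \<tau>) * D l + \<tau> * B * Z l" if l: "l < 2 * m" for l
  proof -
    define V where "V = (\<lambda>x r. gap x (fst r) + \<tau> * B * \<theta> * (norm (snd r - opt x))\<^sup>2)"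
    define st where "st = (\<lambda>(x, w, r). kat_step m h (\<psi> x) L \<mu> w r)"
    have "t l \<notin> A' l"
    proof
      assume "t l \<in> A' l"
      then consider "t l \<in> A" | l' where "l' < l" "t l = t l'" by (auto simp: A'_def)
      then show False
        by cases (use t(2) l in blast, use inj_onD[OF t(1)] l in fastforce)
    qed
    note res = expectation_resample[OF xw this, of "\<lambda>y r. V (fst y) (st y r)"]
    have "D (Suc l) + \<tau> * B * \<theta> * Z (Suc l) = expectation (\<lambda>\<omega>. V (x \<omega>) (run \<omega> (Suc l)))"
      unfolding D_def Z_def V_def using intD[of "Suc l"] intZ[of "Suc l"]
      by (simp add: Bochner_Integration.integral_add)
    also have "\<dots> = expectation (\<lambda>\<omega>. V (fst (xw l \<omega>)) (st (xw l \<omega>) (J (t l) \<omega>)))"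
      unfolding run_def kat_inner_Suc st_def xw_def by simp
    also have "\<dots> = expectation (\<lambda>\<omega>. (\<Sum>r<m. V (fst (xw l \<omega>)) (st (xw l \<omega>) r)) / real m)"
      by (rule res)
    also have "\<dots> \<le> expectation (\<lambda>\<omega>. 1 / 2 * gap (x \<omega>) (w \<omega>) + ((1 / 2 - \<tau>) * gap (x \<omega>) (fst (run \<omega> l))
        + \<tau> * B * (norm (snd (run \<omega> l) - opt (x \<omega>)))\<^sup>2))"
    proof (rule integral_mono)
      show "integrable M (\<lambda>\<omega>. (\<Sum>r<m. V (fst (xw l \<omega>)) (st (xw l \<omega>) r)) / real m)"
        by (rule int)
      show "integrable M (\<lambda>\<omega>. 1 / 2 * gap (x \<omega>) (w \<omega>) + ((1 / 2 - \<tau>) * gap (x \<omega>) (fst (run \<omega> l))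
        + \<tau> * B * (norm (snd (run \<omega> l) - opt (x \<omega>)))\<^sup>2))"
        using intD[of l] intZ[of l] intw by auto
      fix \<omega>
      let ?x = "x \<omega>"
      let ?st = "kat_step m h (\<psi> ?x) L \<mu> (w \<omega>) (run \<omega> l)"
      have "(\<Sum>r<m. V ?x (?st r)) / real m = (\<Sum>r<m. F ?x (fst (?st r))
          + \<tau> * ((3 * \<tau> * L / 2 + \<mu> / 2) * (norm (snd (?st r) - opt ?x))\<^sup>2)) / real m - F ?x (opt ?x)"
        unfolding V_def gap_def step_size_strong_convexity unfolding B_def[symmetric] using m
        by (simp add: sum.distrib sum_subtractf add_divide_distrib diff_divide_distrib mult.assoc)
      also have "\<dots> \<le> \<tau> * F ?x (opt ?x) + 1 / 2 * F ?x (w \<omega>) + (1 - \<tau> - 1 / 2) * F ?x (fst (run \<omega> l))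
          + \<tau> * (B * (norm (snd (run \<omega> l) - opt ?x))\<^sup>2) - F ?x (opt ?x)"
        using kat_step_average[of ?x "w \<omega>" "run \<omega> l" "opt ?x"] unfolding B_def by simp
      also have "\<dots> = 1 / 2 * gap ?x (w \<omega>) + ((1 / 2 - \<tau>) * gap ?x (fst (run \<omega> l))
          + \<tau> * B * (norm (snd (run \<omega> l) - opt ?x))\<^sup>2)"
        unfolding gap_def by (simp add: algebra_simps)
      finally show "(\<Sum>r<m. V (fst (xw l \<omega>)) (st (xw l \<omega>) r)) / real m \<le> 1 / 2 * gap ?x (w \<omega>)
          + ((1 / 2 - \<tau>) * gap ?x (fst (run \<omega> l)) + \<tau> * B * (norm (snd (run \<omega> l) - opt ?x))\<^sup>2)"
        unfolding xw_def st_def by simp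
    qed
    also have "\<dots> = dw / 2 + (1 / 2 - \<tau>) * D l + \<tau> * B * Z l"
      unfolding D_def Z_def dw_def using intD[of l] intZ[of l] intw by (simp add: Bochner_Integration.integral_add)
    finally show ?thesis .
  qed
  \<comment> \<open>By Jensen this dominates S times the expected gap of the new snapshot.\<close>
  define T where "T = (\<Sum>l<2 * m. \<theta> ^ l * D (Suc l))"
  have tel: "(1 - (1 / 2 - \<tau>) * \<theta>) * T + \<theta> ^ (2 * m) * ((1 / 2 - \<tau>) * D (2 * m) + \<tau> * B * Z (2 * m))
      \<le> dw / 2 * S + ((1 / 2 - \<tau>) * D 0 + \<tau> * B * Z 0)"
    unfolding T_def S_def using step \<theta>_ge_1 by (intro weighted_telescope) auto
  have D: "0 \<le> D l" and Z: "0 \<le> Z l" for l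
    unfolding D_def Z_def gap_def using F_opt_le by (auto intro!: integral_nonneg_AE)
  have "0 \<le> T" unfolding T_def using D \<theta>_ge_1 by (intro sum_nonneg) auto
  then have "(1 + \<tau>) / 2 * T \<le> (1 - (1 / 2 - \<tau>) * \<theta>) * T"
    by (intro mult_right_mono \<theta>_contraction)
  moreover have "(1 + \<tau>) * ((1 / 2 - \<tau>) * D (2 * m) + \<tau> * B * Z (2 * m))
      \<le> \<theta> ^ (2 * m) * ((1 / 2 - \<tau>) * D (2 * m) + \<tau> * B * Z (2 * m))"
    using D Z \<tau>_bounds L_pos by (intro mult_right_mono \<theta>_power_ge) (auto simp: B_def)
  ultimately have main: "(1 + \<tau>) * (T / 2 + (1 / 2 - \<tau>) * D (2 * m) + \<tau> * B * Z (2 * m))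
      \<le> dw / 2 * S + (1 / 2 - \<tau>) * D 0 + \<tau> * B * Z 0"
    using tel distrib_left[of "1 + \<tau>" "T / 2" "(1 / 2 - \<tau>) * D (2 * m) + \<tau> * B * Z (2 * m)"]
    unfolding add.assoc by simp
  have detw: "determined (A' (2 * m)) w'"
  proof -
    have *: "determined (A' (2 * m)) (\<lambda>\<omega>. run \<omega> (Suc l))" if "l < 2 * m" for l
      using that finA by (intro determined_mono[OF run]) (auto simp: A'_def)
    show ?thesis
    proof (rule determinedI)
      show "finite (A' (2 * m))" using finA by (simp add: A'_def)
      fix \<omega> \<omega>' assume "\<omega> \<in> space M" "\<omega>' \<in> space M" "\<And>q. q \<in> A' (2 * m) \<Longrightarrow> J q \<omega> = J q \<omega>'"
      then have "run \<omega> (Suc l) = run \<omega>' (Suc l)" if "l < 2 * m" for l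
        using determinedD[OF *[OF that]] by blast
      then have "(\<Sum>l<2 * m. \<theta> ^ l *\<^sub>R fst (run \<omega> (Suc l))) = (\<Sum>l<2 * m. \<theta> ^ l *\<^sub>R fst (run \<omega>' (Suc l)))"
        by (intro sum.cong) auto
      then show "w' \<omega> = w' \<omega>'" by (simp only: w'_def)
    qed
  qed
  have intw': "integrable M (\<lambda>\<omega>. gap (x \<omega>) (w' \<omega>))"
    by (rule determined_integrable[OF determined_comp2[OF xA detw]])
  have "S * expectation (\<lambda>\<omega>. gap (x \<omega>) (w' \<omega>)) = expectation (\<lambda>\<omega>. S * gap (x \<omega>) (w' \<omega>))"
    by simp
  also have "\<dots> \<le> expectation (\<lambda>\<omega>. \<Sum>l<2 * m. \<theta> ^ l * gap (x \<omega>) (fst (run \<omega> (Suc l))))"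
    unfolding gap_def w'_def
    by (rule integral_mono[OF _ _ F_weighted_average])
       (use intw' intD in \<open>auto simp: gap_def w'_def\<close>)
  also have "\<dots> = T"
    unfolding T_def D_def using intD by (simp add: Bochner_Integration.integral_sum)
  finally have Tw: "S * expectation (\<lambda>\<omega>. gap (x \<omega>) (w' \<omega>)) \<le> T" .
  have "expectation (\<lambda>\<omega>. \<Phi> (x \<omega>) (w' \<omega>, run \<omega> (2 * m)))
      = S / 2 * expectation (\<lambda>\<omega>. gap (x \<omega>) (w' \<omega>)) + (1 / 2 - \<tau>) * D (2 * m) + \<tau> * B * Z (2 * m)"
    unfolding \<Phi>_eq fst_conv snd_conv D_def Z_def
    using intw' intD[of "2 * m"] intZ[of "2 * m"] by (simp add: Bochner_Integration.integral_add)
  also have "\<dots> \<le> T / 2 + (1 / 2 - \<tau>) * D (2 * m) + \<tau> * B * Z (2 * m)"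
    using Tw by simp
  finally have "(1 + \<tau>) * expectation (\<lambda>\<omega>. \<Phi> (x \<omega>) (w' \<omega>, run \<omega> (2 * m)))
      \<le> (1 + \<tau>) * (T / 2 + (1 / 2 - \<tau>) * D (2 * m) + \<tau> * B * Z (2 * m))"
    using \<tau>_bounds by (intro mult_left_mono) auto
  also note main
  also have "dw / 2 * S + (1 / 2 - \<tau>) * D 0 + \<tau> * B * Z 0 = expectation (\<lambda>\<omega>. \<Phi> (x \<omega>) (w \<omega>, pz \<omega>))"
    unfolding \<Phi>_eq fst_conv snd_conv D_def Z_def dw_def
    using intw intD[of 0] intZ[of 0] by (simp add: Bochner_Integration.integral_add run_def)
  finally show ?thesis .
qed

lemma epochs_contraction:
  fixes x y :: "'w \<Rightarrow> 'v" and t :: "nat \<Rightarrow> nat \<Rightarrow> 't"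
  assumes x: "determined A x" and y: "determined A y"
    and inj: "\<And>e l e' l'. t e l = t e' l' \<Longrightarrow> e = e' \<and> l = l'" and A: "\<And>e l. t e l \<notin> A"
  defines "st \<equiv> \<lambda>e \<omega>. kat_epochs m h (\<psi> (x \<omega>)) L \<mu> (\<lambda>e l. J (t e l) \<omega>) (y \<omega>) e"
  shows "(1 + \<tau>) ^ e * expectation (\<lambda>\<omega>. \<Phi> (x \<omega>) (st e \<omega>)) \<le> expectation (\<lambda>\<omega>. \<Phi> (x \<omega>) (y \<omega>, (y \<omega>, y \<omega>)))"
    and "determined (A \<union> case_prod t ` ({..<e} \<times> {..<2 * m})) (st e)"
proof -
  define A' where "A' = (\<lambda>e. A \<union> case_prod t ` ({..<e} \<times> {..<2 * m}))"
  have finA: "finite (A' e)" for e using x by (simp add: A'_def determined_def)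
  have det: "determined (A' e) (st e)" for e
  proof (rule determinedI[OF finA])
    fix \<omega> \<omega>' assume *: "\<omega> \<in> space M" "\<omega>' \<in> space M" "\<And>q. q \<in> A' e \<Longrightarrow> J q \<omega> = J q \<omega>'"
    then have A: "\<And>q. q \<in> A \<Longrightarrow> J q \<omega> = J q \<omega>'" by (simp add: A'_def)
    then have eq: "x \<omega> = x \<omega>'" "y \<omega> = y \<omega>'"
      using determinedD[OF x *(1,2)] determinedD[OF y *(1,2)] by blast+
    show "st e \<omega> = st e \<omega>'"
      unfolding st_def eq using * by (intro kat_epochs_cong) (force simp: A'_def)
  qed
  then show "determined (A \<union> case_prod t ` ({..<e} \<times> {..<2 * m})) (st e)"
    unfolding A'_def .
  show "(1 + \<tau>) ^ e * expectation (\<lambda>\<omega>. \<Phi> (x \<omega>) (st e \<omega>)) \<le> expectation (\<lambda>\<omega>. \<Phi> (x \<omega>) (y \<omega>, (y \<omega>, y \<omega>)))"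
  proof (induction e)
    case (Suc e)
    have "determined (A' e) x" using finA by (intro determined_mono[OF x]) (auto simp: A'_def)
    note epoch_contraction[OF this determined_comp[OF det] determined_comp[OF det], of "t e" fst snd]
    moreover have "inj_on (t e) {..<2 * m}" using inj by (auto simp: inj_on_def)
    moreover have "t e ` {..<2 * m} \<inter> A' e = {}"
    proof -
      have "t e l \<notin> A' e" for l using A inj unfolding A'_def by fastforce
      then show ?thesis by blast
    qed
    ultimately have "(1 + \<tau>) * expectation (\<lambda>\<omega>. \<Phi> (x \<omega>) (st (Suc e) \<omega>))
        \<le> expectation (\<lambda>\<omega>. \<Phi> (x \<omega>) (st e \<omega>))"
      unfolding st_def kat_epochs_Suc \<theta>_def[symmetric] S_def[symmetric] prod.collapse by blast
    then have "(1 + \<tau>) ^ e * ((1 + \<tau>) * expectation (\<lambda>\<omega>. \<Phi> (x \<omega>) (st (Suc e) \<omega>)))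
        \<le> (1 + \<tau>) ^ e * expectation (\<lambda>\<omega>. \<Phi> (x \<omega>) (st e \<omega>))"
      using \<tau>_bounds by (intro mult_left_mono) auto
    then show ?case using Suc by (simp add: mult_ac)
  qed (simp add: st_def)
qed

text \<open>The potential bounds the squared distance of the snapshot from below and is bounded by
  it from above at the start. The factor S cancels, so the rate depends on the condition number
  only.\<close>

lemma katyusha_contraction:
  fixes x y :: "'w \<Rightarrow> 'v" and t :: "nat \<Rightarrow> nat \<Rightarrow> 't"
  assumes x: "determined A x" and y: "determined A y"
    and inj: "\<And>e l e' l'. t e l = t e' l' \<Longrightarrow> e = e' \<and> l = l'" and A: "\<And>e l. t e l \<notin> A"
    and c: "0 < c" "c \<le> 8 / 9" and K: "\<kappa> \<le> K"
    and E: "100 * (1 + sqrt (K / real m)) * ln (2 * K / c) \<le> real E"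
  shows "expectation (\<lambda>\<omega>. (norm (worker_katyusha m f L \<mu> E (\<lambda>e l. J (t e l) \<omega>) (x \<omega>) (y \<omega>) - opt (x \<omega>)))\<^sup>2)
    \<le> c / 2 * expectation (\<lambda>\<omega>. (norm (y \<omega> - opt (x \<omega>)))\<^sup>2)"
proof -
  define st where "st = (\<lambda>\<omega>. kat_epochs m h (\<psi> (x \<omega>)) L \<mu> (\<lambda>e l. J (t e l) \<omega>) (y \<omega>) E)"
  define A' where "A' = A \<union> case_prod t ` ({..<E} \<times> {..<2 * m})"
  define R where "R = expectation (\<lambda>\<omega>. (norm (fst (st \<omega>) - opt (x \<omega>)))\<^sup>2)"
  define R0 where "R0 = expectation (\<lambda>\<omega>. (norm (y \<omega> - opt (x \<omega>)))\<^sup>2)"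
  note ep = epochs_contraction[OF x y inj A]
  have st: "determined A' st" unfolding st_def A'_def by (rule ep(2))
  have x': "determined A' x" using x by (intro determined_mono[OF x]) (auto simp: A'_def determined_def)
  have int: "integrable M (\<lambda>\<omega>. g (x \<omega>) (st \<omega>))" for g :: "_ \<Rightarrow> _ \<Rightarrow> real"
    by (rule determined_integrable[OF determined_comp2[OF x' st]])
  have int0: "integrable M (\<lambda>\<omega>. g (x \<omega>) (y \<omega>))" for g :: "_ \<Rightarrow> _ \<Rightarrow> real"
    by (rule determined_integrable[OF determined_comp2[OF x y]])
  have \<tau>1: "0 < (1 + \<tau>) ^ E" using \<tau>_bounds by simp
  have R0: "0 \<le> R0" unfolding R0_def by (intro integral_nonneg_AE) auto
  have "S * \<mu> / 4 * R = expectation (\<lambda>\<omega>. S * \<mu> / 4 * (norm (fst (st \<omega>) - opt (x \<omega>)))\<^sup>2)"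
    unfolding R_def by simp
  also have "\<dots> \<le> expectation (\<lambda>\<omega>. \<Phi> (x \<omega>) (st \<omega>))"
    by (rule integral_mono[OF int int \<Phi>_lower])
  finally have "(1 + \<tau>) ^ E * (S * \<mu> / 4 * R) \<le> (1 + \<tau>) ^ E * expectation (\<lambda>\<omega>. \<Phi> (x \<omega>) (st \<omega>))"
    using \<tau>1 by (intro mult_left_mono) auto
  also have "\<dots> \<le> expectation (\<lambda>\<omega>. \<Phi> (x \<omega>) (y \<omega>, (y \<omega>, y \<omega>)))"
    unfolding st_def by (rule ep(1))
  also have "\<dots> \<le> expectation (\<lambda>\<omega>. 9 / 16 * S * L * (norm (y \<omega> - opt (x \<omega>)))\<^sup>2)"
    by (rule integral_mono[OF int0 int0 \<Phi>_start])
  also have "\<dots> = 9 / 16 * S * L * R0" unfolding R0_def by simp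
  finally have "S * ((1 + \<tau>) ^ E * (\<mu> / 4 * R)) \<le> S * (9 / 16 * L * R0)" by (simp add: mult_ac)
  then have "(1 + \<tau>) ^ E * (\<mu> / 4 * R) \<le> 9 / 16 * L * R0" using S_ge_2 by simp
  then have "R \<le> 9 / 4 * \<kappa> / (1 + \<tau>) ^ E * R0" using \<tau>1 \<mu> by (simp add: field_simps)
  also have "\<dots> \<le> c / 2 * R0" by (intro mult_right_mono contraction_factor[OF c K E] R0)
  finally show ?thesis
    unfolding R_def R0_def st_def worker_katyusha_def katyusha_def h_def[abs_def] \<psi>_def[abs_def] .
qed

end

subsection \<open>One inexact accelerated step\<close>

text \<open>Nesterov's estimate with an inexact gradient. Regularity of \<open>G\<close> enters as
  three scalar inequalities, and the error \<open>e\<close> enters through three inner products,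
  with \<open>a\<close>, \<open>b\<close> and \<open>g\<close>, each split by Young's
  inequality.\<close>

lemma accelerated_step:
  fixes \<xi> \<xi>' l l' opt d e :: "'v::real_inner" and G :: "'v \<Rightarrow> real"
  assumes q: "3 \<le> q" and \<eta>: "0 < \<eta>" "\<beta> * \<eta> = 2 / 15" "\<alpha> * \<eta> * q\<^sup>2 = 4 / 3"
    and upper: "G l' \<le> G \<xi> + d \<bullet> (l' - \<xi>) + \<beta> / 2 * (norm (l' - \<xi>))\<^sup>2"
    and lower_opt: "G \<xi> + d \<bullet> (opt - \<xi>) + \<alpha> / 2 * (norm (opt - \<xi>))\<^sup>2 \<le> G opt"
    and lower_l: "G \<xi> + d \<bullet> (l - \<xi>) + \<alpha> / 2 * (norm (l - \<xi>))\<^sup>2 \<le> G l"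
    and l': "l' = \<xi> - \<eta> *\<^sub>R (d + e)" and \<xi>': "\<xi>' = l' + ((q - 1) / (q + 1)) *\<^sub>R (l' - l)"
  shows "2 * \<eta> * q\<^sup>2 * (G l' - G opt) + (norm ((1 + q) *\<^sub>R \<xi>' - q *\<^sub>R l' - opt))\<^sup>2
    \<le> (1 - 1 / q) * (2 * \<eta> * q\<^sup>2 * (G l - G opt) + (norm ((1 + q) *\<^sub>R \<xi> - q *\<^sub>R l - opt))\<^sup>2)
      - q / 5 * (norm (\<xi>' - \<xi>))\<^sup>2 + 6 * q ^ 3 * \<eta>\<^sup>2 * (norm e)\<^sup>2"
proof -
  define a b g where "a = \<xi> - opt" and "b = \<xi> - l" and "g = d + e"
  define \<omega> where "\<omega> = (q - 1) / (q + 1)"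
  have d: "d = g - e" by (simp add: g_def)
  have q0: "q \<noteq> 0" "q + 1 \<noteq> 0" using q by auto
  have \<omega>: "0 \<le> \<omega>" "\<omega> \<le> 1" "q * \<omega> \<le> q - 1" "(1 + q) * \<omega> = q - 1"
    using q by (auto simp: \<omega>_def divide_simps algebra_simps)
  have l'\<xi>: "l' - \<xi> = - (\<eta> *\<^sub>R g)" using l' by (simp add: g_def)
  have l'l: "l' - l = b - \<eta> *\<^sub>R g" using l' by (simp add: g_def b_def)
  have v: "(1 + q) *\<^sub>R \<xi> - q *\<^sub>R l - opt = a + q *\<^sub>R b"
    by (simp add: a_def b_def algebra_simps)
  have v': "(1 + q) *\<^sub>R \<xi>' - q *\<^sub>R l' - opt = a + (q - 1) *\<^sub>R b - (q * \<eta>) *\<^sub>R g"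
  proof -
    have "(1 + q) *\<^sub>R \<xi>' - q *\<^sub>R l' - opt = (l' - \<xi>) + a + ((1 + q) * \<omega>) *\<^sub>R (l' - l)"
      unfolding \<xi>' \<omega>_def[symmetric] by (simp add: a_def algebra_simps)
    then show ?thesis unfolding \<omega> l'\<xi> l'l by (simp add: algebra_simps)
  qed
  have \<xi>diff: "\<xi>' - \<xi> = \<omega> *\<^sub>R b - ((1 + \<omega>) * \<eta>) *\<^sub>R g"
    unfolding \<xi>' \<omega>_def[symmetric] l'l using l'\<xi> by (simp add: algebra_simps)
  define A B C Ee where "A = a \<bullet> a" and "B = b \<bullet> b" and "C = g \<bullet> g" and "Ee = e \<bullet> e"
  have pos: "0 \<le> A" "0 \<le> B" "0 \<le> C" "0 \<le> Ee" by (auto simp: A_def B_def C_def Ee_def)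
  have G1: "G l' - G opt \<le> (G \<xi> - G opt) - \<eta> * (d \<bullet> g) + \<beta> / 2 * \<eta>\<^sup>2 * C"
    using upper unfolding l'\<xi> by (simp add: C_def power_mult_distrib power2_norm_eq_inner)
  have G2: "G \<xi> - G opt \<le> d \<bullet> a - \<alpha> / 2 * A"
  proof -
    have "opt - \<xi> = - a" by (simp add: a_def)
    then show ?thesis using lower_opt by (simp add: A_def power2_norm_eq_inner)
  qed
  have G3: "G \<xi> - G opt \<le> (G l - G opt) + d \<bullet> b - \<alpha> / 2 * B"
  proof -
    have "l - \<xi> = - b" by (simp add: b_def)
    then show ?thesis using lower_l by (simp add: B_def power2_norm_eq_inner)
  qed
  have "2 * \<eta> * q\<^sup>2 * (G l' - G opt)
      \<le> 2 * \<eta> * q\<^sup>2 * ((G \<xi> - G opt) - \<eta> * (d \<bullet> g) + \<beta> / 2 * \<eta>\<^sup>2 * C)"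
    using \<eta> by (intro mult_left_mono G1) auto
  \<comment> \<open>Write \<open>q\<^sup>2\<close> as q + q (q - 1): the share q of the gap at \<xi>
    is compared with the minimizer (\<open>G2\<close>), the share q (q - 1) with the previous point
    (\<open>G3\<close>), which produces the factor 1 - 1/q.\<close>
  also have "\<dots> = 2 * \<eta> * q * (G \<xi> - G opt) + 2 * \<eta> * q * (q - 1) * (G \<xi> - G opt)
      - 2 * \<eta>\<^sup>2 * q\<^sup>2 * (d \<bullet> g) + (\<beta> * \<eta>) * (q\<^sup>2 * \<eta>\<^sup>2 * C)"
    by (simp add: algebra_simps power2_eq_square)
  also have "\<dots> \<le> 2 * \<eta> * q * (d \<bullet> a - \<alpha> / 2 * A) + 2 * \<eta> * q * (q - 1) * ((G l - G opt) + d \<bullet> b - \<alpha> / 2 * B)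
      - 2 * \<eta>\<^sup>2 * q\<^sup>2 * (d \<bullet> g) + 2 / 15 * (q\<^sup>2 * \<eta>\<^sup>2 * C)"
    unfolding \<eta>(2) using q \<eta> by (intro add_mono diff_mono mult_left_mono G2 G3) auto
  also have "\<dots> = (1 - 1 / q) * (2 * \<eta> * q\<^sup>2 * (G l - G opt)) - (\<alpha> * \<eta> * q\<^sup>2) * (A / q) - (\<alpha> * \<eta> * q\<^sup>2) * ((q - 1) / q * B)
      + 2 * \<eta> * q * (d \<bullet> a) + 2 * \<eta> * q * (q - 1) * (d \<bullet> b)
      - 2 * \<eta>\<^sup>2 * q\<^sup>2 * (d \<bullet> g) + 2 / 15 * (q\<^sup>2 * \<eta>\<^sup>2 * C)"
    using q0 by (simp add: field_simps power2_eq_square)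
  finally have GG: "2 * \<eta> * q\<^sup>2 * (G l' - G opt)
      \<le> (1 - 1 / q) * (2 * \<eta> * q\<^sup>2 * (G l - G opt)) - 4 / 3 * (A / q) - 4 / 3 * ((q - 1) / q * B)
      + 2 * \<eta> * q * (d \<bullet> a) + 2 * \<eta> * q * (q - 1) * (d \<bullet> b)
      - 2 * \<eta>\<^sup>2 * q\<^sup>2 * (d \<bullet> g) + 2 / 15 * (q\<^sup>2 * \<eta>\<^sup>2 * C)"
    unfolding \<eta>(3) .
  have V: "(norm (a + (q - 1) *\<^sub>R b - (q * \<eta>) *\<^sub>R g))\<^sup>2
      = (1 - 1 / q) * (norm (a + q *\<^sub>R b))\<^sup>2 + A / q - (q - 1) * B
        - 2 * \<eta> * q * (g \<bullet> a) - 2 * \<eta> * q * (q - 1) * (g \<bullet> b) + q\<^sup>2 * \<eta>\<^sup>2 * C"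
  proof -
    have "(norm (a + (q - 1) *\<^sub>R b - (q * \<eta>) *\<^sub>R g))\<^sup>2
      = A + 2 * (q - 1) * (a \<bullet> b) + (q - 1)\<^sup>2 * B - 2 * \<eta> * q * (g \<bullet> a) - 2 * \<eta> * q * (q - 1) * (g \<bullet> b) + q\<^sup>2 * \<eta>\<^sup>2 * C"
      unfolding power2_norm_eq_inner A_def B_def C_def
      by (simp add: inner_diff inner_add_left inner_add_right inner_commute power2_eq_square algebra_simps)
    moreover have "(norm (a + q *\<^sub>R b))\<^sup>2 = A + 2 * q * (a \<bullet> b) + q\<^sup>2 * B"
      unfolding power2_norm_eq_inner A_def B_def
      by (simp add: inner_add_left inner_add_right inner_commute power2_eq_square algebra_simps)
    moreover have "(1 - 1 / q) * (A + 2 * q * (a \<bullet> b) + q\<^sup>2 * B) + A / q - (q - 1) * B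
        = A + 2 * (q - 1) * (a \<bullet> b) + (q - 1)\<^sup>2 * B"
      using q0 by (simp add: field_simps power2_eq_square)
    ultimately show ?thesis by simp
  qed
  \<comment> \<open>The parameters in \<open>y1\<close>, \<open>y2\<close> and \<open>y3\<close>
    leave 1/3 of A/q, 1/2 of (q - 1) B and 1/3 of the C term; this is what the final balance can
    afford.\<close>
  have y1: "- (2 * \<eta> * q * (e \<bullet> a)) \<le> 1 / 3 * (A / q) + 3 * q ^ 3 * \<eta>\<^sup>2 * Ee"
  proof -
    have "- (e \<bullet> a) \<le> A / (6 * \<eta> * q\<^sup>2) + Ee * (3 * \<eta> * q\<^sup>2) / 2"
      using young_inner[of "1 / (3 * \<eta> * q\<^sup>2)" a "- e"] q \<eta>
      by (simp add: A_def Ee_def power2_norm_eq_inner inner_commute)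
    then have "2 * \<eta> * q * - (e \<bullet> a) \<le> 2 * \<eta> * q * (A / (6 * \<eta> * q\<^sup>2) + Ee * (3 * \<eta> * q\<^sup>2) / 2)"
      using q \<eta> by (intro mult_left_mono) auto
    also have "\<dots> = 1 / 3 * (A / q) + 3 * q ^ 3 * \<eta>\<^sup>2 * Ee"
      using q0 \<eta>(1) by (simp add: field_simps power2_eq_square power3_eq_cube)
    finally show ?thesis by simp
  qed
  have y2: "- (2 * \<eta> * q * (q - 1) * (e \<bullet> b)) \<le> 1 / 2 * ((q - 1) * B) + 2 * (q - 1) * (q\<^sup>2 * \<eta>\<^sup>2 * Ee)"
  proof -
    have "- (e \<bullet> b) \<le> B / (4 * \<eta> * q) + \<eta> * q * Ee"
      using young_inner[of "1 / (2 * \<eta> * q)" b "- e"] q \<eta>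
      by (simp add: B_def Ee_def power2_norm_eq_inner inner_commute mult_ac)
    then have "2 * \<eta> * q * (q - 1) * - (e \<bullet> b) \<le> 2 * \<eta> * q * (q - 1) * (B / (4 * \<eta> * q) + \<eta> * q * Ee)"
      using q \<eta> by (intro mult_left_mono) auto
    also have "\<dots> = 1 / 2 * ((q - 1) * B) + 2 * (q - 1) * (q\<^sup>2 * \<eta>\<^sup>2 * Ee)"
      using q0 \<eta>(1) by (simp add: field_simps power2_eq_square)
    finally show ?thesis by simp
  qed
  have y3: "2 * \<eta>\<^sup>2 * q\<^sup>2 * (e \<bullet> g) \<le> 1 / 3 * (q\<^sup>2 * \<eta>\<^sup>2 * C) + 3 * (q\<^sup>2 * \<eta>\<^sup>2 * Ee)"
  proof -
    have "e \<bullet> g \<le> C / 6 + 3 / 2 * Ee"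
      using young_inner[of 3 e g] by (simp add: C_def Ee_def power2_norm_eq_inner)
    then have "2 * \<eta>\<^sup>2 * q\<^sup>2 * (e \<bullet> g) \<le> 2 * \<eta>\<^sup>2 * q\<^sup>2 * (C / 6 + 3 / 2 * Ee)"
      by (intro mult_left_mono) auto
    then show ?thesis by (simp add: algebra_simps)
  qed
  have err: "3 * q ^ 3 * \<eta>\<^sup>2 * Ee + 2 * (q - 1) * (q\<^sup>2 * \<eta>\<^sup>2 * Ee) + 3 * (q\<^sup>2 * \<eta>\<^sup>2 * Ee) \<le> 6 * q ^ 3 * \<eta>\<^sup>2 * Ee"
  proof -
    have "1 * (q\<^sup>2 * \<eta>\<^sup>2 * Ee) \<le> q * (q\<^sup>2 * \<eta>\<^sup>2 * Ee)" using q pos by (intro mult_right_mono) auto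
    then show ?thesis by (simp add: algebra_simps power2_eq_square power3_eq_cube)
  qed
  have move: "q / 5 * (norm (\<xi>' - \<xi>))\<^sup>2 \<le> 8 / 15 * (q\<^sup>2 * \<eta>\<^sup>2 * C) + 1 / 2 * ((q - 1) * B)"
  proof -
    have "0 \<le> (norm (\<omega> *\<^sub>R b + ((1 + \<omega>) * \<eta>) *\<^sub>R g))\<^sup>2" by simp
    then have "(norm (\<xi>' - \<xi>))\<^sup>2 \<le> 2 * \<omega>\<^sup>2 * B + 2 * (1 + \<omega>)\<^sup>2 * (\<eta>\<^sup>2 * C)"
      unfolding \<xi>diff power2_norm_eq_inner B_def C_def
      by (simp add: inner_diff inner_add_left inner_add_right inner_commute power2_eq_square algebra_simps)
    then have "q / 5 * (norm (\<xi>' - \<xi>))\<^sup>2 \<le> q / 5 * (2 * \<omega>\<^sup>2 * B + 2 * (1 + \<omega>)\<^sup>2 * (\<eta>\<^sup>2 * C))"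
      using q by (intro mult_left_mono) auto
    also have "\<dots> = 2 / 5 * ((q * \<omega> * \<omega>) * B) + 2 / 5 * (q * (1 + \<omega>)\<^sup>2) * (\<eta>\<^sup>2 * C)"
      by (simp add: power2_eq_square algebra_simps)
    also have "\<dots> \<le> 1 / 2 * ((q - 1) * B) + 2 / 5 * (4 / 3 * q\<^sup>2) * (\<eta>\<^sup>2 * C)"
    proof -
      have "q * \<omega> * \<omega> \<le> q - 1"
        using mult_mono[OF \<omega>(3) \<omega>(2)] \<omega> q by simp
      then have "q * \<omega> * \<omega> * B \<le> (q - 1) * B" using pos by (intro mult_right_mono)
      moreover have "0 \<le> (q - 1) * B" using q pos by simp
      moreover have "2 / 5 * (q * (1 + \<omega>)\<^sup>2) * (\<eta>\<^sup>2 * C) \<le> 2 / 5 * (4 / 3 * q\<^sup>2) * (\<eta>\<^sup>2 * C)"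
      proof -
        have "(1 + \<omega>)\<^sup>2 \<le> 2\<^sup>2" using \<omega> by (intro power_mono) auto
        then have "q * (1 + \<omega>)\<^sup>2 \<le> q * 4" using q by (intro mult_left_mono) auto
        also have "\<dots> \<le> 4 / 3 * q\<^sup>2" using q by (simp add: power2_eq_square)
        finally show ?thesis using pos by (intro mult_right_mono) auto
      qed
      ultimately show ?thesis by linarith
    qed
    finally show ?thesis by (simp add: mult_ac)
  qed
  have Bpos: "0 \<le> (q - 1) / q * B" using q pos by simp
  have dist: "d \<bullet> a = g \<bullet> a - e \<bullet> a" "d \<bullet> b = g \<bullet> b - e \<bullet> b" "d \<bullet> g = C - e \<bullet> g"
    unfolding d C_def by (simp_all add: inner_diff_left)
  have e2: "(norm e)\<^sup>2 = Ee" by (simp add: Ee_def power2_norm_eq_inner)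
  have lin: "2 * \<eta> * q * (d \<bullet> a) = 2 * \<eta> * q * (g \<bullet> a) - 2 * \<eta> * q * (e \<bullet> a)"
    "2 * \<eta> * q * (q - 1) * (d \<bullet> b) = 2 * \<eta> * q * (q - 1) * (g \<bullet> b) - 2 * \<eta> * q * (q - 1) * (e \<bullet> b)"
    "2 * \<eta>\<^sup>2 * q\<^sup>2 * (d \<bullet> g) = 2 * (q\<^sup>2 * \<eta>\<^sup>2 * C) - 2 * \<eta>\<^sup>2 * q\<^sup>2 * (e \<bullet> g)"
    unfolding dist by (simp_all add: algebra_simps)
  \<comment> \<open>The balance: A/q has -4/3 + 1 + 1/3 = 0, (q - 1) B has -1 + 1/2 + 1/2 = 0 and
    the C term has 2/15 - 2 + 1 + 1/3 + 8/15 = 0, where the last 1/2 and 8/15 pay for the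
    displacement. The B term left over from strong convexity is dropped.\<close>
  show ?thesis
    using GG V y1 y2 y3 err move Bpos unfolding v v' lin e2 distrib_left by linarith
qed

subsection \<open>Weights of the Lyapunov function\<close>

text \<open>The coefficient, up to the factor \<open>1 / \<mu>min\<^sup>2\<close>, with which the displacement \<open>d\<close> iterations ago enters
  the error of the stale gradients: twice the lazy threshold (\<open>6\<close> for each of its sums) plus twice the
  accumulated Katyusha error \<open>c ^ d\<close>.\<close>

definition lag_error :: "nat \<Rightarrow> real \<Rightarrow> real \<Rightarrow> nat \<Rightarrow> real" where
  "lag_error D c \<gamma> d = 8 * c ^ d + 6 * (if d \<le> D then c + \<gamma> else c ^ (d - D))"

text \<open>Besides the decay by t per lag, the bracket drops by 1/D at each lag up to D, from 2 at
  lag 1 to 1 at lag D + 1, and halves afterwards. The linear drop pays for the errors of size c +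
  \<gamma>, the halving for those of size c to the power d - D. The factor 1/20 gives lag 1 the
  weight 1/10, half of the gain 1/5.\<close>

definition lag_weight :: "nat \<Rightarrow> real \<Rightarrow> nat \<Rightarrow> real" where
  "lag_weight D t d = (if d \<le> D then (real (D - d) + 1) / real D + 1 else 1 / 2 ^ (d - D - 1)) * t ^ (d - 1) / 20"

lemma lag_weight_pos: "1 \<le> D \<Longrightarrow> 0 < t \<Longrightarrow> 0 < lag_weight D t d"
  by (auto simp: lag_weight_def intro!: mult_pos_pos divide_pos_pos add_pos_pos add_nonneg_pos)

lemma lag_weight_1: "1 \<le> D \<Longrightarrow> lag_weight D t 1 = 1 / 10"
  by (simp add: lag_weight_def of_nat_diff field_simps)

text \<open>The drop of the bracket must exceed the error of the lag. Up to D the drop is worth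
  \<open>t ^ d / (20 * D)\<close> and the error costs 16/15 (14/1200 + 6/288) = 26/750 in the same
  units; beyond D it is 1/40 against 16/15 times 14/1200.\<close>

lemma lag_weight_step:
  assumes D: "1 \<le> D" and d: "1 \<le> d" and t: "0 < t" "t \<le> 1" and \<kappa>: "1 \<le> \<kappa>" and c: "0 < c"
    and c\<kappa>: "\<kappa> * c \<le> t ^ (D + 1) / (1200 * real D)" and \<gamma>\<kappa>: "\<kappa> * \<gamma> \<le> t ^ D / (288 * real D)"
  shows "16 / 15 * \<kappa> * lag_error D c \<gamma> d + lag_weight D t (Suc d) \<le> t * lag_weight D t d"
proof -
  \<comment> \<open>Beyond lag D the errors decay like powers of c, which must beat both t and the
    halving.\<close>
  have c_le: "c \<le> t / 2"
  proof -
    have "t ^ (D + 1) \<le> t ^ 1" using D t by (intro power_decreasing) auto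
    then have "t ^ (D + 1) / (1200 * real D) \<le> t / (1200 * 1)" using D t by (intro frac_le) auto
    moreover have "1 * c \<le> \<kappa> * c" using \<kappa> c by (intro mult_right_mono) auto
    ultimately show ?thesis using c\<kappa> t by linarith
  qed
  then have c1: "c \<le> 1" using t by simp
  have td: "t * t ^ (d - 1) = t ^ d" using d by (cases d) auto
  show ?thesis
  proof (cases "d \<le> D")
    case True
    have "c ^ d \<le> c ^ 1" using d c c1 by (intro power_decreasing) auto
    then have "lag_error D c \<gamma> d \<le> 14 * c + 6 * \<gamma>" using True by (simp add: lag_error_def)
    then have "16 / 15 * \<kappa> * lag_error D c \<gamma> d \<le> 16 / 15 * \<kappa> * (14 * c + 6 * \<gamma>)"
      using \<kappa> by (intro mult_left_mono) auto
    also have "\<dots> = 16 / 15 * (14 * (\<kappa> * c) + 6 * (\<kappa> * \<gamma>))" by (simp add: algebra_simps)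
    also have "\<dots> \<le> 16 / 15 * (14 * (t ^ D / (1200 * real D)) + 6 * (t ^ D / (288 * real D)))"
    proof -
      have "t ^ (D + 1) \<le> t ^ D" using t by (intro power_decreasing) auto
      then have "t ^ (D + 1) / (1200 * real D) \<le> t ^ D / (1200 * real D)" by (intro divide_right_mono) auto
      then show ?thesis using c\<kappa> \<gamma>\<kappa> by simp
    qed
    also have "\<dots> = 26 / 750 * (t ^ D / real D)" by simp
    also have "\<dots> \<le> 1 / 20 * (t ^ d / real D)"
    proof -
      have "t ^ D \<le> t ^ d" using t True by (intro power_decreasing) auto
      then show ?thesis using t by (intro mult_mono divide_right_mono) auto
    qed
    also have "\<dots> + lag_weight D t (Suc d) = t * lag_weight D t d"
    proof (cases "d = D")
      case True
      then show ?thesis using D td by (simp add: lag_weight_def field_simps)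
    next
      case False
      then have "d < D" using True by simp
      then have "real (D - d) = real (D - Suc d) + 1" by (simp add: of_nat_diff)
      moreover obtain j where "d = Suc j" using d by (cases d) auto
      ultimately show ?thesis using \<open>d < D\<close> D by (simp add: lag_weight_def field_simps)
    qed
    finally show ?thesis by simp
  next
    case False
    define n where "n = d - D - 1"
    have dn: "d = D + 1 + n" using False by (simp add: n_def)
    \<comment> \<open>The exponent n + 1 is d - D: one factor c is paired with \<kappa>, the other n
      are compared with t/2.\<close>
    have "c ^ d \<le> c ^ (n + 1)" using dn c c1 by (intro power_decreasing) auto
    then have "lag_error D c \<gamma> d \<le> 14 * c ^ (n + 1)" using dn by (simp add: lag_error_def)
    then have "16 / 15 * \<kappa> * lag_error D c \<gamma> d \<le> 16 / 15 * \<kappa> * (14 * c ^ (n + 1))"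
      using \<kappa> by (intro mult_left_mono) auto
    also have "\<dots> = 16 / 15 * 14 * ((\<kappa> * c) * c ^ n)" by simp
    also have "\<dots> \<le> 16 / 15 * 14 * (t ^ (D + 1) / 1200 * (t / 2) ^ n)"
    proof -
      have "t ^ (D + 1) / (1200 * real D) \<le> t ^ (D + 1) / 1200" using D t by (intro divide_left_mono) auto
      then have "\<kappa> * c \<le> t ^ (D + 1) / 1200" using c\<kappa> by linarith
      then show ?thesis using c c_le \<kappa> t by (intro mult_left_mono mult_mono power_mono) auto
    qed
    also have "\<dots> = 16 / 15 * 14 / 1200 * (t ^ d / 2 ^ n)"
      unfolding dn by (simp add: power_divide power_add)
    also have "\<dots> \<le> 1 / 40 * (t ^ d / 2 ^ n)" using t by (intro mult_right_mono) auto
    also have "\<dots> + lag_weight D t (Suc d) = t * lag_weight D t d"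
      using td dn by (simp add: lag_weight_def field_simps)
    finally show ?thesis by simp
  qed
qed

subsection \<open>Lazy aggregation\<close>

lemma lazy_threshold_cong:
  assumes "\<And>j. j \<le> k \<Longrightarrow> x j = x' j"
  shows "lazy_threshold D c \<gamma> \<mu>min x k i = lazy_threshold D c \<gamma> \<mu>min x' k i"
  unfolding lazy_threshold_def Let_def using assms
  by (intro arg_cong2[where f=times] arg_cong2[where f=plus] sum.cong) auto

text \<open>Collects the sums by the lag k - j: the first covers lags beyond D, the second all lags,
  the last two lags up to D. Twice the prefactor 3 gives 6 for each sum, and the Katyusha term
  raises the coefficient of \<open>c ^ d\<close> to 8.\<close>

lemma lazy_threshold_eq:
  "2 * lazy_threshold D c \<gamma> \<mu>min x k i + 2 / \<mu>min\<^sup>2 * (\<Sum>j<k. c ^ (k - j) * (norm (x j $ i - x (Suc j) $ i))\<^sup>2)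
    = 1 / \<mu>min\<^sup>2 * (\<Sum>j<k. lag_error D c \<gamma> (k - j) * (norm (x j $ i - x (Suc j) $ i))\<^sup>2)"
proof -
  define \<delta> where "\<delta> = (\<lambda>j. (norm (x j $ i - x (Suc j) $ i))\<^sup>2)"
  have split: "(\<Sum>j<k. g j) = (\<Sum>j<k - D. g j) + (\<Sum>j\<in>{k - D..<k}. g j)" for g :: "nat \<Rightarrow> real"
    by (metis sum.atLeastLessThan_concat atLeast0LessThan diff_le_self le0)
  have "(\<Sum>j<k. lag_error D c \<gamma> (k - j) * \<delta> j)
      = 8 * (\<Sum>j<k. c ^ (k - j) * \<delta> j) + 6 * (\<Sum>j<k. (if k - j \<le> D then c + \<gamma> else c ^ (k - j - D)) * \<delta> j)"
    by (simp add: lag_error_def sum_distrib_left sum.distrib[symmetric] algebra_simps)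
  also have "(\<Sum>j<k. (if k - j \<le> D then c + \<gamma> else c ^ (k - j - D)) * \<delta> j)
      = (\<Sum>j<k - D. c ^ (k - D - j) * \<delta> j) + (\<Sum>j\<in>{k - D..<k}. (c + \<gamma>) * \<delta> j)"
    unfolding split by (intro arg_cong2[where f="(+)"] sum.cong) (auto simp: ac_simps)
  also have "(\<Sum>j\<in>{k - D..<k}. (c + \<gamma>) * \<delta> j) = (\<Sum>j\<in>{k - D..<k}. c * \<delta> j) + (\<Sum>j\<in>{k - D..<k}. \<gamma> * \<delta> j)"
    by (simp add: distrib_right sum.distrib)
  finally have lag: "(\<Sum>j<k. lag_error D c \<gamma> (k - j) * \<delta> j) = 8 * (\<Sum>j<k. c ^ (k - j) * \<delta> j)
      + 6 * ((\<Sum>j<k - D. c ^ (k - D - j) * \<delta> j)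
        + ((\<Sum>j\<in>{k - D..<k}. c * \<delta> j) + (\<Sum>j\<in>{k - D..<k}. \<gamma> * \<delta> j)))" .
  have "2 * (3 / M * (a + b + u + v)) + 2 / M * b = 1 / M * (8 * b + 6 * (a + (u + v)))" for M a b u v :: real
    by (simp add: algebra_simps add_divide_distrib)
  then have "2 * lazy_threshold D c \<gamma> \<mu>min x k i + 2 / \<mu>min\<^sup>2 * (\<Sum>j<k. c ^ (k - j) * \<delta> j)
      = 1 / \<mu>min\<^sup>2 * (\<Sum>j<k. lag_error D c \<gamma> (k - j) * \<delta> j)"
    unfolding lazy_threshold_def Let_def \<delta>_def lag[unfolded \<delta>_def] by blast
  then show ?thesis unfolding \<delta>_def .
qed

lemma norm_diff_sq_le:
  fixes a b c :: "'v::real_inner"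
  shows "(norm (a - c))\<^sup>2 \<le> 2 * (norm (a - b))\<^sup>2 + 2 * (norm (b - c))\<^sup>2"
proof -
  have "(norm (u + v))\<^sup>2 \<le> 2 * (norm u)\<^sup>2 + 2 * (norm v)\<^sup>2" for u v :: 'v
  proof -
    have "0 \<le> (u - v) \<bullet> (u - v)" by simp
    then show ?thesis
      unfolding power2_norm_eq_inner by (simp add: inner_diff inner_add_left inner_add_right inner_commute)
  qed
  from this[of "a - b" "b - c"] show ?thesis by simp
qed

lemma norm_vec_sq: "(norm (X :: 'a::real_inner^'n))\<^sup>2 = (\<Sum>i\<in>UNIV. (norm (X $ i))\<^sup>2)"
  unfolding power2_norm_eq_inner inner_vec_def ..

section \<open>A run of DLAG and its dual objective\<close>

locale dlag = network U sqrtU \<sigma> + sampling M m "\<lambda>(k, i, e, l). J k i e l"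
  for U sqrtU :: "real^'n^'n" and \<sigma> and M :: "'w measure" and m and J :: "nat \<Rightarrow> 'n \<Rightarrow> nat \<Rightarrow> nat \<Rightarrow> 'w \<Rightarrow> nat" +
  fixes f :: "'n \<Rightarrow> nat \<Rightarrow> 'a::euclidean_space \<Rightarrow> real" and L \<mu> :: "'n \<Rightarrow> real"
    and D E :: nat and \<kappa>max \<beta> \<alpha> \<kappa> c \<gamma> \<eta> q t :: real
    and x y \<theta> \<theta>hat \<xi> lam :: "nat \<Rightarrow> 'w \<Rightarrow> 'a^'n" and delay :: "nat \<Rightarrow> 'n \<Rightarrow> 'w \<Rightarrow> nat"
    and \<xi>opt :: "'a^'n"
  assumes f: "\<And>i. worker m (f i) (L i) (\<mu> i)"
    and \<beta>: "\<beta> = \<sigma> 1 / Min (range \<mu>)" and \<alpha>: "\<alpha> = \<sigma> (CARD('n) - 1) / Max (range L)"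
    and \<kappa>: "\<kappa> = \<beta> / \<alpha>" and \<eta>: "\<eta> = 2 / 15 * (1 / \<beta>)" and q: "q = sqrt (10 * \<kappa>)"
    and t: "0 < t" "t \<le> 1 - 1 / q" and D: "1 \<le> D"
    and c: "0 < c" "\<kappa> * c \<le> t ^ (D + 1) / (1200 * real D)"
    and \<gamma>: "0 < \<gamma>" "\<kappa> * \<gamma> \<le> t ^ D / (288 * real D)"
    and \<kappa>max: "\<And>i. L i / \<mu> i \<le> \<kappa>max"
    and E: "100 * (1 + sqrt (\<kappa>max / real m)) * ln (2 * \<kappa>max / c) \<le> real E"
    and run: "\<And>\<omega>. \<omega> \<in> space M \<Longrightarrow>
      dlag_run m f L \<mu> U \<eta> 10 \<kappa> c \<gamma> D E (\<lambda>k i e l. J k i e l \<omega>)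
        (\<lambda>k. x k \<omega>) (\<lambda>k. y k \<omega>) (\<lambda>k. \<theta> k \<omega>) (\<lambda>k. \<theta>hat k \<omega>) (\<lambda>k i. delay k i \<omega>)"
    and aux: "\<And>\<omega>. \<omega> \<in> space M \<Longrightarrow>
      dlag_aux sqrtU \<eta> 10 \<kappa> (\<lambda>k. \<theta>hat k \<omega>) (\<lambda>k. \<xi> k \<omega>) (\<lambda>k. lam k \<omega>)"
    and \<xi>opt: "is_arg_min (dual m f sqrtU) (\<lambda>\<xi>. (\<Sum>i\<in>UNIV. \<xi> $ i) = 0) \<xi>opt"
begin

sublocale W: sampled_worker m "f i" "L i" "\<mu> i" M "\<lambda>(k, i, e, l). J k i e l" for i
  by (intro sampled_worker.intro f sampling_axioms)

abbreviation \<mu>min :: real where "\<mu>min \<equiv> Min (range \<mu>)"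
abbreviation Lmax :: real where "Lmax \<equiv> Max (range L)"
abbreviation G :: "'a^'n \<Rightarrow> real" where "G \<equiv> dual m f sqrtU"

lemma \<mu>min: "0 < \<mu>min" "\<mu>min \<le> \<mu> i"
  using Min_in[of "range \<mu>"] W.\<mu> by auto

lemma Lmax: "L i \<le> Lmax" "0 < Lmax" "\<mu>min \<le> Lmax"
proof -
  show le: "L i \<le> Lmax" for i by simp
  then show "0 < Lmax" "\<mu>min \<le> Lmax"
    using \<mu>min W.L_pos W.\<mu>_le_L by (meson less_le_trans order_trans)+
qed

lemma \<alpha>\<beta>: "0 < \<alpha>" "\<alpha> \<le> \<beta>" "0 < \<beta>"
proof -
  show "0 < \<alpha>" unfolding \<alpha> using U_eig(2) Lmax(2) by simp
  show "\<alpha> \<le> \<beta>" unfolding \<alpha> \<beta> using \<sigma>1 U_eig(2) \<mu>min(1) Lmax(3) by (intro frac_le) auto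
  then show "0 < \<beta>" using \<open>0 < \<alpha>\<close> by simp
qed

lemma \<kappa>_ge_1: "1 \<le> \<kappa>"
  unfolding \<kappa> using \<alpha>\<beta> by simp

lemma \<eta>_pos: "0 < \<eta>"
  unfolding \<eta> using \<alpha>\<beta> by simp

lemma q3: "3 \<le> q" and q_sq: "q\<^sup>2 = 10 * \<kappa>"
  unfolding q using \<kappa>_ge_1 by (auto intro!: real_le_rsqrt)

lemma t_le_1: "t \<le> 1"
proof -
  have "0 \<le> 1 / q" using q3 by simp
  then show ?thesis using t(2) by linarith
qed

lemma c_le: "c \<le> 1 / 1200"
proof -
  have "1 * c \<le> \<kappa> * c" using \<kappa>_ge_1 c by (intro mult_right_mono) auto
  also have "\<dots> \<le> 1 / (1200 * 1)"
    using D t t_le_1 by (intro order_trans[OF c(2)] frac_le power_le_one) auto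
  finally show ?thesis by simp
qed

definition Opt :: "'a^'n \<Rightarrow> 'a^'n" where
  "Opt Y = (\<chi> i. W.opt i (Y $ i))"

lemma conjugate_primal:
  "conjugate (primal m f) Y = (\<Sum>i\<in>UNIV. conjugate (average m (f i)) (Y $ i))"
proof -
  have "Y \<bullet> X - primal m f X \<le> Y \<bullet> Opt Y - primal m f (Opt Y)" for X
    unfolding inner_vec_def primal_def sum_subtractf[symmetric] Opt_def vec_lambda_beta
    by (intro sum_mono conjugate_qbounds_aux[OF W.qbounds_f W.\<mu> W.gf_opt])
  then have "conjugate (primal m f) Y = Y \<bullet> Opt Y - primal m f (Opt Y)"
    by (rule conjugate_eqI)
  also have "\<dots> = (\<Sum>i\<in>UNIV. conjugate (average m (f i)) (Y $ i))"
    unfolding inner_vec_def primal_def sum_subtractf[symmetric] Opt_def vec_lambda_beta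
    by (intro sum.cong refl) (simp add: conjugate_qbounds_eq[OF W.qbounds_f W.\<mu>] W.opt_def)
  finally show ?thesis .
qed

lemma qbounds_conjugate_primal: "qbounds (1 / Lmax) (1 / \<mu>min) (conjugate (primal m f)) Opt"
proof -
  have q: "qbounds (1 / Lmax) (1 / \<mu>min) (conjugate (average m (f i))) (W.opt i)" for i
    unfolding W.opt_def
    by (rule qbounds_mono[OF qbounds_conjugate[OF W.qbounds_f W.\<mu>]])
       (use \<mu>min Lmax W.L_pos W.\<mu> in \<open>auto intro!: divide_left_mono\<close>)
  have eq: "conjugate (primal m f) X + Opt X \<bullet> (Y - X) + b / 2 * (norm (Y - X))\<^sup>2
      = (\<Sum>i\<in>UNIV. conjugate (average m (f i)) (X $ i) + W.opt i (X $ i) \<bullet> (Y $ i - X $ i)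
          + b / 2 * (norm (Y $ i - X $ i))\<^sup>2)" for X Y b
    unfolding conjugate_primal norm_vec_sq inner_vec_def by (simp add: Opt_def sum.distrib sum_distrib_left)
  show ?thesis
    unfolding qbounds_def
  proof (intro allI conjI)
    fix X Y
    show "conjugate (primal m f) X + Opt X \<bullet> (Y - X) + 1 / Lmax / 2 * (norm (Y - X))\<^sup>2 \<le> conjugate (primal m f) Y"
      unfolding eq unfolding conjugate_primal by (intro sum_mono qbounds_lower[OF q])
    show "conjugate (primal m f) Y \<le> conjugate (primal m f) X + Opt X \<bullet> (Y - X) + 1 / \<mu>min / 2 * (norm (Y - X))\<^sup>2"
      unfolding eq unfolding conjugate_primal by (intro sum_mono qbounds_upper[OF q])
  qed
qed

lemma G_upper:
  "G X \<le> G Y + rmult (Opt (rmult Y sqrtU)) sqrtU \<bullet> (X - Y) + \<beta> / 2 * (norm (X - Y))\<^sup>2"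
proof -
  have "G X \<le> G Y + Opt (rmult Y sqrtU) \<bullet> rmult (X - Y) sqrtU + 1 / \<mu>min / 2 * (norm (rmult (X - Y) sqrtU))\<^sup>2"
    using qbounds_upper[OF qbounds_conjugate_primal, of "rmult X sqrtU" "rmult Y sqrtU"]
    by (simp only: dual_def rmult_diff)
  also have "1 / \<mu>min / 2 * (norm (rmult (X - Y) sqrtU))\<^sup>2 \<le> 1 / \<mu>min / 2 * (\<sigma> 1 * (norm (X - Y))\<^sup>2)"
    using \<mu>min by (intro mult_left_mono norm_rmult_sqrtU_upper) (auto simp: less_imp_le)
  finally show ?thesis unfolding inner_rmult[OF sqrtU_sym] \<beta> by simp
qed

text \<open>The zero column sum of the difference excludes the kernel of \<open>sqrtU\<close>;
  without it \<alpha> would be 0.\<close>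

lemma G_lower:
  assumes "(\<Sum>i\<in>UNIV. (X - Y) $ i) = 0"
  shows "G Y + rmult (Opt (rmult Y sqrtU)) sqrtU \<bullet> (X - Y) + \<alpha> / 2 * (norm (X - Y))\<^sup>2 \<le> G X"
proof -
  have "1 / Lmax / 2 * (\<sigma> (CARD('n) - 1) * (norm (X - Y))\<^sup>2) \<le> 1 / Lmax / 2 * (norm (rmult (X - Y) sqrtU))\<^sup>2"
    using Lmax by (intro mult_left_mono norm_rmult_sqrtU_lower assms) (auto simp: less_imp_le)
  moreover have "G Y + Opt (rmult Y sqrtU) \<bullet> rmult (X - Y) sqrtU + 1 / Lmax / 2 * (norm (rmult (X - Y) sqrtU))\<^sup>2 \<le> G X"
    using qbounds_lower[OF qbounds_conjugate_primal, of "rmult Y sqrtU" "rmult X sqrtU"]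
    by (simp only: dual_def rmult_diff)
  moreover have "1 / Lmax / 2 * (\<sigma> (CARD('n) - 1) * (norm (X - Y))\<^sup>2) = \<alpha> / 2 * (norm (X - Y))\<^sup>2"
    by (simp add: \<alpha>)
  ultimately show ?thesis unfolding inner_rmult[OF sqrtU_sym] by linarith
qed

lemma \<xi>opt_sum: "(\<Sum>i\<in>UNIV. \<xi>opt $ i) = 0"
  using \<xi>opt by (simp add: is_arg_min_def)

text \<open>Subtracting the mean column from \<open>X\<close> makes it feasible and does not change
  \<open>G\<close>.\<close>

lemma G_\<xi>opt_le: "G \<xi>opt \<le> G X"
proof -
  define a where "a = (1 / real CARD('n)) *\<^sub>R (\<Sum>i\<in>UNIV. X $ i)"
  have "(\<Sum>i\<in>UNIV. (X - (\<chi> i. a)) $ i) = 0"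
    by (simp add: sum_subtractf a_def sum_constant_scaleR)
  then have "G \<xi>opt \<le> G (X - (\<chi> i. a))"
    using \<xi>opt unfolding is_arg_min_def by (meson not_less)
  also have "\<dots> = G X" unfolding dual_def rmult_diff rmult_const_sqrtU by simp
  finally show ?thesis .
qed

lemma Inf_G: "(INF X. G X) = G \<xi>opt"
  by (rule cInf_eq_minimum) (auto intro: G_\<xi>opt_le)

definition err :: "nat \<Rightarrow> 'w \<Rightarrow> 'n \<Rightarrow> real" where
  "err k \<omega> i = (norm (\<theta> k \<omega> $ i - W.opt i (x k \<omega> $ i)))\<^sup>2"

section \<open>Invariants and gradient errors on a fixed sample path\<close>

context
  fixes \<omega> assumes \<omega>: "\<omega> \<in> space M"
begin

lemma \<xi>_0: "\<xi> 0 \<omega> = 0" and lam_0: "lam 0 \<omega> = 0"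
  and lam_Suc: "lam (Suc k) \<omega> = \<xi> k \<omega> - \<eta> *\<^sub>R rmult (\<theta>hat k \<omega>) sqrtU"
  and \<xi>_Suc: "\<xi> (Suc k) \<omega> = lam (Suc k) \<omega> + ((q - 1) / (q + 1)) *\<^sub>R (lam (Suc k) \<omega> - lam k \<omega>)"
  using aux[OF \<omega>] unfolding dlag_aux_def q by auto

lemma x_0: "x 0 \<omega> = 0" and y_0: "y 0 \<omega> = 0"
  and \<theta>_0: "\<theta> 0 \<omega> $ i = grad (conjugate (average m (f i))) 0"
  and \<theta>hat_0: "\<theta>hat 0 \<omega> $ i = \<theta> 0 \<omega> $ i" and delay_0: "delay 0 i \<omega> = 0"
  and \<theta>_Suc: "\<theta> (Suc k) \<omega> $ i
    = worker_katyusha m (f i) (L i) (\<mu> i) E (\<lambda>e l. J (Suc k) i e l \<omega>) (x (Suc k) \<omega> $ i) (\<theta> k \<omega> $ i)"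
  and lazy: "if \<not> (norm (\<theta>hat k \<omega> $ i - \<theta> (Suc k) \<omega> $ i))\<^sup>2 \<le> lazy_threshold D c \<gamma> \<mu>min (\<lambda>k. x k \<omega>) (Suc k) i
      \<or> delay k i \<omega> = D
    then \<theta>hat (Suc k) \<omega> $ i = \<theta> (Suc k) \<omega> $ i \<and> delay (Suc k) i \<omega> = 0
    else \<theta>hat (Suc k) \<omega> $ i = \<theta>hat k \<omega> $ i \<and> delay (Suc k) i \<omega> = delay k i \<omega> + 1"
  and y_Suc: "y (Suc k) \<omega> = x k \<omega> - \<eta> *\<^sub>R rmult (\<theta>hat k \<omega>) U"
  and x_Suc: "x (Suc k) \<omega> = y (Suc k) \<omega> + ((q - 1) / (q + 1)) *\<^sub>R (y (Suc k) \<omega> - y k \<omega>)"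
proof -
  note r = run[OF \<omega>, unfolded dlag_run_def]
  show "x 0 \<omega> = 0" "y 0 \<omega> = 0" "\<theta> 0 \<omega> $ i = grad (conjugate (average m (f i))) 0"
    "\<theta>hat 0 \<omega> $ i = \<theta> 0 \<omega> $ i" "delay 0 i \<omega> = 0"
    using r by auto
  have k: "1 \<le> Suc k" "Suc k - 1 = k" by auto
  have "\<forall>k\<ge>1. \<forall>i. \<theta> k \<omega> $ i = worker_katyusha m (f i) (L i) (\<mu> i) E ((\<lambda>k i e l. J k i e l \<omega>) k i) (x k \<omega> $ i) (\<theta> (k - 1) \<omega> $ i) \<and>
        (if \<not> (norm (\<theta>hat (k - 1) \<omega> $ i - \<theta> k \<omega> $ i))\<^sup>2 \<le> lazy_threshold D c \<gamma> (Min (range \<mu>)) (\<lambda>k. x k \<omega>) k i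
            \<or> delay (k - 1) i \<omega> = D
         then \<theta>hat k \<omega> $ i = \<theta> k \<omega> $ i \<and> delay k i \<omega> = 0
         else \<theta>hat k \<omega> $ i = \<theta>hat (k - 1) \<omega> $ i \<and> delay k i \<omega> = delay (k - 1) i \<omega> + 1)"
    using r by blast
  from this[rule_format, OF k(1), of i, unfolded k(2)]
  show "\<theta> (Suc k) \<omega> $ i
    = worker_katyusha m (f i) (L i) (\<mu> i) E (\<lambda>e l. J (Suc k) i e l \<omega>) (x (Suc k) \<omega> $ i) (\<theta> k \<omega> $ i)"
    and "if \<not> (norm (\<theta>hat k \<omega> $ i - \<theta> (Suc k) \<omega> $ i))\<^sup>2 \<le> lazy_threshold D c \<gamma> \<mu>min (\<lambda>k. x k \<omega>) (Suc k) i
      \<or> delay k i \<omega> = D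
    then \<theta>hat (Suc k) \<omega> $ i = \<theta> (Suc k) \<omega> $ i \<and> delay (Suc k) i \<omega> = 0
    else \<theta>hat (Suc k) \<omega> $ i = \<theta>hat k \<omega> $ i \<and> delay (Suc k) i \<omega> = delay k i \<omega> + 1"
    by blast+
  show "y (Suc k) \<omega> = x k \<omega> - \<eta> *\<^sub>R rmult (\<theta>hat k \<omega>) U"
    "x (Suc k) \<omega> = y (Suc k) \<omega> + ((q - 1) / (q + 1)) *\<^sub>R (y (Suc k) \<omega> - y k \<omega>)"
    using r unfolding q by blast+
qed

lemma xy_eq: "x k \<omega> = rmult (\<xi> k \<omega>) sqrtU \<and> y k \<omega> = rmult (lam k \<omega>) sqrtU"
proof (induction k)
  case 0
  show ?case by (simp add: x_0 y_0 \<xi>_0 lam_0 rmult_0)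
next
  case (Suc k)
  have "y (Suc k) \<omega> = rmult (lam (Suc k) \<omega>) sqrtU"
    unfolding y_Suc lam_Suc rmult_diff rmult_scaleR rmult_rmult sqrtU(2) using Suc by simp
  moreover from this have "x (Suc k) \<omega> = rmult (\<xi> (Suc k) \<omega>) sqrtU"
    unfolding x_Suc \<xi>_Suc rmult_diff rmult_add rmult_scaleR using Suc by simp
  ultimately show ?case by simp
qed

lemma \<xi>lam_sum: "(\<Sum>i\<in>UNIV. \<xi> k \<omega> $ i) = 0 \<and> (\<Sum>i\<in>UNIV. lam k \<omega> $ i) = 0"
proof (induction k)
  case 0
  show ?case by (simp add: \<xi>_0 lam_0)
next
  case (Suc k)
  have "(\<Sum>i\<in>UNIV. lam (Suc k) \<omega> $ i) = 0"
    unfolding lam_Suc using Suc sum_rmult_sqrtU[of "\<theta>hat k \<omega>"]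
    by (simp add: sum_subtractf flip: scaleR_sum_right)
  moreover from this have "(\<Sum>i\<in>UNIV. \<xi> (Suc k) \<omega> $ i) = 0"
    unfolding \<xi>_Suc using Suc by (simp add: sum.distrib sum_subtractf flip: scaleR_sum_right)
  ultimately show ?case by simp
qed

text \<open>The run starts at the exact dual gradient, so the Katyusha error starts at 0.\<close>

lemma \<theta>_0_opt: "\<theta> 0 \<omega> $ i = W.opt i (x 0 \<omega> $ i)"
  unfolding \<theta>_0 x_0 W.opt_def
  using qbounds_grad[OF qbounds_conjugate[OF W.qbounds_f W.\<mu>]] by simp

lemma lazy_threshold_nonneg: "0 \<le> lazy_threshold D c \<gamma> \<mu>min (\<lambda>k. x k \<omega>) k i"
  unfolding lazy_threshold_def Let_def using c \<gamma>
  by (intro mult_nonneg_nonneg add_nonneg_nonneg sum_nonneg) auto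

text \<open>Either the worker has just sent and its stale gradient is current, or it was silent, and
  then the lazy condition held and bounds the distance to the current one.\<close>

lemma \<theta>hat_error:
  "(norm (\<theta>hat k \<omega> $ i - W.opt i (x k \<omega> $ i)))\<^sup>2
    \<le> 2 * lazy_threshold D c \<gamma> \<mu>min (\<lambda>k. x k \<omega>) k i + 2 * err k \<omega> i"
proof (cases k)
  case 0
  then show ?thesis
    using lazy_threshold_nonneg[of k i] by (simp add: \<theta>hat_0 \<theta>_0_opt err_def)
next
  case (Suc j)
  show ?thesis
  proof (cases "\<theta>hat k \<omega> $ i = \<theta> k \<omega> $ i")
    case True
    then show ?thesis using lazy_threshold_nonneg[of k i] by (simp add: err_def)
  next
    case False
    then have "(norm (\<theta>hat k \<omega> $ i - \<theta> k \<omega> $ i))\<^sup>2 \<le> lazy_threshold D c \<gamma> \<mu>min (\<lambda>k. x k \<omega>) k i"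
      using lazy[of j i] unfolding Suc by (auto split: if_splits)
    then show ?thesis
      using norm_diff_sq_le[of "\<theta>hat k \<omega> $ i" "W.opt i (x k \<omega> $ i)" "\<theta> k \<omega> $ i"] by (simp add: err_def)
  qed
qed

text \<open>A warm start inherits the previous error plus the drift of the exact dual
  gradient.\<close>

lemma start_error:
  "(norm (\<theta> k \<omega> $ i - W.opt i (x (Suc k) \<omega> $ i)))\<^sup>2
    \<le> 2 * err k \<omega> i + 2 / \<mu>min\<^sup>2 * (norm (x k \<omega> $ i - x (Suc k) \<omega> $ i))\<^sup>2"
proof -
  have "norm (W.opt i (x k \<omega> $ i) - W.opt i (x (Suc k) \<omega> $ i)) \<le> norm (x k \<omega> $ i - x (Suc k) \<omega> $ i) / \<mu> i"
    unfolding W.opt_def by (rule grad_inv_lipschitz[OF W.qbounds_f W.\<mu>])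
  also have "\<dots> \<le> norm (x k \<omega> $ i - x (Suc k) \<omega> $ i) / \<mu>min"
    using \<mu>min W.\<mu> by (intro divide_left_mono) auto
  finally have "(norm (W.opt i (x k \<omega> $ i) - W.opt i (x (Suc k) \<omega> $ i)))\<^sup>2
      \<le> (norm (x k \<omega> $ i - x (Suc k) \<omega> $ i) / \<mu>min)\<^sup>2"
    by (rule power_mono) simp
  then show ?thesis
    using norm_diff_sq_le[of "\<theta> k \<omega> $ i" "W.opt i (x (Suc k) \<omega> $ i)" "W.opt i (x k \<omega> $ i)"]
    by (simp add: err_def power_divide)
qed

end

end

section \<open>Expected errors of the stale gradients\<close>

context dlag
begin

definition past :: "nat \<Rightarrow> (nat \<times> 'n \<times> nat \<times> nat) set" where
  "past k = {..<k} \<times> UNIV \<times> {..<E} \<times> {..<2 * m}"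

lemma finite_past: "finite (past k)"
  by (simp add: past_def)

lemma past_mono: "j \<le> k \<Longrightarrow> past j \<subseteq> past k"
  by (auto simp: past_def)

text \<open>Note the shift: the points \<open>x\<close>, \<open>y\<close>, \<xi> and
  \<open>lam\<close> of iteration k use samples of earlier iterations only, while the gradients and
  delays of iteration k use those of iteration k as well. So the samples of iteration k are fresh
  for \<open>x k\<close>.\<close>

lemma history_cong:
  assumes \<omega>: "\<omega> \<in> space M" and \<omega>': "\<omega>' \<in> space M"
    and "\<And>k' i e l. (k', i, e, l) \<in> past k \<Longrightarrow> J k' i e l \<omega> = J k' i e l \<omega>'"
  shows "(\<forall>j\<le>k. x j \<omega> = x j \<omega>' \<and> y j \<omega> = y j \<omega>' \<and> \<xi> j \<omega> = \<xi> j \<omega>' \<and> lam j \<omega> = lam j \<omega>')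
    \<and> (\<forall>j<k. \<theta> j \<omega> = \<theta> j \<omega>' \<and> \<theta>hat j \<omega> = \<theta>hat j \<omega>' \<and> (\<forall>i. delay j i \<omega> = delay j i \<omega>'))"
  using assms(3)
proof (induction k)
  case 0
  show ?case using x_0 y_0 \<xi>_0 lam_0 \<omega> \<omega>' by simp
next
  case (Suc k)
  have IH: "(\<forall>j\<le>k. x j \<omega> = x j \<omega>' \<and> y j \<omega> = y j \<omega>' \<and> \<xi> j \<omega> = \<xi> j \<omega>' \<and> lam j \<omega> = lam j \<omega>')
    \<and> (\<forall>j<k. \<theta> j \<omega> = \<theta> j \<omega>' \<and> \<theta>hat j \<omega> = \<theta>hat j \<omega>' \<and> (\<forall>i. delay j i \<omega> = delay j i \<omega>'))"
    using past_mono[of k "Suc k"] by (intro Suc.IH Suc.prems) auto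
  have new: "\<theta> k \<omega> = \<theta> k \<omega>' \<and> \<theta>hat k \<omega> = \<theta>hat k \<omega>' \<and> (\<forall>i. delay k i \<omega> = delay k i \<omega>')"
  proof (cases k)
    case 0
    then show ?thesis
      by (simp add: vec_eq_iff \<theta>_0[OF \<omega>] \<theta>_0[OF \<omega>'] \<theta>hat_0[OF \<omega>] \<theta>hat_0[OF \<omega>'] delay_0[OF \<omega>] delay_0[OF \<omega>'])
  next
    case (Suc j)
    have \<theta>: "\<theta> k \<omega> $ i = \<theta> k \<omega>' $ i" for i
    proof -
      have "J k i e l \<omega> = J k i e l \<omega>'" if "e < E" "l < 2 * m" for e l
        using that by (intro Suc.prems) (simp add: past_def)
      moreover have "x k \<omega> = x k \<omega>'" "\<theta> j \<omega> = \<theta> j \<omega>'" using IH Suc by auto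
      ultimately show ?thesis
        unfolding Suc \<theta>_Suc[OF \<omega>] \<theta>_Suc[OF \<omega>'] worker_katyusha_def katyusha_def
        by (auto intro!: arg_cong[where f=fst] kat_epochs_cong)
    qed
    have th: "lazy_threshold D c \<gamma> \<mu>min (\<lambda>k. x k \<omega>) k i = lazy_threshold D c \<gamma> \<mu>min (\<lambda>k. x k \<omega>') k i" for i
      using IH by (intro lazy_threshold_cong) auto
    have prev: "\<theta>hat j \<omega> = \<theta>hat j \<omega>'" "delay j i \<omega> = delay j i \<omega>'" for i using IH Suc by auto
    have "\<theta>hat k \<omega> $ i = \<theta>hat k \<omega>' $ i \<and> delay k i \<omega> = delay k i \<omega>'" for i
      using lazy[OF \<omega>, of j i] lazy[OF \<omega>', of j i] unfolding Suc[symmetric] \<theta> th prev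
      by (auto split: if_splits)
    then show ?thesis using \<theta> by (simp add: vec_eq_iff)
  qed
  then have old: "x k \<omega> = x k \<omega>'" "y k \<omega> = y k \<omega>'" "\<xi> k \<omega> = \<xi> k \<omega>'" "lam k \<omega> = lam k \<omega>'" "\<theta>hat k \<omega> = \<theta>hat k \<omega>'"
    using IH by auto
  have "x (Suc k) \<omega> = x (Suc k) \<omega>'" "y (Suc k) \<omega> = y (Suc k) \<omega>'"
    "\<xi> (Suc k) \<omega> = \<xi> (Suc k) \<omega>'" "lam (Suc k) \<omega> = lam (Suc k) \<omega>'"
    unfolding x_Suc[OF \<omega>] x_Suc[OF \<omega>'] y_Suc[OF \<omega>] y_Suc[OF \<omega>']
      \<xi>_Suc[OF \<omega>] \<xi>_Suc[OF \<omega>'] lam_Suc[OF \<omega>] lam_Suc[OF \<omega>'] old by (rule refl)+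
  then show ?case using IH new by (metis le_Suc_eq less_Suc_eq)
qed

lemma determined_pastI:
  assumes "\<And>\<omega> \<omega>'. \<omega> \<in> space M \<Longrightarrow> \<omega>' \<in> space M \<Longrightarrow>
      \<forall>j\<le>k. x j \<omega> = x j \<omega>' \<and> y j \<omega> = y j \<omega>' \<and> \<xi> j \<omega> = \<xi> j \<omega>' \<and> lam j \<omega> = lam j \<omega>' \<Longrightarrow>
      \<forall>j<k. \<theta> j \<omega> = \<theta> j \<omega>' \<and> \<theta>hat j \<omega> = \<theta>hat j \<omega>' \<Longrightarrow> X \<omega> = X \<omega>'"
  shows "determined (past k) X"
proof (rule determinedI[OF finite_past])
  fix \<omega> \<omega>' assume "\<omega> \<in> space M" "\<omega>' \<in> space M"
    "\<And>t. t \<in> past k \<Longrightarrow> (case t of (k, i, e, l) \<Rightarrow> J k i e l) \<omega> = (case t of (k, i, e, l) \<Rightarrow> J k i e l) \<omega>'"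
  then show "X \<omega> = X \<omega>'" using history_cong[of \<omega> \<omega>' k] by (intro assms) force+
qed

lemma integrable_pastI:
  fixes X :: "'w \<Rightarrow> real"
  assumes "\<And>\<omega> \<omega>'. \<omega> \<in> space M \<Longrightarrow> \<omega>' \<in> space M \<Longrightarrow>
      \<forall>j\<le>k. x j \<omega> = x j \<omega>' \<and> y j \<omega> = y j \<omega>' \<and> \<xi> j \<omega> = \<xi> j \<omega>' \<and> lam j \<omega> = lam j \<omega>' \<Longrightarrow>
      \<forall>j<k. \<theta> j \<omega> = \<theta> j \<omega>' \<and> \<theta>hat j \<omega> = \<theta>hat j \<omega>' \<Longrightarrow> X \<omega> = X \<omega>'"
  shows "integrable M X"
  using determined_pastI[OF assms] by (rule determined_integrable)

definition \<delta> :: "'n \<Rightarrow> nat \<Rightarrow> 'w \<Rightarrow> real" where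
  "\<delta> i j \<omega> = (norm (x j \<omega> $ i - x (Suc j) \<omega> $ i))\<^sup>2"

definition move :: "nat \<Rightarrow> 'w \<Rightarrow> real" where
  "move j \<omega> = (norm (\<xi> (Suc j) \<omega> - \<xi> j \<omega>))\<^sup>2"

definition inexact :: "nat \<Rightarrow> 'w \<Rightarrow> 'a^'n" where
  "inexact k \<omega> = rmult (\<theta>hat k \<omega> - Opt (x k \<omega>)) sqrtU"

definition core :: "nat \<Rightarrow> 'w \<Rightarrow> real" where
  "core k \<omega> = 2 * \<eta> * q\<^sup>2 * (G (lam k \<omega>) - G \<xi>opt) + (norm ((1 + q) *\<^sub>R \<xi> k \<omega> - q *\<^sub>R lam k \<omega> - \<xi>opt))\<^sup>2"

lemma integrable_\<delta>: "integrable M (\<delta> i j)"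
  by (rule integrable_pastI[of "Suc j"]) (simp add: \<delta>_def)

lemma integrable_move: "integrable M (move j)"
  by (rule integrable_pastI[of "Suc j"]) (simp add: move_def)

lemma integrable_err: "integrable M (\<lambda>\<omega>. err k \<omega> i)"
  by (rule integrable_pastI[of "Suc k"]) (simp add: err_def)

lemma integrable_inexact: "integrable M (\<lambda>\<omega>. (norm (inexact k \<omega>))\<^sup>2)"
  by (rule integrable_pastI[of "Suc k"]) (simp add: inexact_def)

lemma integrable_\<theta>hat: "integrable M (\<lambda>\<omega>. (norm (\<theta>hat k \<omega> $ i - W.opt i (x k \<omega> $ i)))\<^sup>2)"
  by (rule integrable_pastI[of "Suc k"]) simp

lemma integrable_core: "integrable M (core k)"
  by (rule integrable_pastI[of k]) (simp add: core_def)

lemma integrable_G: "integrable M (\<lambda>\<omega>. G (lam k \<omega>))"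
  by (rule integrable_pastI[of k]) simp

text \<open>The factor 2 lost in \<open>start_error\<close> is why Katyusha is run to contraction
  c/2: the accumulated error then decays with rate c, the rate in the lazy condition.\<close>

lemma expectation_err_Suc:
  "expectation (\<lambda>\<omega>. err (Suc k) \<omega> i) \<le> c * expectation (\<lambda>\<omega>. err k \<omega> i) + c / \<mu>min\<^sup>2 * expectation (\<delta> i k)"
proof -
  have x: "determined (past (Suc k)) (\<lambda>\<omega>. x (Suc k) \<omega> $ i)" and \<theta>: "determined (past (Suc k)) (\<lambda>\<omega>. \<theta> k \<omega> $ i)"
    by (rule determined_pastI; simp)+
  have int: "integrable M (\<lambda>\<omega>. (norm (\<theta> k \<omega> $ i - W.opt i (x (Suc k) \<omega> $ i)))\<^sup>2)"
    by (rule integrable_pastI[of "Suc k"]) simp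
  have "expectation (\<lambda>\<omega>. err (Suc k) \<omega> i)
      = expectation (\<lambda>\<omega>. (norm (worker_katyusha m (f i) (L i) (\<mu> i) E (\<lambda>e l. J (Suc k) i e l \<omega>)
          (x (Suc k) \<omega> $ i) (\<theta> k \<omega> $ i) - W.opt i (x (Suc k) \<omega> $ i)))\<^sup>2)"
    by (intro Bochner_Integration.integral_cong refl) (simp add: err_def \<theta>_Suc)
  also have "\<dots> \<le> c / 2 * expectation (\<lambda>\<omega>. (norm (\<theta> k \<omega> $ i - W.opt i (x (Suc k) \<omega> $ i)))\<^sup>2)"
    \<comment> \<open>The samples of iteration k + 1 are new because \<open>past (Suc k)\<close>
      stops at iteration k.\<close>
    using W.katyusha_contraction[where t="\<lambda>e l. (Suc k, i, e, l)" and c=c and K=\<kappa>max and E=E, OF x \<theta>] c c_le \<kappa>max E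
    by (simp add: past_def)
  also have "\<dots> \<le> c / 2 * expectation (\<lambda>\<omega>. 2 * err k \<omega> i + 2 / \<mu>min\<^sup>2 * \<delta> i k \<omega>)"
  proof (intro mult_left_mono integral_mono int)
    show "integrable M (\<lambda>\<omega>. 2 * err k \<omega> i + 2 / \<mu>min\<^sup>2 * \<delta> i k \<omega>)"
      using integrable_err[of k i] integrable_\<delta>[of i k] by auto
    show "(norm (\<theta> k \<omega> $ i - W.opt i (x (Suc k) \<omega> $ i)))\<^sup>2 \<le> 2 * err k \<omega> i + 2 / \<mu>min\<^sup>2 * \<delta> i k \<omega>"
      if "\<omega> \<in> space M" for \<omega>
      using start_error[OF that] by (simp add: \<delta>_def)
  qed (use c in simp)
  also have "\<dots> = c * expectation (\<lambda>\<omega>. err k \<omega> i) + c / \<mu>min\<^sup>2 * expectation (\<delta> i k)"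
    using integrable_err[of k i] integrable_\<delta>[of i k] by (simp add: Bochner_Integration.integral_add algebra_simps)
  finally show ?thesis .
qed

lemma expectation_err:
  "expectation (\<lambda>\<omega>. err k \<omega> i) \<le> 1 / \<mu>min\<^sup>2 * (\<Sum>j<k. c ^ (k - j) * expectation (\<delta> i j))"
proof (induction k)
  case 0
  have "expectation (\<lambda>\<omega>. err 0 \<omega> i) = expectation (\<lambda>\<omega>. 0)"
    by (intro Bochner_Integration.integral_cong refl) (simp add: err_def \<theta>_0_opt)
  then show ?case by simp
next
  case (Suc k)
  have "expectation (\<lambda>\<omega>. err (Suc k) \<omega> i)
      \<le> c * (1 / \<mu>min\<^sup>2 * (\<Sum>j<k. c ^ (k - j) * expectation (\<delta> i j))) + c / \<mu>min\<^sup>2 * expectation (\<delta> i k)"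
    using Suc c by (intro order_trans[OF expectation_err_Suc] add_right_mono mult_left_mono) auto
  also have "\<dots> = 1 / \<mu>min\<^sup>2 * ((\<Sum>j<k. c * (c ^ (k - j) * expectation (\<delta> i j))) + c * expectation (\<delta> i k))"
    by (simp add: sum_distrib_left algebra_simps)
  also have "(\<Sum>j<k. c * (c ^ (k - j) * expectation (\<delta> i j))) = (\<Sum>j<k. c ^ (Suc k - j) * expectation (\<delta> i j))"
    by (intro sum.cong) (auto simp: Suc_diff_le)
  finally show ?case by simp
qed

text \<open>Twice the threshold is \<open>?A - ?B\<close> by \<open>lazy_threshold_eq\<close>, and
  in expectation \<open>?B\<close> is exactly the bound on twice the Katyusha error, so only
  \<open>?A\<close> remains.\<close>

lemma expectation_\<theta>hat:
  "expectation (\<lambda>\<omega>. (norm (\<theta>hat k \<omega> $ i - W.opt i (x k \<omega> $ i)))\<^sup>2)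
    \<le> 1 / \<mu>min\<^sup>2 * (\<Sum>j<k. lag_error D c \<gamma> (k - j) * expectation (\<delta> i j))"
proof -
  let ?A = "\<lambda>\<omega>. 1 / \<mu>min\<^sup>2 * (\<Sum>j<k. lag_error D c \<gamma> (k - j) * \<delta> i j \<omega>)"
  let ?B = "\<lambda>\<omega>. 2 / \<mu>min\<^sup>2 * (\<Sum>j<k. c ^ (k - j) * \<delta> i j \<omega>)"
  have int: "integrable M (\<lambda>\<omega>. a * (\<Sum>j<k. g j * \<delta> i j \<omega>))" for a and g :: "nat \<Rightarrow> real"
    using integrable_\<delta> by auto
  have "expectation (\<lambda>\<omega>. (norm (\<theta>hat k \<omega> $ i - W.opt i (x k \<omega> $ i)))\<^sup>2)
      \<le> expectation (\<lambda>\<omega>. ?A \<omega> - ?B \<omega> + 2 * err k \<omega> i)"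
  proof (intro integral_mono integrable_\<theta>hat)
    show "integrable M (\<lambda>\<omega>. ?A \<omega> - ?B \<omega> + 2 * err k \<omega> i)"
      by (intro Bochner_Integration.integrable_add Bochner_Integration.integrable_diff int
          integrable_mult_right integrable_err)
    fix \<omega> assume "\<omega> \<in> space M"
    from \<theta>hat_error[OF this, of k i]
    show "(norm (\<theta>hat k \<omega> $ i - W.opt i (x k \<omega> $ i)))\<^sup>2 \<le> ?A \<omega> - ?B \<omega> + 2 * err k \<omega> i"
      using lazy_threshold_eq[of D c \<gamma> \<mu>min "\<lambda>k. x k \<omega>" k i] unfolding \<delta>_def by linarith
  qed
  also have "\<dots> = 1 / \<mu>min\<^sup>2 * (\<Sum>j<k. lag_error D c \<gamma> (k - j) * expectation (\<delta> i j))
      - 2 * (1 / \<mu>min\<^sup>2 * (\<Sum>j<k. c ^ (k - j) * expectation (\<delta> i j))) + 2 * expectation (\<lambda>\<omega>. err k \<omega> i)"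
  proof -
    have e: "expectation (\<lambda>\<omega>. a * (\<Sum>j<k. g j * \<delta> i j \<omega>)) = a * (\<Sum>j<k. g j * expectation (\<delta> i j))"
      for a and g :: "nat \<Rightarrow> real"
      using integrable_\<delta> by (simp add: Bochner_Integration.integral_sum)
    have "expectation (\<lambda>\<omega>. ?A \<omega> - ?B \<omega> + 2 * err k \<omega> i)
        = expectation ?A - expectation ?B + expectation (\<lambda>\<omega>. 2 * err k \<omega> i)"
      using int integrable_err
      by (subst Bochner_Integration.integral_add, (intro Bochner_Integration.integrable_diff int integrable_mult_right integrable_err)+)
        (subst Bochner_Integration.integral_diff, (intro int refl)+)
    then show ?thesis unfolding e by simp
  qed
  also have "\<dots> \<le> 1 / \<mu>min\<^sup>2 * (\<Sum>j<k. lag_error D c \<gamma> (k - j) * expectation (\<delta> i j))"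
    using expectation_err[of k i] by simp
  finally show ?thesis .
qed

lemma lag_error_nonneg: "0 \<le> lag_error D c \<gamma> d"
  using c \<gamma> by (simp add: lag_error_def)

text \<open>The top eigenvalue enters twice, once for the image of the error under
  \<open>sqrtU\<close> and once because the displacement of \<open>x\<close> is that of \<xi> times
  \<open>sqrtU\<close>; with 1/\<open>\<mu>min\<^sup>2\<close> this makes \<beta> squared.\<close>

lemma expectation_inexact:
  "expectation (\<lambda>\<omega>. (norm (inexact k \<omega>))\<^sup>2) \<le> \<beta>\<^sup>2 * (\<Sum>j<k. lag_error D c \<gamma> (k - j) * expectation (move j))"
proof -
  have \<delta>: "(\<Sum>i\<in>UNIV. expectation (\<delta> i j)) \<le> \<sigma> 1 * expectation (move j)" for j
  proof -
    have "(\<Sum>i\<in>UNIV. expectation (\<delta> i j)) = expectation (\<lambda>\<omega>. \<Sum>i\<in>UNIV. \<delta> i j \<omega>)"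
      using integrable_\<delta> by (simp add: Bochner_Integration.integral_sum)
    also have "\<dots> \<le> expectation (\<lambda>\<omega>. \<sigma> 1 * move j \<omega>)"
    proof (rule integral_mono)
      fix \<omega> assume \<omega>: "\<omega> \<in> space M"
      have "(\<Sum>i\<in>UNIV. \<delta> i j \<omega>) = (norm (x j \<omega> - x (Suc j) \<omega>))\<^sup>2"
        unfolding norm_vec_sq \<delta>_def by simp
      also have "\<dots> = (norm (rmult (\<xi> j \<omega> - \<xi> (Suc j) \<omega>) sqrtU))\<^sup>2"
        using xy_eq[OF \<omega>] by (simp add: rmult_diff)
      also have "\<dots> \<le> \<sigma> 1 * move j \<omega>"
        using norm_rmult_sqrtU_upper[of "\<xi> j \<omega> - \<xi> (Suc j) \<omega>"] by (simp add: move_def norm_minus_commute)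
      finally show "(\<Sum>i\<in>UNIV. \<delta> i j \<omega>) \<le> \<sigma> 1 * move j \<omega>" .
    qed (use integrable_\<delta> integrable_move in auto)
    finally show ?thesis by simp
  qed
  have "expectation (\<lambda>\<omega>. (norm (inexact k \<omega>))\<^sup>2)
      \<le> expectation (\<lambda>\<omega>. \<sigma> 1 * (\<Sum>i\<in>UNIV. (norm (\<theta>hat k \<omega> $ i - W.opt i (x k \<omega> $ i)))\<^sup>2))"
  proof (intro integral_mono integrable_inexact)
    fix \<omega>
    have "(norm (inexact k \<omega>))\<^sup>2 \<le> \<sigma> 1 * (norm (\<theta>hat k \<omega> - Opt (x k \<omega>)))\<^sup>2"
      unfolding inexact_def by (rule norm_rmult_sqrtU_upper)
    then show "(norm (inexact k \<omega>))\<^sup>2 \<le> \<sigma> 1 * (\<Sum>i\<in>UNIV. (norm (\<theta>hat k \<omega> $ i - W.opt i (x k \<omega> $ i)))\<^sup>2)"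
      unfolding norm_vec_sq[of "\<theta>hat k \<omega> - Opt (x k \<omega>)"] by (simp add: Opt_def)
  qed (use integrable_\<theta>hat in auto)
  also have "\<dots> = \<sigma> 1 * (\<Sum>i\<in>UNIV. expectation (\<lambda>\<omega>. (norm (\<theta>hat k \<omega> $ i - W.opt i (x k \<omega> $ i)))\<^sup>2))"
    using integrable_\<theta>hat by (simp add: Bochner_Integration.integral_sum)
  also have "\<dots> \<le> \<sigma> 1 * (\<Sum>i\<in>UNIV. 1 / \<mu>min\<^sup>2 * (\<Sum>j<k. lag_error D c \<gamma> (k - j) * expectation (\<delta> i j)))"
    using \<sigma>1 by (intro mult_left_mono sum_mono expectation_\<theta>hat) auto
  also have "\<dots> = \<sigma> 1 / \<mu>min\<^sup>2 * (\<Sum>j<k. lag_error D c \<gamma> (k - j) * (\<Sum>i\<in>UNIV. expectation (\<delta> i j)))"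
    unfolding sum_distrib_left by (subst sum.swap) (simp add: mult_ac)
  also have "\<dots> \<le> \<sigma> 1 / \<mu>min\<^sup>2 * (\<Sum>j<k. lag_error D c \<gamma> (k - j) * (\<sigma> 1 * expectation (move j)))"
    using \<sigma>1 by (intro mult_left_mono sum_mono \<delta> lag_error_nonneg) auto
  also have "\<dots> = \<beta>\<^sup>2 * (\<Sum>j<k. lag_error D c \<gamma> (k - j) * expectation (move j))"
    unfolding \<beta> by (simp add: sum_distrib_left sum_divide_distrib power2_eq_square mult_ac)
  finally show ?thesis .
qed

lemma core_step:
  assumes \<omega>: "\<omega> \<in> space M"
  shows "core (Suc k) \<omega> \<le> (1 - 1 / q) * core k \<omega> - q / 5 * move k \<omega> + 6 * q ^ 3 * \<eta>\<^sup>2 * (norm (inexact k \<omega>))\<^sup>2"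
proof -
  have d: "rmult (\<theta>hat k \<omega>) sqrtU = rmult (Opt (rmult (\<xi> k \<omega>) sqrtU)) sqrtU + inexact k \<omega>"
    using xy_eq[OF \<omega>] by (simp add: inexact_def rmult_diff)
  have sum0: "(\<Sum>i\<in>UNIV. (a - b) $ i) = 0" if "(\<Sum>i\<in>UNIV. a $ i) = 0" "(\<Sum>i\<in>UNIV. b $ i) = 0" for a b :: "'a^'n"
    using that by (simp add: sum_subtractf)
  show ?thesis
    unfolding core_def move_def
  proof (rule accelerated_step[where d="rmult (Opt (rmult (\<xi> k \<omega>) sqrtU)) sqrtU", OF q3 \<eta>_pos])
    show "\<beta> * \<eta> = 2 / 15" using \<alpha>\<beta> by (simp add: \<eta>)
    show "\<alpha> * \<eta> * q\<^sup>2 = 4 / 3" unfolding q_sq using \<alpha>\<beta> by (simp add: \<eta> \<kappa>)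
    show "lam (Suc k) \<omega> = \<xi> k \<omega> - \<eta> *\<^sub>R (rmult (Opt (rmult (\<xi> k \<omega>) sqrtU)) sqrtU + inexact k \<omega>)"
      unfolding lam_Suc[OF \<omega>] d ..
    show "\<xi> (Suc k) \<omega> = lam (Suc k) \<omega> + ((q - 1) / (q + 1)) *\<^sub>R (lam (Suc k) \<omega> - lam k \<omega>)"
      by (rule \<xi>_Suc[OF \<omega>])
  qed (intro G_upper G_lower sum0 \<xi>opt_sum conjunct1[OF \<xi>lam_sum[OF \<omega>]] conjunct2[OF \<xi>lam_sum[OF \<omega>]])+
qed

lemma expectation_core_step:
  "expectation (core (Suc k)) \<le> (1 - 1 / q) * expectation (core k) - q / 5 * expectation (move k)
    + q * (16 / 15 * \<kappa>) * (\<Sum>j<k. lag_error D c \<gamma> (k - j) * expectation (move j))"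
proof -
  have "expectation (core (Suc k)) \<le> expectation (\<lambda>\<omega>. (1 - 1 / q) * core k \<omega> - q / 5 * move k \<omega>
      + 6 * q ^ 3 * \<eta>\<^sup>2 * (norm (inexact k \<omega>))\<^sup>2)"
    using integrable_core integrable_move integrable_inexact by (intro integral_mono core_step) auto
  also have "\<dots> = (1 - 1 / q) * expectation (core k) - q / 5 * expectation (move k)
      + 6 * q ^ 3 * \<eta>\<^sup>2 * expectation (\<lambda>\<omega>. (norm (inexact k \<omega>))\<^sup>2)"
    using integrable_core[of k] integrable_move[of k] integrable_inexact[of k]
    by (simp add: Bochner_Integration.integral_add Bochner_Integration.integral_diff)
  also have "\<dots> \<le> (1 - 1 / q) * expectation (core k) - q / 5 * expectation (move k)
      + 6 * q ^ 3 * \<eta>\<^sup>2 * (\<beta>\<^sup>2 * (\<Sum>j<k. lag_error D c \<gamma> (k - j) * expectation (move j)))"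
    using q3 by (intro add_left_mono mult_left_mono expectation_inexact) auto
  \<comment> \<open>As \<eta>\<beta> = 2/15 and q squared is 10\<kappa>, the coefficient is q times
    60\<kappa> times 4/225.\<close>
  also have "6 * q ^ 3 * \<eta>\<^sup>2 * (\<beta>\<^sup>2 * (\<Sum>j<k. lag_error D c \<gamma> (k - j) * expectation (move j)))
      = q * (16 / 15 * \<kappa>) * (\<Sum>j<k. lag_error D c \<gamma> (k - j) * expectation (move j))"
  proof -
    have "\<eta> * \<beta> = 2 / 15" using \<alpha>\<beta> by (simp add: \<eta>)
    then have "(\<eta> * \<beta>)\<^sup>2 = 4 / 225" by (simp only:) (simp add: power2_eq_square)
    then have "\<eta>\<^sup>2 * \<beta>\<^sup>2 = 4 / 225" by (simp only: power_mult_distrib)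
    moreover have "q ^ 3 = q * (10 * \<kappa>)" unfolding q_sq[symmetric] by (simp add: power2_eq_square power3_eq_cube)
    ultimately have "6 * q ^ 3 * (\<eta>\<^sup>2 * \<beta>\<^sup>2) = q * (16 / 15 * \<kappa>)" by (simp only:)
    from this[symmetric] show ?thesis by (simp only: mult_ac)
  qed
  finally show ?thesis .
qed

section \<open>The Lyapunov function and its contraction\<close>

definition weight :: "nat \<Rightarrow> real" where
  "weight d = q * lag_weight D t d"

lemma weight_pos: "0 < weight d"
  unfolding weight_def using q3 D t by (intro mult_pos_pos lag_weight_pos) auto

definition lyap :: "nat \<Rightarrow> 'w \<Rightarrow> real" where
  "lyap k \<omega> = core k \<omega> + (\<Sum>d = 1..k. weight d * move (k - d) \<omega>)"

text \<open>The proof uses one weighted sum; for lags up to D each weight is halved so that the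
  coefficients of both sums in the statement are positive. Lags beyond k contribute nothing, since
  truncation makes both indices 0.\<close>

lemma lyapunov_eq:
  "lyapunov G \<eta> 10 \<kappa> D (\<lambda>d. weight d / 2) (\<lambda>d. if d \<le> D then weight d / 2 else weight d)
    \<xi>opt (\<lambda>k. \<xi> k \<omega>) (\<lambda>k. lam k \<omega>) k = lyap k \<omega>"
proof -
  let ?n = "\<lambda>d. (norm (\<xi> (k + 1 - d) \<omega> - \<xi> (k - d) \<omega>))\<^sup>2"
  have "(\<Sum>d = 1..D. weight d / 2 * ?n d) = (\<Sum>d\<in>{1..D} \<inter> {1..k}. weight d / 2 * ?n d)"
    by (intro sum.mono_neutral_right) auto
  also have "\<dots> = (\<Sum>d = 1..k. if d \<le> D then weight d / 2 * ?n d else 0)"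
    by (simp add: sum.inter_restrict[symmetric] flip: sum.inter_filter) (intro sum.cong; auto)
  finally have "(\<Sum>d = 1..D. weight d / 2 * ?n d) = (\<Sum>d = 1..k. if d \<le> D then weight d / 2 * ?n d else 0)" .
  then have "(\<Sum>d = 1..D. weight d / 2 * ?n d) + (\<Sum>d = 1..k. (if d \<le> D then weight d / 2 else weight d) * ?n d)
      = (\<Sum>d = 1..k. (if d \<le> D then weight d / 2 * ?n d else 0) + (if d \<le> D then weight d / 2 else weight d) * ?n d)"
    by (simp only: sum.distrib)
  also have "\<dots> = (\<Sum>d = 1..k. weight d * move (k - d) \<omega>)"
    by (intro sum.cong) (auto simp: move_def Suc_diff_le)
  finally have "(\<Sum>d = 1..D. weight d / 2 * ?n d) + (\<Sum>d = 1..k. (if d \<le> D then weight d / 2 else weight d) * ?n d)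
      = (\<Sum>d = 1..k. weight d * move (k - d) \<omega>)" .
  then show ?thesis
    unfolding lyapunov_def Let_def lyap_def core_def q_sq unfolding q by simp
qed

lemma integrable_lyap: "integrable M (lyap k)"
  unfolding lyap_def using integrable_core integrable_move by auto

lemma expectation_lyap:
  "expectation (lyap k) = expectation (core k) + (\<Sum>d = 1..k. weight d * expectation (move (k - d)))"
  unfolding lyap_def using integrable_core integrable_move
  by (simp add: Bochner_Integration.integral_add Bochner_Integration.integral_sum)

text \<open>Passing to the next iteration moves each displacement one lag further, which
  \<open>lag_weight_step\<close> prices together with its error. The newest displacement enters with
  weight q/10 and is covered by the gain q/5.\<close>

lemma expectation_lyap_step: "expectation (lyap (Suc k)) \<le> (1 - 1 / q) * expectation (lyap k)"
proof -
  define e where "e = (\<lambda>j. expectation (move j))"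
  have e: "0 \<le> e j" for j unfolding e_def move_def by (intro integral_nonneg_AE) auto
  have "(\<Sum>d = 1..Suc k. weight d * e (Suc k - d)) = weight 1 * e k + (\<Sum>d = 1..k. weight (Suc d) * e (k - d))"
    unfolding One_nat_def sum.atLeast1_atMost_eq by (subst sum.lessThan_Suc_shift) simp
  also have "weight 1 = q / 10" unfolding weight_def using lag_weight_1[OF D] by simp
  finally have new: "(\<Sum>d = 1..Suc k. weight d * e (Suc k - d)) = q / 10 * e k + (\<Sum>d = 1..k. weight (Suc d) * e (k - d))" .
  have lags: "(\<Sum>j<k. lag_error D c \<gamma> (k - j) * e j) = (\<Sum>d = 1..k. lag_error D c \<gamma> d * e (k - d))"
    by (rule sum.reindex_bij_witness[of _ "\<lambda>d. k - d" "\<lambda>j. k - j"]) auto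
  have "expectation (core (Suc k)) \<le> (1 - 1 / q) * expectation (core k) - q / 5 * e k
      + q * (16 / 15 * \<kappa>) * (\<Sum>d = 1..k. lag_error D c \<gamma> d * e (k - d))"
    unfolding lags[symmetric] unfolding e_def by (rule expectation_core_step)
  then have "expectation (lyap (Suc k)) \<le> (1 - 1 / q) * expectation (core k) - q / 5 * e k
      + q * (16 / 15 * \<kappa>) * (\<Sum>d = 1..k. lag_error D c \<gamma> d * e (k - d))
      + (q / 10 * e k + (\<Sum>d = 1..k. weight (Suc d) * e (k - d)))"
    unfolding expectation_lyap e_def[THEN fun_cong, symmetric] new by linarith
  also have "\<dots> = (1 - 1 / q) * expectation (core k) - q / 10 * e k
      + (\<Sum>d = 1..k. q * (16 / 15 * \<kappa> * lag_error D c \<gamma> d + lag_weight D t (Suc d)) * e (k - d))"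
    by (simp add: sum_distrib_left sum_divide_distrib sum.distrib[symmetric] weight_def algebra_simps)
  also have "\<dots> \<le> (1 - 1 / q) * expectation (core k) + (\<Sum>d = 1..k. (1 - 1 / q) * (weight d * e (k - d)))"
  proof -
    have "q * (16 / 15 * \<kappa> * lag_error D c \<gamma> d + lag_weight D t (Suc d)) * e (k - d) \<le> (1 - 1 / q) * (weight d * e (k - d))"
      if "d \<in> {1..k}" for d
    proof -
      have "q * (16 / 15 * \<kappa> * lag_error D c \<gamma> d + lag_weight D t (Suc d)) \<le> q * (t * lag_weight D t d)"
        using that q3 by (intro mult_left_mono lag_weight_step D t t_le_1 \<kappa>_ge_1 c \<gamma>) auto
      also have "\<dots> = t * weight d" by (simp add: weight_def)
      also have "\<dots> \<le> (1 - 1 / q) * weight d" using weight_pos[of d] by (intro mult_right_mono t) auto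
      finally have "q * (16 / 15 * \<kappa> * lag_error D c \<gamma> d + lag_weight D t (Suc d)) * e (k - d)
          \<le> (1 - 1 / q) * weight d * e (k - d)"
        by (intro mult_right_mono e)
      then show ?thesis by simp
    qed
    then have "(\<Sum>d = 1..k. q * (16 / 15 * \<kappa> * lag_error D c \<gamma> d + lag_weight D t (Suc d)) * e (k - d))
        \<le> (\<Sum>d = 1..k. (1 - 1 / q) * (weight d * e (k - d)))"
      by (rule sum_mono)
    moreover have "0 \<le> q / 10 * e k" using q3 e by simp
    ultimately show ?thesis by linarith
  qed
  also have "\<dots> = (1 - 1 / q) * expectation (lyap k)"
    unfolding expectation_lyap e_def by (simp add: sum_distrib_left distrib_left)
  finally show ?thesis .
qed

lemma expectation_gap_le:
  "expectation (\<lambda>\<omega>. G (lam k \<omega>)) - G \<xi>opt \<le> (1 - 1 / q) ^ k * (expectation (lyap 0) / (2 * \<eta> * 10 * \<kappa>))"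
proof -
  have p: "0 < 2 * \<eta> * 10 * \<kappa>" using \<eta>_pos \<kappa>_ge_1 by simp
  have r: "0 \<le> 1 - 1 / q" using q3 by simp
  have "expectation (lyap k) \<le> (1 - 1 / q) ^ k * expectation (lyap 0)"
  proof (induction k)
    case (Suc k)
    have "expectation (lyap (Suc k)) \<le> (1 - 1 / q) * ((1 - 1 / q) ^ k * expectation (lyap 0))"
      using Suc r by (intro order_trans[OF expectation_lyap_step] mult_left_mono)
    then show ?case by simp
  qed simp
  moreover have "2 * \<eta> * 10 * \<kappa> * (expectation (\<lambda>\<omega>. G (lam k \<omega>)) - G \<xi>opt) \<le> expectation (lyap k)"
  proof -
    have "2 * \<eta> * 10 * \<kappa> * (expectation (\<lambda>\<omega>. G (lam k \<omega>)) - G \<xi>opt)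
        = expectation (\<lambda>\<omega>. 2 * \<eta> * 10 * \<kappa> * (G (lam k \<omega>) - G \<xi>opt))"
      using integrable_G[of k] by (simp add: Bochner_Integration.integral_diff prob_space)
    also have "\<dots> \<le> expectation (lyap k)"
    proof (rule integral_mono)
      show "integrable M (lyap k)" by (rule integrable_lyap)
      show "integrable M (\<lambda>\<omega>. 2 * \<eta> * 10 * \<kappa> * (G (lam k \<omega>) - G \<xi>opt))"
        using integrable_G[of k] by auto
      fix \<omega>
      have "0 \<le> (\<Sum>d = 1..k. weight d * move (k - d) \<omega>)"
        using weight_pos by (intro sum_nonneg mult_nonneg_nonneg) (auto simp: less_imp_le move_def)
      moreover have "0 \<le> (norm ((1 + q) *\<^sub>R \<xi> k \<omega> - q *\<^sub>R lam k \<omega> - \<xi>opt))\<^sup>2" by simp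
      ultimately show "2 * \<eta> * 10 * \<kappa> * (G (lam k \<omega>) - G \<xi>opt) \<le> lyap k \<omega>"
        unfolding lyap_def core_def q_sq by simp
    qed
    finally show ?thesis .
  qed
  ultimately have "2 * \<eta> * 10 * \<kappa> * (expectation (\<lambda>\<omega>. G (lam k \<omega>)) - G \<xi>opt) \<le> (1 - 1 / q) ^ k * expectation (lyap 0)"
    by linarith
  then have "(expectation (\<lambda>\<omega>. G (lam k \<omega>)) - G \<xi>opt) * (2 * \<eta> * 10 * \<kappa>) \<le> (1 - 1 / q) ^ k * expectation (lyap 0)"
    by (simp only: mult.commute)
  then show ?thesis using pos_le_divide_eq[OF p] by simp
qed

lemma expectation_lyap_0_nonneg: "0 \<le> expectation (lyap 0)"
proof (rule integral_nonneg_AE, rule AE_I2)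
  fix \<omega>
  have "0 \<le> 2 * \<eta> * q\<^sup>2 * (G (lam 0 \<omega>) - G \<xi>opt)"
    using \<eta>_pos G_\<xi>opt_le by (intro mult_nonneg_nonneg) auto
  then show "0 \<le> lyap 0 \<omega>" by (simp add: lyap_def core_def)
qed

end

subsection \<open>Complexity\<close>

text \<open>With \<epsilon> at most 1/2 the logarithm is at least 2/3, so the rounding and the
  initial gap can be absorbed as multiples of it. The maximum with 0 prevents a small initial gap
  from making the count negative.\<close>

lemma iteration_count:
  fixes a :: "nat \<Rightarrow> real"
  assumes \<kappa>: "1 \<le> \<kappa>" and \<Delta>: "0 \<le> \<Delta>" and a: "\<And>k. a k \<le> (1 - 1 / sqrt (10 * \<kappa>)) ^ k * \<Delta>"
    and \<epsilon>: "0 < \<epsilon>" "\<epsilon> \<le> 1 / 2"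
  shows "\<exists>K. (\<forall>k\<ge>K. a k \<le> \<epsilon>) \<and> real K \<le> 10 * (1 + max 0 (ln \<Delta>)) * sqrt \<kappa> * ln (1 / \<epsilon>)"
proof -
  define q l u K where "q = sqrt (10 * \<kappa>)" and "l = ln (1 / \<epsilon>)" and "u = max 0 (ln \<Delta>)" and "K = nat \<lceil>q * (u + l)\<rceil>"
  have "ln 2 \<le> l" unfolding l_def using \<epsilon> by (subst ln_le_cancel_iff) (auto simp: field_simps)
  then have l: "2 / 3 \<le> l" using ln2_ge_two_thirds by linarith
  have u: "0 \<le> u" "ln \<Delta> \<le> u" by (auto simp: u_def)
  have s: "1 \<le> sqrt \<kappa>" using \<kappa> by simp
  have q: "3 \<le> q" unfolding q_def using \<kappa> by (intro real_le_rsqrt) auto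
  have q': "q \<le> 32 / 10 * sqrt \<kappa>"
    unfolding q_def using \<kappa> by (intro real_le_lsqrt) (auto simp: power_mult_distrib power2_eq_square)
  have "a k \<le> \<epsilon>" if k: "K \<le> k" for k
  \<comment> \<open>Separate because \<open>ln\<close> inverts \<open>exp\<close> only on positive
    numbers.\<close>
  proof (cases "\<Delta> = 0")
    case True
    then show ?thesis using a[of k] \<epsilon> by simp
  next
    case False
    have "q * (u + l) \<le> real K" unfolding K_def by (rule real_nat_ceiling_ge)
    then have "u + l \<le> real k / q" using k q by (simp add: field_simps)
    then have "ln \<Delta> + l \<le> real k / q" using u by linarith
    have "(1 - 1 / q) ^ k \<le> exp (- (1 / q)) ^ k"
      using q exp_ge_add_one_self[of "- (1 / q)"] by (intro power_mono) auto
    also have "\<dots> = exp (- (real k / q))" by (simp flip: exp_of_nat_mult)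
    also have "\<dots> \<le> exp (- (ln \<Delta> + l))" using \<open>ln \<Delta> + l \<le> real k / q\<close> by simp
    also have "\<dots> = \<epsilon> / \<Delta>"
      using False \<Delta> \<epsilon> by (simp add: l_def exp_diff exp_minus ln_div exp_add field_simps)
    finally have "(1 - 1 / q) ^ k * \<Delta> \<le> \<epsilon>" using False \<Delta> by (simp add: field_simps)
    then show ?thesis using a[of k] unfolding q_def by linarith
  qed
  moreover have "real K \<le> 10 * (1 + u) * sqrt \<kappa> * l"
  proof -
    have "0 \<le> q * (u + l)" using q u l by simp
    then have "real K \<le> q * (u + l) + 1" unfolding K_def by linarith
    also have "q * (u + l) \<le> 32 / 10 * sqrt \<kappa> * (u + l)" using q' u l by (intro mult_right_mono) auto
    also have "u + l \<le> 3 / 2 * (u * l) + l"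
      using mult_left_mono[OF l, of u] u by simp
    also have "(1::real) \<le> 3 / 2 * (sqrt \<kappa> * l)"
      using mult_mono[OF s l] s by simp
    finally have "real K \<le> 32 / 10 * sqrt \<kappa> * (3 / 2 * (u * l) + l) + 3 / 2 * (sqrt \<kappa> * l)"
      using s by simp
    also have "\<dots> = 48 / 10 * (sqrt \<kappa> * (u * l)) + 47 / 10 * (sqrt \<kappa> * l)" by (simp add: field_simps)
    also have "\<dots> \<le> 10 * (sqrt \<kappa> * (u * l)) + 10 * (sqrt \<kappa> * l)"
      using s u l by (intro add_mono mult_right_mono) auto
    also have "\<dots> = 10 * (1 + u) * sqrt \<kappa> * l" by (simp add: algebra_simps)
    finally show ?thesis .
  qed
  ultimately show ?thesis unfolding u_def l_def by blast
qed

text \<open>The constant 100 is 5 gradients per component and epoch, times 2 for rounding up a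
  number that is at least 1, times 10 from the iteration count.\<close>

lemma gradient_count:
  fixes m E K n :: nat
  assumes m: "1 \<le> m" and C0: "100 \<le> C0" and \<Lambda>: "1 \<le> \<Lambda>" and \<kappa>: "0 \<le> \<kappa>max"
    and E: "E = nat \<lceil>C0 * (1 + sqrt (\<kappa>max / real m)) * \<Lambda>\<rceil>" and K: "real K \<le> 10 * B"
  shows "real (n * K * katyusha_evals m E) \<le> 100 * (C0 * real n * (real m + sqrt (real m * \<kappa>max)) * \<Lambda> * B)"
proof -
  define e where "e = C0 * (1 + sqrt (\<kappa>max / real m)) * \<Lambda>"
  have "1 * 1 \<le> C0 * (1 + sqrt (\<kappa>max / real m))"
    using C0 \<kappa> by (intro mult_mono) auto
  then have e1: "1 \<le> e" unfolding e_def using \<Lambda> mult_mono[of 1 "C0 * (1 + sqrt (\<kappa>max / real m))" 1 \<Lambda>] by simp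
  then have E': "real E \<le> 2 * e" unfolding E e_def[symmetric] by linarith
  have em: "real m * e = C0 * (real m + sqrt (real m * \<kappa>max)) * \<Lambda>"
  proof -
    have "real m * sqrt (\<kappa>max / real m) = sqrt (real m * \<kappa>max)"
      using m by (simp add: real_sqrt_divide real_sqrt_mult field_simps)
    then show ?thesis unfolding e_def by (simp add: algebra_simps)
  qed
  have "real (n * K * katyusha_evals m E) = real n * (real K * (5 * real m * real E))"
    by (simp add: katyusha_evals_def algebra_simps)
  also have "\<dots> \<le> real n * ((10 * B) * (5 * real m * (2 * e)))"
    using K E' e1 by (intro mult_left_mono mult_mono) auto
  also have "\<dots> = 100 * (real n * (real m * e) * B)" by simp
  also have "\<dots> = 100 * (C0 * real n * (real m + sqrt (real m * \<kappa>max)) * \<Lambda> * B)"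
    unfolding em by (simp add: mult_ac)
  finally show ?thesis .
qed

text \<open>Since \<kappa>\<alpha> = \<beta>, the prefactor becomes the square of \<beta> times
  \<open>\<mu>min\<close>, over the fourth power of \<open>N\<close>, which is at most 1.\<close>

lemma parameter_bound:
  fixes \<alpha> \<beta> \<kappa> \<mu>min N B :: real and d :: nat
  assumes "0 < \<alpha>" "0 < \<beta>" "\<kappa> = \<beta> / \<alpha>" "0 < \<mu>min" "\<beta> * \<mu>min \<le> N\<^sup>2" "0 < B"
  shows "\<kappa> * (\<alpha> * \<beta> * \<mu>min\<^sup>2 / (B * N ^ 4) * exp (- (2 * real d / sqrt \<kappa>)))
    \<le> exp (- (2 / sqrt \<kappa>)) ^ d / B"
proof -
  define u where "u = exp (- (2 * real d / sqrt \<kappa>))"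
  have "N \<noteq> 0"
    using assms(5) mult_pos_pos[OF assms(2,4)] by auto
  have "(\<beta> * \<mu>min)\<^sup>2 \<le> (N\<^sup>2)\<^sup>2" using assms by (intro power_mono) auto
  then have "(\<beta> * \<mu>min)\<^sup>2 / N ^ 4 \<le> 1" using \<open>N \<noteq> 0\<close> by (simp add: divide_le_eq)
  then have "(\<beta> * \<mu>min)\<^sup>2 / N ^ 4 * (u / B) \<le> 1 * (u / B)"
    using assms by (intro mult_right_mono) (auto simp: u_def)
  moreover have "\<kappa> * (\<alpha> * \<beta> * \<mu>min\<^sup>2 / (B * N ^ 4) * u) = (\<beta> * \<mu>min)\<^sup>2 / N ^ 4 * (u / B)"
    using assms \<open>N \<noteq> 0\<close> by (simp add: power2_eq_square field_simps)
  moreover have "u = exp (- (2 / sqrt \<kappa>)) ^ d"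
    unfolding u_def by (simp flip: exp_of_nat_mult add: mult_ac)
  ultimately show ?thesis unfolding u_def by simp
qed

text \<open>With u the inverse square root of \<kappa>, the exponential is at most 1/(1 + 2u), hence
  at most 1 - u/3 for u up to 1; and the square root of 10 is at least 3.\<close>

lemma exp_rate_bound:
  assumes "1 \<le> (\<kappa> :: real)"
  shows "exp (- (2 / sqrt \<kappa>)) \<le> 1 - 1 / sqrt (10 * \<kappa>)"
proof -
  define u where "u = 1 / sqrt \<kappa>"
  have u: "0 < u" "u \<le> 1" using assms by (auto simp: u_def)
  have "3 \<le> sqrt 10" by (rule real_le_rsqrt) simp
  then have "1 / sqrt 10 \<le> 1 / 3" by (intro divide_left_mono) auto
  then have "1 / sqrt 10 * u \<le> 1 / 3 * u" using u by (intro mult_right_mono) auto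
  then have q: "1 / sqrt (10 * \<kappa>) \<le> u / 3" by (simp add: u_def real_sqrt_mult)
  have "1 + 2 * u \<le> exp (2 * u)" by (rule exp_ge_add_one_self)
  then have "exp (- (2 * u)) \<le> 1 / (1 + 2 * u)"
    using u by (simp add: exp_minus inverse_eq_divide divide_left_mono)
  also have "\<dots> \<le> 1 - u / 3"
  proof -
    have "u * u \<le> u" using u by (simp add: mult_left_le)
    then have "1 \<le> (1 - u / 3) * (1 + 2 * u)" using u by (simp add: algebra_simps)
    then show ?thesis using u by (simp add: divide_le_eq)
  qed
  finally show ?thesis using q by (simp add: u_def)
qed

theorem theorem1:
  fixes f :: "'n::finite \<Rightarrow> nat \<Rightarrow> 'a::euclidean_space \<Rightarrow> real"
    and L \<mu> :: "'n \<Rightarrow> real"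
    and m D E :: nat
    and edges :: "('n \<times> 'n) set"
    and W U sqrtU :: "real^'n^'n"
    and \<sigma> :: "nat \<Rightarrow> real"
    and G :: "'a^'n \<Rightarrow> real"
    and \<xi>opt :: "'a^'n"
    and \<mu>min Lmax \<kappa>max \<kappa>F \<zeta> \<alpha> \<beta> \<kappa> \<gamma> c \<eta> s C0 :: real
    and M :: "'w measure"
    and J :: "nat \<Rightarrow> 'n \<Rightarrow> nat \<Rightarrow> nat \<Rightarrow> 'w \<Rightarrow> nat"
    and x y \<theta> \<theta>hat \<xi> lam :: "nat \<Rightarrow> 'w \<Rightarrow> 'a^'n"
    and delay :: "nat \<Rightarrow> 'n \<Rightarrow> 'w \<Rightarrow> nat"
  assumes sizes: "1 \<le> m" "1 \<le> D" "2 \<le> CARD('n)"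
    and f_diff: "\<And>i j z. j < m \<Longrightarrow> f i j differentiable (at z)"
    and f_smooth: "\<And>i j. j < m \<Longrightarrow> smooth_with (L i) (f i j)"
    and f_strong: "\<And>i j. j < m \<Longrightarrow> strongly_convex_with (\<mu> i) (f i j)"
    and \<mu>_pos: "\<And>i. 0 < \<mu> i"
    and \<mu>min: "\<mu>min = Min (range \<mu>)"
    and Lmax: "Lmax = Max (range L)"
    and \<kappa>max: "\<kappa>max = Max (range (\<lambda>i. L i / \<mu> i))"
    and \<kappa>F: "\<kappa>F = Lmax / \<mu>min"
    and undirected: "sym edges"
    and W_sym: "transpose W = W"
    and W_edges: "\<And>i j. W $ i $ j \<noteq> 0 \<longleftrightarrow> (i, j) \<in> edges"
    and U: "U = mat 1 - W"
    and U_psd: "pos_semidef U"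
    and U_null: "{v. U *v v = 0} = span {\<chi> i. 1}"
    and U_eig: "eigenvalues_desc U \<sigma>" "\<sigma> (CARD('n) - 1) > 0" "\<sigma> CARD('n) = 0"
    and \<zeta>: "\<zeta> = \<sigma> (CARD('n) - 1) / \<sigma> 1"
    and sqrtU: "pos_semidef sqrtU" "sqrtU ** sqrtU = U"
    and G: "G = dual m f sqrtU"
    and \<beta>: "\<beta> = \<sigma> 1 / \<mu>min"
    and \<alpha>: "\<alpha> = \<sigma> (CARD('n) - 1) / Lmax"
    and \<kappa>: "\<kappa> = \<kappa>F / \<zeta>"
    and \<xi>opt: "is_arg_min G (\<lambda>\<xi>. (\<Sum>i\<in>UNIV. \<xi> $ i) = 0) \<xi>opt"
    and \<gamma>: "\<gamma> = \<alpha> * \<beta> * \<mu>min\<^sup>2 / (288 * real D * norm sqrtU ^ 4) * exp (- (2 * real D / sqrt \<kappa>))"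
    and c: "c = \<alpha> * \<beta> * \<mu>min\<^sup>2 / (1200 * real D * norm sqrtU ^ 4) * exp (- (2 * (real D + 1) / sqrt \<kappa>))"
    and \<eta>: "\<eta> = 2 / 15 * (1 / \<beta>)"
    and s: "s = 10"
    and C0: "100 \<le> C0"
    and E: "E = nat \<lceil>C0 * (1 + sqrt (\<kappa>max / real m)) * ln (2 * \<kappa>max / c)\<rceil>"
    and M: "prob_space M"
    and J_indep: "prob_space.indep_vars M (\<lambda>_. count_space {..<m}) (\<lambda>(k, i, e, l). J k i e l) UNIV"
    and J_unif: "\<And>k i e l. distr M (count_space {..<m}) (J k i e l) = uniform_count_measure {..<m}"
    and run: "\<And>\<omega>. \<omega> \<in> space M \<Longrightarrow>
      dlag_run m f L \<mu> U \<eta> s \<kappa> c \<gamma> D E (\<lambda>k i e l. J k i e l \<omega>)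
        (\<lambda>k. x k \<omega>) (\<lambda>k. y k \<omega>) (\<lambda>k. \<theta> k \<omega>) (\<lambda>k. \<theta>hat k \<omega>) (\<lambda>k i. delay k i \<omega>)"
    and aux: "\<And>\<omega>. \<omega> \<in> space M \<Longrightarrow>
      dlag_aux sqrtU \<eta> s \<kappa> (\<lambda>k. \<theta>hat k \<omega>) (\<lambda>k. \<xi> k \<omega>) (\<lambda>k. lam k \<omega>)"
  shows "c < 1 \<and>
    (\<exists>cd ctd :: nat \<Rightarrow> real.
      (\<forall>d\<in>{1..D}. 0 < cd d) \<and> (\<forall>d\<ge>1. 0 < ctd d) \<and>
      (let Lyap = (\<lambda>k \<omega>. lyapunov G \<eta> s \<kappa> D cd ctd \<xi>opt (\<lambda>k. \<xi> k \<omega>) (\<lambda>k. lam k \<omega>) k);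
           \<Delta> = (LINT \<omega>|M. Lyap 0 \<omega>) / (2 * \<eta> * s * \<kappa>);
           C = 1 + max 0 (ln \<Delta>)
       in (\<forall>k. integrable M (Lyap k) \<and> integrable M (\<lambda>\<omega>. G (lam k \<omega>)) \<and>
             (LINT \<omega>|M. Lyap (k + 1) \<omega>) \<le> (1 - 1 / sqrt (10 * \<kappa>)) * (LINT \<omega>|M. Lyap k \<omega>)) \<and>
          (\<forall>\<epsilon>. 0 < \<epsilon> \<longrightarrow> \<epsilon> \<le> 1 / 2 \<longrightarrow>
             (\<exists>K :: nat.
                (\<forall>k\<ge>K. (LINT \<omega>|M. G (lam k \<omega>)) - (INF \<xi>. G \<xi>) \<le> \<epsilon>) \<and>
                real K \<le> 10 * C * sqrt \<kappa> * ln (1 / \<epsilon>) \<and>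
                real (CARD('n) * K * katyusha_evals m E)
                  \<le> 100 * C0 * C * real CARD('n) * (real m + sqrt (real m * \<kappa>max))
                     * ln (2 * \<kappa>max / c) * sqrt \<kappa> * ln (1 / \<epsilon>)))))"
proof -
  have worker: "worker m (f i) (L i) (\<mu> i)" for i
    using sizes(1) f_diff f_smooth f_strong \<mu>_pos
    by (intro worker.intro qbounds_of_smooth_strongly_convex) auto
  interpret N: network U sqrtU \<sigma>
    using sizes(3) U_psd U_null U_eig sqrtU by (intro network.intro)
  interpret prob_space M by (rule M)
  have sampling: "sampling M m (\<lambda>(k, i, e, l). J k i e l)"
  proof (intro sampling.intro sampling_axioms.intro M sizes(1))
    show "indep_vars (\<lambda>_. count_space {..<m}) (\<lambda>(k, i, e, l). J k i e l) UNIV" by (rule J_indep)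
    show "distr M (count_space {..<m}) (case t of (k, i, e, l) \<Rightarrow> J k i e l) = uniform_count_measure {..<m}" for t
      by (cases t) (simp add: J_unif)
  qed
  \<comment> \<open>The decay per lag of the weights. Its powers D and D + 1 are the exponentials in
    \<gamma> and c, and it lies below the contraction factor 1 - 1/q.\<close>
  define t where "t = exp (- (2 / sqrt \<kappa>))"
  have \<mu>min_pos: "0 < \<mu>min" using Min_in[of "range \<mu>"] \<mu>_pos unfolding \<mu>min by auto
  have L_le: "L i \<le> Lmax" and \<mu>_le: "\<mu>min \<le> \<mu> i" and \<kappa>_le: "L i / \<mu> i \<le> \<kappa>max" for i
    unfolding Lmax \<mu>min \<kappa>max by simp_all
  have L\<mu>: "\<mu> i \<le> L i" for i by (rule worker.\<mu>_le_L[OF worker])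
  obtain i0 :: 'n where True by blast
  have Lmax_pos: "0 < Lmax" and Lmax_ge: "\<mu>min \<le> Lmax"
    using L_le[of i0] \<mu>_le[of i0] L\<mu>[of i0] \<mu>min_pos by linarith+
  have \<kappa>max_ge: "1 \<le> \<kappa>max"
    using \<kappa>_le[of i0] L\<mu>[of i0] \<mu>_pos[of i0] by (smt (verit) le_divide_eq_1_pos)
  have \<alpha>\<beta>: "0 < \<alpha>" "0 < \<beta>"
    using U_eig(2) N.\<sigma>1 \<mu>min_pos Lmax_pos by (simp_all add: \<alpha> \<beta>)
  have \<kappa>': "\<kappa> = \<beta> / \<alpha>" by (simp add: \<kappa> \<kappa>F \<zeta> \<alpha> \<beta>)
  have "\<alpha> \<le> \<beta>" unfolding \<alpha> \<beta> using N.\<sigma>1 U_eig(2) \<mu>min_pos Lmax_ge by (intro frac_le) auto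
  then have \<kappa>1: "1 \<le> \<kappa>" unfolding \<kappa>' using \<alpha>\<beta> by simp
  have \<sigma>N: "\<beta> * \<mu>min \<le> (norm sqrtU)\<^sup>2" using N.\<sigma>1_le_norm \<mu>min_pos by (simp add: \<beta>)
  have "norm sqrtU \<noteq> 0" using N.\<sigma>1_le_norm N.\<sigma>1(2) by auto
  then have c_pos: "0 < c" and \<gamma>_pos: "0 < \<gamma>"
    using \<alpha>\<beta> \<mu>min_pos sizes(2) by (simp_all add: c \<gamma>)
  have c\<kappa>: "\<kappa> * c \<le> t ^ (D + 1) / (1200 * real D)"
    using parameter_bound[OF \<alpha>\<beta> \<kappa>' \<mu>min_pos \<sigma>N, of "1200 * real D" "D + 1"] sizes(2)
    unfolding c t_def by (simp add: add.commute)
  have \<gamma>\<kappa>: "\<kappa> * \<gamma> \<le> t ^ D / (288 * real D)"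
    using parameter_bound[OF \<alpha>\<beta> \<kappa>' \<mu>min_pos \<sigma>N, of "288 * real D" D] sizes(2)
    unfolding \<gamma> t_def by simp
  have c1: "c \<le> 1 / 1200"
  proof -
    have "1 * c \<le> \<kappa> * c" using \<kappa>1 c_pos by (intro mult_right_mono) auto
    also have "\<dots> \<le> 1 / (1200 * 1)"
      using sizes(2) \<kappa>1 by (intro order_trans[OF c\<kappa>] frac_le power_le_one) (auto simp: t_def)
    finally show ?thesis by simp
  qed
  define \<Lambda> where "\<Lambda> = ln (2 * \<kappa>max / c)"
  have \<Lambda>: "1 \<le> \<Lambda>"
  proof -
    \<comment> \<open>The number 3 exceeds e, so the logarithm is at least 1, as needed to absorb
      the rounding of the number of epochs.\<close>
    have "3 * c \<le> 2 * \<kappa>max" using c1 \<kappa>max_ge by linarith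
    then have "3 \<le> 2 * \<kappa>max / c" using c_pos by (simp add: le_divide_eq)
    then have "exp 1 \<le> 2 * \<kappa>max / c" using exp_le by linarith
    then show ?thesis unfolding \<Lambda>_def using c_pos \<kappa>max_ge by (subst ln_ge_iff) auto
  qed
  note E_eq = E[folded \<Lambda>_def]
  have E_ge: "100 * (1 + sqrt (\<kappa>max / real m)) * ln (2 * \<kappa>max / c) \<le> real E"
  proof -
    have "100 * (1 + sqrt (\<kappa>max / real m)) * \<Lambda> \<le> C0 * (1 + sqrt (\<kappa>max / real m)) * \<Lambda>"
      using C0 \<kappa>max_ge \<Lambda> by (intro mult_right_mono) auto
    also have "\<dots> \<le> real E" unfolding E \<Lambda>_def by (rule real_nat_ceiling_ge)
    finally show ?thesis unfolding \<Lambda>_def .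
  qed
  interpret dlag U sqrtU \<sigma> M m J f L \<mu> D E \<kappa>max \<beta> \<alpha> \<kappa> c \<gamma> \<eta> "sqrt (10 * \<kappa>)" t
    x y \<theta> \<theta>hat \<xi> lam delay \<xi>opt
    using sizes(2) c_pos c\<kappa> \<gamma>_pos \<gamma>\<kappa> \<kappa>_le E_ge run aux \<xi>opt exp_rate_bound[OF \<kappa>1]
    unfolding s G
    by (intro dlag.intro dlag_axioms.intro N.network_axioms sampling worker)
       (auto simp: \<beta> \<alpha> \<mu>min Lmax \<kappa>' \<eta> t_def)
  define cd ctd where "cd = (\<lambda>d. weight d / 2)" and "ctd = (\<lambda>d. if d \<le> D then weight d / 2 else weight d)"
  have lyap: "lyapunov G \<eta> s \<kappa> D cd ctd \<xi>opt (\<lambda>k. \<xi> k \<omega>) (\<lambda>k. lam k \<omega>) k = lyap k \<omega>" for k \<omega>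
    unfolding s G cd_def ctd_def by (rule lyapunov_eq)
  define \<Delta> where "\<Delta> = expectation (lyap 0) / (2 * \<eta> * s * \<kappa>)"
  define C where "C = 1 + max 0 (ln \<Delta>)"
  have \<Delta>0: "0 \<le> \<Delta>"
    unfolding \<Delta>_def s using expectation_lyap_0_nonneg \<eta>_pos \<kappa>1 by (intro divide_nonneg_nonneg) auto
  have gap: "expectation (\<lambda>\<omega>. G (lam k \<omega>)) - (INF \<xi>. G \<xi>) \<le> (1 - 1 / sqrt (10 * \<kappa>)) ^ k * \<Delta>" for k
    unfolding G Inf_G \<Delta>_def s by (rule expectation_gap_le)
  have "\<exists>K. (\<forall>k\<ge>K. expectation (\<lambda>\<omega>. G (lam k \<omega>)) - (INF \<xi>. G \<xi>) \<le> \<epsilon>) \<and>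
      real K \<le> 10 * C * sqrt \<kappa> * ln (1 / \<epsilon>) \<and>
      real (CARD('n) * K * katyusha_evals m E)
        \<le> 100 * C0 * C * real CARD('n) * (real m + sqrt (real m * \<kappa>max)) * ln (2 * \<kappa>max / c) * sqrt \<kappa> * ln (1 / \<epsilon>)"
    if \<epsilon>: "0 < \<epsilon>" "\<epsilon> \<le> 1 / 2" for \<epsilon>
  proof -
    obtain K where K: "\<forall>k\<ge>K. expectation (\<lambda>\<omega>. G (lam k \<omega>)) - (INF \<xi>. G \<xi>) \<le> \<epsilon>"
      and K_le: "real K \<le> 10 * C * sqrt \<kappa> * ln (1 / \<epsilon>)"
      using iteration_count[OF \<kappa>1 \<Delta>0 gap \<epsilon>] unfolding C_def by blast
    have "real (CARD('n) * K * katyusha_evals m E)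
        \<le> 100 * (C0 * real CARD('n) * (real m + sqrt (real m * \<kappa>max)) * \<Lambda> * (C * sqrt \<kappa> * ln (1 / \<epsilon>)))"
      using K_le \<kappa>max_ge by (intro gradient_count sizes(1) C0 \<Lambda> E_eq) auto
    also have "\<dots> = 100 * C0 * C * real CARD('n) * (real m + sqrt (real m * \<kappa>max)) * ln (2 * \<kappa>max / c)
        * sqrt \<kappa> * ln (1 / \<epsilon>)"
      unfolding \<Lambda>_def by (simp only: mult_ac)
    finally show ?thesis using K K_le by blast
  qed
  moreover have "\<forall>d\<in>{1..D}. 0 < cd d" "\<forall>d\<ge>1. 0 < ctd d"
    using weight_pos by (simp_all add: cd_def ctd_def)
  moreover have "integrable M (lyap k)" "integrable M (\<lambda>\<omega>. G (lam k \<omega>))"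
    "expectation (lyap (k + 1)) \<le> (1 - 1 / sqrt (10 * \<kappa>)) * expectation (lyap k)" for k
    using integrable_lyap integrable_G expectation_lyap_step[of k] unfolding G by auto
  ultimately show ?thesis
    using c1 by (intro conjI exI[of _ cd] exI[of _ ctd]) (simp_all add: lyap Let_def \<Delta>_def C_def)
qed

end
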